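(* Let $X$ be the AR(2)-process with coefficients $(a_1,a_2)\in\mathbb{R}^2$, and assume $Y_1$ is Gaussian with mean zero and positive variance. Then: (1) $\lim_{N\to\infty}p_N=p_\infty>0$ exists if and only if $(a_1,a_2)\in C$; (2) $p_N\sim cN^{-1}$ for some constant $c>0$ if and only if $(a_1,a_2)=(0,1)$, and $p_N\asymp N^{-1/4}$ if and only if $(a_1,a_2)=(2,-1)$; (3) $p_N=N^{-1/2+o(1)}$ if and only if $(a_1,a_2)\in P$ and $|a_2|<1$; (4) $p_N\precsim e^{-\lambda N}$ for some $\lambda>0$ if and only if $(a_1,a_2)\in E$.
   Context: Let $(Y_n)_{n\ge1}$ be i.i.d. The AR(2)-process is $X_n=a_1X_{n-1}+a_2X_{n-2}+Y_n$ for $n\ge1$ with $X_n=0$ for $n\le0$; $p_N:=\mathbb{P}(\sup_{n=1,\dots,N}X_n\le0)$. Regions: $C:=\{a_1\ge2,\ a_1^2+4a_2>0\}\cup\{a_1\in(0,2),\ a_1+a_2>1\}\cup\{a_1^2+4a_2=0,\ a_1>2\}\cup\{a_1=0,\ a_2>1\}$; $P:=\{a_1+a_2=1,\ a_2\in[-1,1]\}$; $E:=\mathbb{R}^2\setminus(C\cup P)$. $f\sim g$ means $f/g\to1$; $f\precsim g$ means $\limsup f/g<\infty$; $f\asymp g$ means $f\precsim g$ and $g\precsim f$. *)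

theory Defs
  imports "HOL-Probability.Probability" "HOL-Library.Landau_Symbols"
begin

text \<open>AR(2) process driven by the innovation sequence y (index 0 of y is unused):
  ar2 a1 a2 y n = X_n, with X_0 = X_{-1} = 0 and
  X_n = a1 X_{n-1} + a2 X_{n-2} + y n for n \<ge> 1.\<close>
fun ar2 :: "real \<Rightarrow> real \<Rightarrow> (nat \<Rightarrow> real) \<Rightarrow> nat \<Rightarrow> real" where
  "ar2 a1 a2 y 0 = 0"
| "ar2 a1 a2 y (Suc 0) = y 1"
| "ar2 a1 a2 y (Suc (Suc n)) = a1 * ar2 a1 a2 y (Suc n) + a2 * ar2 a1 a2 y n + y (Suc (Suc n))"

definition persist_prob :: "'w measure \<Rightarrow> (nat \<Rightarrow> 'w \<Rightarrow> real) \<Rightarrow> real \<Rightarrow> real \<Rightarrow> nat \<Rightarrow> real" where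
  "persist_prob M Y a1 a2 N =
     measure M {\<omega> \<in> space M. \<forall>n\<in>{1..N}. ar2 a1 a2 (\<lambda>k. Y k \<omega>) n \<le> 0}"

definition regionC :: "(real \<times> real) set" where
  "regionC = {(a1, a2). a1 \<ge> 2 \<and> a1\<^sup>2 + 4 * a2 > 0}
           \<union> {(a1, a2). 0 < a1 \<and> a1 < 2 \<and> a1 + a2 > 1}
           \<union> {(a1, a2). a1\<^sup>2 + 4 * a2 = 0 \<and> a1 > 2}
           \<union> {(a1, a2). a1 = 0 \<and> a2 > 1}"

definition regionP :: "(real \<times> real) set" where
  "regionP = {(a1, a2). a1 + a2 = 1 \<and> -1 \<le> a2 \<and> a2 \<le> 1}"

definition regionE :: "(real \<times> real) set" where
  "regionE = UNIV - (regionC \<union> regionP)"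

end

theory Submission
  imports Defs "HOL-Real_Asymp.Real_Asymp"
begin

text \<open>
  The survival probability from an arbitrary state satisfies a one-step integral recursion, which
  reduces most regions to inductions on the number of steps. In region \<open>C\<close> an explosive invariant is
  kept with summable failure probabilities. In region \<open>E\<close> either a Lyapunov function contracts, or a
  bounded run of positive innovations makes the process positive from any state (complex roots), or a
  dominant negative root forces oscillation (anti-concentration).

  At \<open>(0, 1)\<close> the process consists of two interlaced independent random walks; splitting a walk at its
  first maximum gives \<open>q\<^sub>0 q\<^sub>n + \<dots> + q\<^sub>n q\<^sub>0 = 1\<close> for its persistence probabilities, hence
  \<open>q\<^sub>n = (- 1)\<^sup>n ((- 1 / 2) gchoose n)\<close>. On the rest of the unit-root segment the process is such a walk
  up to an error of size \<open>sqrt (ln N)\<close>, which costs a factor \<open>exp (O (sqrt (ln N)))\<close>.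

  At \<open>(2, - 1)\<close> the process is an integrated random walk. Distribute the initial velocity by Lebesgue
  measure and split at an interior maximum: time reversal turns both sides into persistence events,
  and the velocities with an interior maximum have mass of order \<open>sqrt n\<close>. Hence the convolution
  of \<open>p\<close> with itself is of order \<open>sqrt n\<close>.
\<close>

section \<open>Gaussian noise and survival probabilities\<close>

definition gauss :: "real measure" where
  "gauss = density lborel (\<lambda>x. ennreal (std_normal_density x))"

lemma sets_gauss [simp, measurable_cong]: "sets gauss = sets borel"
  by (simp add: gauss_def)

lemma space_gauss [simp]: "space gauss = UNIV"
  by (simp add: gauss_def)

lemma prob_space_gauss: "prob_space gauss"
  unfolding gauss_def by (rule prob_space_normal_density) simp

interpretation gauss: prob_space gauss by (rule prob_space_gauss)

lemmas emeasure_gauss_eq = gauss.emeasure_eq_measure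

interpretation noise: sequence_space gauss
  by unfold_locales

abbreviation noise :: "(nat \<Rightarrow> real) measure" where
  "noise \<equiv> PiM UNIV (\<lambda>_. gauss)"

lemma space_noise [simp]: "space noise = UNIV"
  by (simp add: space_PiM)

lemma noise_event: "Measurable.pred noise P \<Longrightarrow> {y. P y} \<in> sets noise"
  by (simp add: pred_def)

text \<open>\<open>x\<close> is the current and \<open>z\<close> the previous value of the process. Innovations are indexed from 0, so
  \<open>y (k - 1)\<close> is the normalised \<open>Y\<^sub>k\<close>.\<close>

primrec surv :: "real \<Rightarrow> real \<Rightarrow> nat \<Rightarrow> real \<Rightarrow> real \<Rightarrow> ennreal" where
  "surv a b 0 x z = 1"
| "surv a b (Suc n) x z =
     (\<integral>\<^sup>+u. indicator {..0} (a * x + b * z + u) * surv a b n (a * x + b * z + u) x \<partial>gauss)"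

fun arp :: "real \<Rightarrow> real \<Rightarrow> real \<Rightarrow> real \<Rightarrow> (nat \<Rightarrow> real) \<Rightarrow> nat \<Rightarrow> real" where
  "arp a b x z y 0 = x"
| "arp a b x z y (Suc 0) = a * x + b * z + y 0"
| "arp a b x z y (Suc (Suc n)) = a * arp a b x z y (Suc n) + b * arp a b x z y n + y (Suc n)"

lemma arp_shift:
  "arp a b x z y (Suc n) = arp a b (a * x + b * z + y 0) x (\<lambda>k. y (Suc k)) n"
  by (induction n rule: induct_nat_012) simp_all

lemma measurable_surv' [measurable]:
  "(\<lambda>p. surv a b n (fst p) (snd p)) \<in> borel_measurable (borel \<Otimes>\<^sub>M borel)"
proof (induction n)
  case (Suc n)
  note Suc[measurable]
  have [measurable]: "(\<lambda>p. surv a b n (f p) (g p)) \<in> borel_measurable N"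
    if [measurable]: "f \<in> borel_measurable N" "g \<in> borel_measurable N" for f g and N :: "'c measure"
    using measurable_compose[OF measurable_Pair[OF that] Suc] by simp
  show ?case by simp
qed simp

lemma measurable_surv [measurable]:
  assumes "f \<in> borel_measurable N" "g \<in> borel_measurable N"
  shows "(\<lambda>p. surv a b n (f p) (g p)) \<in> borel_measurable N"
  using measurable_compose[OF measurable_Pair[OF assms] measurable_surv'] by simp

lemma measurable_arp [measurable]: "(\<lambda>y. arp a b x z y n) \<in> borel_measurable noise"
  by (induction n rule: induct_nat_012) simp_all

lemma nn_integral_noise_iter:
  assumes [measurable]: "f \<in> borel_measurable noise"
  shows "(\<integral>\<^sup>+y. f y \<partial>noise) = (\<integral>\<^sup>+u. \<integral>\<^sup>+y. f (case_nat u y) \<partial>noise \<partial>gauss)"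
  by (subst noise.PiM_iter[symmetric])
     (simp add: nn_integral_distr noise.P.nn_integral_fst[symmetric] case_prod_beta)

lemma nn_integral_noise_comb:
  assumes [measurable]: "f \<in> borel_measurable noise"
  shows "(\<integral>\<^sup>+y. f y \<partial>noise) = (\<integral>\<^sup>+a. \<integral>\<^sup>+b. f (comb_seq k a b) \<partial>noise \<partial>noise)"
  by (subst noise.PiM_comb_seq[symmetric, of k])
     (simp add: nn_integral_distr noise.P.nn_integral_fst[symmetric] case_prod_beta)

lemma surv_eq_emeasure:
  "surv a b n x z = emeasure noise {y. \<forall>i\<in>{1..n}. arp a b x z y i \<le> 0}"
proof (induction n arbitrary: x z)
  case 0
  show ?case using noise.emeasure_space_1 by simp
next
  case (Suc n)
  have "emeasure noise {y. \<forall>i\<in>{1..Suc n}. arp a b x z y i \<le> 0} =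
    (\<integral>\<^sup>+y. indicator {y. \<forall>i\<in>{1..Suc n}. arp a b x z y i \<le> 0} y \<partial>noise)"
    by (subst nn_integral_indicator) (auto intro!: noise_event)
  also have "\<dots> = (\<integral>\<^sup>+u. \<integral>\<^sup>+y. indicator {y. \<forall>i\<in>{1..Suc n}. arp a b x z y i \<le> 0} (case_nat u y) \<partial>noise \<partial>gauss)"
    by (rule nn_integral_noise_iter) (auto intro!: noise_event borel_measurable_indicator)
  also have "\<dots> = (\<integral>\<^sup>+u. \<integral>\<^sup>+y. indicator {..0} (a * x + b * z + u) *
      indicator {y. \<forall>i\<in>{1..n}. arp a b (a * x + b * z + u) x y i \<le> 0} y \<partial>noise \<partial>gauss)"
  proof (intro nn_integral_cong)
    fix u y
    have *: "(\<forall>i\<in>{1..Suc n}. P i) \<longleftrightarrow> P 1 \<and> (\<forall>i\<in>{1..n}. P (Suc i))" for P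
    proof (intro iffI ballI)
      fix i assume P: "P 1 \<and> (\<forall>i\<in>{1..n}. P (Suc i))" and i: "i \<in> {1..Suc n}"
      show "P i" using P i by (cases i; cases "i = 1") auto
    qed auto
    show "(indicator {y. \<forall>i\<in>{1..Suc n}. arp a b x z y i \<le> 0} (case_nat u y) :: ennreal) =
      indicator {..0} (a * x + b * z + u) *
      indicator {y. \<forall>i\<in>{1..n}. arp a b (a * x + b * z + u) x y i \<le> 0} y"
      unfolding * by (auto simp: indicator_def arp_shift)
  qed
  also have "\<dots> = surv a b (Suc n) x z"
    by (simp add: nn_integral_cmult Suc nn_integral_indicator[OF noise_event])
  finally show ?case by simp
qed

lemma distr_noise_iid:
  assumes "prob_space M" "prob_space.indep_vars M (\<lambda>_. borel) Z (UNIV :: nat set)"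
    and "\<And>n. distr M borel (Z n) = gauss"
  shows "distr M noise (\<lambda>\<omega> n. Z n \<omega>) = noise"
proof -
  interpret prob_space M by fact
  have rv: "Z n \<in> borel_measurable M" for n
    using assms(2) by (simp add: indep_vars_def)
  have "distr M (PiM UNIV (\<lambda>_. borel)) (\<lambda>x. \<lambda>i\<in>UNIV. Z i x) = PiM UNIV (\<lambda>i. distr M borel (Z i))"
    using assms(2) by (subst (asm) indep_vars_iff_distr_eq_PiM') (auto simp: rv)
  then show ?thesis
    unfolding assms(3) by (simp add: restrict_def cong: distr_cong sets_PiM_cong)
qed

lemma ar2_eq_arp: "ar2 a b (\<lambda>k. s * y (k - 1)) n = s * arp a b 0 0 y n"
  by (induction n rule: induct_nat_012) (simp_all add: algebra_simps)

lemma (in prob_space) indep_vars_reindex_inj: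
  assumes "indep_vars M' X I" "inj f" "range f \<subseteq> I"
  shows "indep_vars (\<lambda>i. M' (f i)) (\<lambda>i. X (f i)) UNIV"
  unfolding indep_vars_def2 indep_sets_def
proof (intro conjI allI impI ballI)
  fix i
  show "random_variable (M' (f i)) (X (f i))"
    using assms by (auto simp: indep_vars_def2)
  then show "{X (f i) -` A \<inter> space M |A. A \<in> sets (M' (f i))} \<subseteq> events"
    by (auto intro!: measurable_sets)
next
  fix J A
  assume J: "J \<noteq> {}" "finite J"
    and A: "A \<in> (\<Pi> i\<in>J. {X (f i) -` A \<inter> space M |A. A \<in> sets (M' (f i))})"
  let ?A = "\<lambda>j. A (inv f j)"
  have "prob (\<Inter>j\<in>f ` J. ?A j) = (\<Prod>j\<in>f ` J. prob (?A j))"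
  proof (rule indep_setsD[where I = I and F = "\<lambda>i. {X i -` A \<inter> space M |A. A \<in> sets (M' i)}"])
    show "\<forall>j\<in>f ` J. ?A j \<in> {X j -` A \<inter> space M |A. A \<in> sets (M' j)}"
      using A assms(2) by (auto simp: Pi_iff)
  qed (use assms J in \<open>auto simp: indep_vars_def2\<close>)
  then show "prob (\<Inter>j\<in>J. A j) = (\<Prod>j\<in>J. prob (A j))"
    using assms(2) by (simp add: prod.reindex inj_on_subset)
qed

lemma persist_prob_eq_surv:
  assumes "prob_space M" "prob_space.indep_vars M (\<lambda>_. borel) Y {1..}" "\<sigma> > 0"
    and "\<And>n. n \<ge> 1 \<Longrightarrow> distributed M lborel (Y n) (\<lambda>x. ennreal (normal_density 0 \<sigma> x))"
  shows "persist_prob M Y a b N = enn2real (surv a b N 0 0)"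
proof -
  interpret prob_space M by fact
  define Z where "Z n \<omega> = Y (Suc n) \<omega> / \<sigma>" for n \<omega>
  have "indep_vars (\<lambda>_. borel) (\<lambda>n. Y (Suc n)) UNIV"
    by (rule indep_vars_reindex_inj[OF assms(2)]) auto
  then have iv: "indep_vars (\<lambda>_. borel) Z UNIV"
    unfolding Z_def using indep_vars_compose2[of "\<lambda>_. borel" "\<lambda>n. Y (Suc n)" UNIV "\<lambda>_ x. x / \<sigma>" "\<lambda>_. borel"] by auto
  have di: "distr M borel (Z n) = gauss" for n
  proof -
    have "distributed M lborel (\<lambda>x. (Y (Suc n) x - 0) / \<sigma>) (\<lambda>x. ennreal (normal_density ((0 - 0)/\<sigma>) (\<sigma>/\<sigma>) x))"
      using normal_standard_normal_convert[of \<sigma> "Y (Suc n)" 0] assms(4)[of "Suc n"] assms(3) by simp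
    then have "distributed M lborel (Z n) (\<lambda>x. ennreal (std_normal_density x))"
      using assms(3) by (simp add: Z_def[abs_def])
    then show ?thesis
      unfolding distributed_def gauss_def by (metis distr_cong sets_lborel)
  qed
  have law: "distr M noise (\<lambda>\<omega> n. Z n \<omega>) = noise"
    by (rule distr_noise_iid) (use iv di assms(1) in auto)
  have [measurable]: "Z n \<in> borel_measurable M" for n
    using iv by (simp add: indep_vars_def)
  have m: "(\<lambda>\<omega> n. Z n \<omega>) \<in> measurable M noise"
    by (rule measurable_PiM_single') auto
  have "surv a b N 0 0 = emeasure (distr M noise (\<lambda>\<omega> n. Z n \<omega>)) {y. \<forall>i\<in>{1..N}. arp a b 0 0 y i \<le> 0}"
    unfolding law by (rule surv_eq_emeasure)
  also have "\<dots> = emeasure M ((\<lambda>\<omega> n. Z n \<omega>) -` {y. \<forall>i\<in>{1..N}. arp a b 0 0 y i \<le> 0} \<inter> space M)"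
    by (rule emeasure_distr[OF m]) (auto intro!: noise_event)
  also have "(\<lambda>\<omega> n. Z n \<omega>) -` {y. \<forall>i\<in>{1..N}. arp a b 0 0 y i \<le> 0} \<inter> space M =
    {\<omega> \<in> space M. \<forall>n\<in>{1..N}. ar2 a b (\<lambda>k. Y k \<omega>) n \<le> 0}"
  proof -
    have "ar2 a b (\<lambda>k. Y k \<omega>) n = \<sigma> * arp a b 0 0 (\<lambda>n. Z n \<omega>) n" for n \<omega>
    proof -
      have "ar2 a b (\<lambda>k. Y k \<omega>) n = ar2 a b (\<lambda>k. \<sigma> * Z (k - 1) \<omega>) n"
        using assms(3) by (induction n rule: induct_nat_012) (simp_all add: Z_def)
      then show ?thesis using ar2_eq_arp by simp
    qed
    then show ?thesis using assms(3) by (auto simp: mult_le_0_iff)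
  qed
  finally show ?thesis by (simp add: persist_prob_def measure_def)
qed

lemma nn_integral_gauss:
  assumes "f \<in> borel_measurable borel"
  shows "(\<integral>\<^sup>+u. f u \<partial>gauss) = (\<integral>\<^sup>+u. ennreal (std_normal_density u) * f u \<partial>lborel)"
  using assms by (simp add: gauss_def nn_integral_density)

lemma emeasure_gauss:
  assumes "A \<in> sets borel"
  shows "emeasure gauss A = (\<integral>\<^sup>+u. ennreal (std_normal_density u) * indicator A u \<partial>lborel)"
  using assms by (simp add: gauss_def emeasure_density)

abbreviation tail_bound :: "real \<Rightarrow> real" where
  "tail_bound L \<equiv> sqrt 2 * exp (- L\<^sup>2 / 4)"

lemma gauss_tail: "emeasure gauss {u. L < \<bar>u\<bar>} \<le> ennreal (tail_bound L)" if "L \<ge> 0"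
proof -
  have "emeasure gauss {u. L < \<bar>u\<bar>} = (\<integral>\<^sup>+u. ennreal (std_normal_density u) * indicator {u. L < \<bar>u\<bar>} u \<partial>lborel)"
    by (rule emeasure_gauss) simp
  also have "\<dots> \<le> (\<integral>\<^sup>+u. ennreal (tail_bound L) * ennreal (normal_density 0 (sqrt 2) u) \<partial>lborel)"
  proof (intro nn_integral_mono)
    fix u :: real
    show "ennreal (std_normal_density u) * indicator {u. L < \<bar>u\<bar>} u \<le>
      ennreal (tail_bound L) * ennreal (normal_density 0 (sqrt 2) u)"
    proof (cases "L < \<bar>u\<bar>")
      case True
      then have "L\<^sup>2 \<le> u\<^sup>2" using that by (simp add: abs_le_square_iff[symmetric])
      then have "exp (- u\<^sup>2 / 2) \<le> exp (- L\<^sup>2 / 4) * exp (- u\<^sup>2 / 4)"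
        by (simp add: exp_add[symmetric] field_simps)
      then have "exp (- u\<^sup>2 / 2) / sqrt (2 * pi) \<le> exp (- L\<^sup>2 / 4) * exp (- u\<^sup>2 / 4) / sqrt (2 * pi)"
        by (rule divide_right_mono) simp
      also have "\<dots> = tail_bound L * normal_density 0 (sqrt 2) u"
        by (simp add: normal_density_def real_sqrt_mult field_simps)
      finally have "std_normal_density u \<le> tail_bound L * normal_density 0 (sqrt 2) u"
        by (simp add: normal_density_def)
      then show ?thesis using True by (simp add: ennreal_mult'[symmetric] ennreal_leI)
    qed simp
  qed
  also have "\<dots> = ennreal (tail_bound L) * (\<integral>\<^sup>+u. ennreal (normal_density 0 (sqrt 2) u) \<partial>lborel)"
    by (rule nn_integral_cmult) simp
  also have "(\<integral>\<^sup>+u. ennreal (normal_density 0 (sqrt 2) u) \<partial>lborel) = 1"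
  proof -
    interpret N: prob_space "density lborel (normal_density 0 (sqrt 2))"
      by (rule prob_space_normal_density) simp
    show ?thesis using N.emeasure_space_1 by (simp add: emeasure_density)
  qed
  finally show ?thesis by simp
qed

lemma gauss_ge_prob: "ennreal (1 - 6 / L\<^sup>2) \<le> emeasure gauss {..L}" if "L > 0"
proof -
  have "tail_bound L \<le> (3/2) * (1 / (L\<^sup>2 / 4))"
  proof (rule mult_mono)
    show "sqrt 2 \<le> 3/2" by (rule real_le_lsqrt) (auto simp: power2_eq_square)
    have "L\<^sup>2 / 4 \<le> exp (L\<^sup>2 / 4)" using exp_ge_add_one_self[of "L\<^sup>2 / 4"] by linarith
    then show "exp (- L\<^sup>2 / 4) \<le> 1 / (L\<^sup>2 / 4)"
      using that by (simp add: exp_minus field_simps)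
  qed auto
  also have "\<dots> = 6 / L\<^sup>2" by simp
  finally have 1: "emeasure gauss {u. L < \<bar>u\<bar>} \<le> ennreal (6 / L\<^sup>2)"
    using gauss_tail[of L] that by (meson ennreal_leI less_imp_le order_trans)
  have "1 = emeasure gauss ({..L} \<union> {L<..})"
    using gauss.emeasure_space_1 by (simp add: ivl_disj_un Un_def not_le[symmetric])
  also have "\<dots> \<le> emeasure gauss {..L} + emeasure gauss {L<..}"
    by (rule emeasure_subadditive) auto
  also have "emeasure gauss {L<..} \<le> emeasure gauss {u. L < \<bar>u\<bar>}"
    by (rule emeasure_mono) auto
  also note 1
  finally have "1 \<le> emeasure gauss {..L} + ennreal (6 / L\<^sup>2)" by simp
  then have "1 \<le> gauss.prob {..L} + 6 / L\<^sup>2"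
    by (simp add: emeasure_gauss_eq ennreal_plus[symmetric] del: ennreal_plus)
  then show ?thesis
    by (simp add: emeasure_gauss_eq ennreal_leI)
qed

lemma gauss_Icc_pos: "0 < emeasure gauss {a..b}" if "a < b"
proof -
  define m where "m = max \<bar>a\<bar> \<bar>b\<bar>"
  have "0 < ennreal (std_normal_density m) * ennreal (b - a)"
    using that by (simp add: ennreal_zero_less_mult_iff normal_density_pos)
  also have "\<dots> = (\<integral>\<^sup>+u. ennreal (std_normal_density m) * indicator {a..b} u \<partial>lborel)"
    using that by (simp add: nn_integral_cmult_indicator)
  also have "\<dots> \<le> (\<integral>\<^sup>+u. ennreal (std_normal_density u) * indicator {a..b} u \<partial>lborel)"
  proof (intro nn_integral_mono)
    fix u :: real
    show "ennreal (std_normal_density m) * indicator {a..b} u \<le> ennreal (std_normal_density u) * indicator {a..b} u"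
    proof (cases "u \<in> {a..b}")
      case True
      then have "\<bar>u\<bar> \<le> \<bar>m\<bar>" by (auto simp: m_def)
      then have "u\<^sup>2 \<le> m\<^sup>2" by (simp add: abs_le_square_iff)
      then show ?thesis using True by (simp add: normal_density_def divide_right_mono ennreal_leI)
    qed simp
  qed
  also have "\<dots> = emeasure gauss {a..b}" by (simp add: emeasure_gauss)
  finally show ?thesis .
qed

lemma gauss_atMost_pos: "0 < emeasure gauss {..b}"
  by (rule less_le_trans[OF gauss_Icc_pos[of "b - 1" b]]) (auto intro!: emeasure_mono)

lemma gauss_prob_less_1:
  assumes "A \<in> sets borel" "A \<inter> {a..b} = {}" "a < b"
  shows "gauss.prob A < 1"
proof -
  have "gauss.prob {a..b} > 0"
    using gauss_Icc_pos[OF assms(3)] by (simp add: emeasure_gauss_eq)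
  moreover have "gauss.prob A + gauss.prob {a..b} = gauss.prob (A \<union> {a..b})"
    using assms by (intro gauss.finite_measure_Union[symmetric]) auto
  ultimately show ?thesis using gauss.prob_le_1[of "A \<union> {a..b}"] by linarith
qed

lemma gauss_Icc_le: "emeasure gauss {a..b} \<le> ennreal ((b - a) / 2)" if "a \<le> b"
proof -
  have d: "std_normal_density u \<le> 1 / 2" for u :: real
  proof -
    have "2 \<le> sqrt (2 * pi)" using pi_gt3 by (intro real_le_rsqrt) auto
    then have "exp (- u\<^sup>2 / 2) / sqrt (2 * pi) \<le> 1 / 2"
      by (intro frac_le) auto
    then show ?thesis by (simp add: normal_density_def)
  qed
  have "emeasure gauss {a..b} = (\<integral>\<^sup>+u. ennreal (std_normal_density u) * indicator {a..b} u \<partial>lborel)"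
    by (simp add: emeasure_gauss)
  also have "\<dots> \<le> (\<integral>\<^sup>+u. ennreal (1/2) * indicator {a..b} u \<partial>lborel)"
    by (intro nn_integral_mono mult_right_mono ennreal_leI d) auto
  also have "\<dots> = ennreal ((b - a) / 2)"
    using that by (simp add: nn_integral_cmult_indicator ennreal_mult'[symmetric] del: ennreal_half)
  finally show ?thesis .
qed

lemma gauss_second_moment: "(\<integral>\<^sup>+u. ennreal ((u + m)\<^sup>2) \<partial>gauss) = ennreal (1 + m\<^sup>2)"
proof -
  have 2: "has_bochner_integral lborel (\<lambda>x. std_normal_density x * x ^ 2) 1"
    using std_normal_moment_even[of 1] by (simp add: fact_2)
  have 1: "has_bochner_integral lborel (\<lambda>x. std_normal_density x * x) 0"
    using std_normal_moment_odd[of 0] by simp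
  have 0: "has_bochner_integral lborel (\<lambda>x. std_normal_density x) 1"
    using std_normal_moment_even[of 0] by simp
  have "has_bochner_integral lborel (\<lambda>x. std_normal_density x * x ^ 2 + (2 * m) * (std_normal_density x * x) + m\<^sup>2 * std_normal_density x) (1 + (2 * m) * 0 + m\<^sup>2 * 1)"
    by (intro has_bochner_integral_add has_bochner_integral_mult_right 0 1 2)
  then have "has_bochner_integral lborel (\<lambda>x. std_normal_density x * (x + m)\<^sup>2) (1 + m\<^sup>2)"
    by (simp add: power2_eq_square algebra_simps)
  then have "(\<integral>\<^sup>+u. ennreal (std_normal_density u * (u + m)\<^sup>2) \<partial>lborel) = ennreal (1 + m\<^sup>2)"
    by (subst nn_integral_eq_integral) (auto simp: has_bochner_integral_iff)
  then show ?thesis by (subst nn_integral_gauss) (auto simp: ennreal_mult'[symmetric])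
qed

lemma gauss_first_abs_moment: "(\<integral>\<^sup>+u. ennreal \<bar>u\<bar> \<partial>gauss) \<le> 1"
proof -
  have "(\<integral>\<^sup>+u. ennreal \<bar>u\<bar> \<partial>gauss) \<le> (\<integral>\<^sup>+u. ennreal (1/2) * 1 + ennreal (1/2) * ennreal ((u + 0)\<^sup>2) \<partial>gauss)"
  proof (intro nn_integral_mono)
    fix u :: real
    have "0 \<le> (\<bar>u\<bar> - 1)\<^sup>2" by simp
    then have "\<bar>u\<bar> \<le> 1/2 + 1/2 * u\<^sup>2" by (simp add: power2_diff)
    then show "ennreal \<bar>u\<bar> \<le> ennreal (1/2) * 1 + ennreal (1/2) * ennreal ((u + 0)\<^sup>2)"
      by (simp add: ennreal_mult'[symmetric] ennreal_plus[symmetric] ennreal_leI del: ennreal_plus ennreal_half)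
  qed
  also have "\<dots> = ennreal (1/2) * 1 + ennreal (1/2) * ennreal (1 + 0\<^sup>2)"
    unfolding gauss_second_moment[symmetric]
    by (subst nn_integral_add) (simp_all add: nn_integral_cmult gauss.emeasure_space_1[simplified])
  also have "\<dots> = 1" by (simp add: ennreal_plus[symmetric] del: ennreal_plus ennreal_half)
  finally show ?thesis .
qed

section \<open>Explosive coefficients\<close>

lemma surv_ge_step:
  assumes "A \<in> sets borel"
    and "\<And>u. u \<in> A \<Longrightarrow> a * x + b * z + u \<le> 0 \<and> c \<le> surv a b n (a * x + b * z + u) x"
  shows "c * emeasure gauss A \<le> surv a b (Suc n) x z"
proof -
  have "c * emeasure gauss A = (\<integral>\<^sup>+u. c * indicator A u \<partial>gauss)"
    using assms(1) by (simp add: nn_integral_cmult_indicator)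
  also have "\<dots> \<le> surv a b (Suc n) x z"
    using assms(2) by (auto intro!: nn_integral_mono simp: indicator_def)
  finally show ?thesis .
qed

lemma surv_lower_of_invariant:
  fixes Inv :: "nat \<Rightarrow> real \<Rightarrow> real \<Rightarrow> bool"
  assumes q: "q > 1" and c: "c > 0"
    and step: "\<And>m x z u. Inv m x z \<Longrightarrow> u \<le> c * q ^ m \<Longrightarrow>
      a * x + b * z + u \<le> 0 \<and> Inv (Suc m) (a * x + b * z + u) x"
  obtains m0 where "\<And>n x z. Inv m0 x z \<Longrightarrow> ennreal (1/2) \<le> surv a b n x z"
proof -
  define r where "r = 1 / q\<^sup>2"
  have r: "0 < r" "r < 1" using q by (auto simp: r_def power_less_one_iff field_simps)
  define e where "e m = 6 / (c * q ^ m)\<^sup>2" for m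
  have e: "e m = 6 / c\<^sup>2 * r ^ m" for m
    by (simp add: e_def r_def power_mult_distrib power_divide power_mult[symmetric] mult.commute)
  have e0: "e m \<ge> 0" for m by (simp add: e_def)
  have low: "ennreal (1 - (\<Sum>i<n. e (m + i))) \<le> surv a b n x z" if "Inv m x z" for n m x z
    using that
  proof (induction n arbitrary: m x z)
    case (Suc n)
    define A where "A = 1 - (\<Sum>i<n. e (Suc m + i))"
    have A1: "A \<le> 1" using e0 by (auto simp: A_def sum_nonneg)
    have "(\<Sum>i<Suc n. e (m + i)) = e m + (\<Sum>i<n. e (Suc m + i))"
      unfolding sum.lessThan_Suc_shift by simp
    then have "1 - (\<Sum>i<Suc n. e (m + i)) = A - e m" by (simp add: A_def)
    moreover have "ennreal (A - e m) \<le> ennreal A * ennreal (1 - e m)"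
    proof (cases "A \<le> e m")
      case True
      then show ?thesis by (simp add: ennreal_neg)
    next
      case False
      then have "0 \<le> A" "e m \<le> 1" using e0[of m] A1 by linarith+
      moreover have "A - e m \<le> A * (1 - e m)"
        using A1 e0[of m] mult_right_mono[of A 1 "e m"] by (simp add: algebra_simps)
      ultimately show ?thesis by (simp add: ennreal_mult[symmetric] ennreal_leI)
    qed
    moreover have "ennreal A * ennreal (1 - e m) \<le> ennreal A * emeasure gauss {..c * q ^ m}"
      unfolding e_def using c q by (intro mult_left_mono gauss_ge_prob) auto
    moreover have "ennreal A * emeasure gauss {..c * q ^ m} \<le> surv a b (Suc n) x z"
    proof (rule surv_ge_step)
      fix u assume "u \<in> {..c * q ^ m}"
      with step[OF Suc.prems, of u] have "a * x + b * z + u \<le> 0" "Inv (Suc m) (a * x + b * z + u) x"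
        by auto
      with Suc.IH show "a * x + b * z + u \<le> 0 \<and> ennreal A \<le> surv a b n (a * x + b * z + u) x"
        unfolding A_def by blast
    qed simp
    ultimately show ?case by (metis order_trans)
  qed simp
  have "(\<lambda>m. 6 / c\<^sup>2 / (1 - r) * r ^ m) \<longlonglongrightarrow> 6 / c\<^sup>2 / (1 - r) * 0"
    using r by (intro tendsto_intros LIMSEQ_realpow_zero) auto
  then have "\<forall>\<^sub>F m in sequentially. 6 / c\<^sup>2 / (1 - r) * r ^ m < 1/2"
    by (intro order_tendstoD) auto
  then obtain m0 where m0: "6 / c\<^sup>2 / (1 - r) * r ^ m0 < 1/2"
    by (auto simp: eventually_sequentially)
  have "(\<Sum>i<n. e (m0 + i)) \<le> 1/2" for n
  proof -
    have "(\<Sum>i<n. e (m0 + i)) = 6 / c\<^sup>2 * r ^ m0 * (\<Sum>i<n. r ^ i)"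
      unfolding e sum_distrib_left by (intro sum.cong) (simp_all add: power_add)
    also have "\<dots> \<le> 6 / c\<^sup>2 * r ^ m0 * (1 / (1 - r))"
    proof (rule mult_left_mono)
      show "(\<Sum>i<n. r ^ i) \<le> 1 / (1 - r)"
        using r by (simp add: sum_gp_strict divide_right_mono)
    qed (use r in auto)
    also have "\<dots> < 1/2" using m0 by (simp add: mult_ac)
    finally show ?thesis by simp
  qed
  then have half: "ennreal (1/2) \<le> ennreal (1 - (\<Sum>i<n. e (m0 + i)))" for n
    by (intro ennreal_leI) (smt (verit) field_sum_of_halves)
  show thesis
    by (rule that[of m0]) (use half low in \<open>blast intro: order_trans\<close>)
qed

lemma surv_antimono: "surv a b (Suc n) x z \<le> surv a b n x z"
  unfolding surv_eq_emeasure by (rule emeasure_mono) (auto intro!: noise_event)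

lemma surv_antimono': "m \<le> n \<Longrightarrow> surv a b n x z \<le> surv a b m x z"
  by (rule lift_Suc_antimono_le) (rule surv_antimono)

lemma surv_le_1: "surv a b n x z \<le> 1"
  using surv_antimono'[of 0 n a b x z] by simp

lemma surv_lower_of_two_steps:
  assumes "\<And>n u1 u2. u1 \<le> k \<Longrightarrow> u2 \<le> k \<Longrightarrow>
    u1 \<le> 0 \<and> a * u1 + u2 \<le> 0 \<and> ennreal (1/2) \<le> surv a b n (a * u1 + u2) u1"
  shows "\<exists>\<delta>>0. \<forall>n. ennreal \<delta> \<le> surv a b n 0 0"
proof -
  define p where "p = gauss.prob {..k}"
  have p: "p > 0" using gauss_atMost_pos[of k] by (simp add: p_def emeasure_gauss_eq)
  have "ennreal (1/2 * p * p) \<le> surv a b n 0 0" for n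
  proof -
    have "ennreal (1/2) * emeasure gauss {..k} \<le> surv a b (Suc n) u 0" if "u \<le> k" for u
      by (rule surv_ge_step) (use assms that in auto)
    then have "ennreal (1/2) * emeasure gauss {..k} * emeasure gauss {..k} \<le> surv a b (Suc (Suc n)) 0 0"
      by (intro surv_ge_step) (use assms in auto)
    also have "\<dots> \<le> surv a b n 0 0" by (rule surv_antimono') simp
    finally show ?thesis
      using p unfolding p_def emeasure_gauss_eq by (simp add: ennreal_mult'[symmetric] del: ennreal_half)
  qed
  then show ?thesis using p by (intro exI[of _ "1/2 * p * p"]) auto
qed

lemma surv_lower_regionC:
  assumes "(a, b) \<in> regionC"
  shows "\<exists>\<delta>>0. \<forall>n. ennreal \<delta> \<le> surv a b n 0 0"
proof -
  define d where "d = sqrt (a\<^sup>2 + 4 * b)"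
  define s1 where "s1 = (a + d) / 2"
  define s2 where "s2 = (a - d) / 2"
  have a0: "a \<ge> 0" using assms by (auto simp: regionC_def)
  have disc: "a\<^sup>2 + 4 * b \<ge> 0"
  proof (cases "a < 2 \<and> a > 0")
    case True
    then have "b > 1 - a" using assms by (auto simp: regionC_def)
    then have "a\<^sup>2 + 4 * b \<ge> (a - 2)\<^sup>2" by (simp add: power2_eq_square algebra_simps)
    then show ?thesis by (meson order_trans zero_le_power2)
  qed (use assms in \<open>auto simp: regionC_def\<close>)
  then have d2: "d\<^sup>2 = a\<^sup>2 + 4 * b" and d0: "d \<ge> 0" by (auto simp: d_def)
  have s1: "s1 > 1"
  proof -
    have "d > 2 - a"
    proof (cases "a < 2")
      case True
      then have "b > 1 - a" using assms by (auto simp: regionC_def)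
      then have "a\<^sup>2 + 4 * b > (2 - a)\<^sup>2" by (simp add: power2_eq_square algebra_simps)
      then show ?thesis unfolding d_def by (rule real_less_rsqrt)
    next
      case False
      have "d > 0 \<or> a > 2" using assms False by (auto simp: regionC_def d_def)
      then show ?thesis using False d0 by linarith
    qed
    then show ?thesis by (simp add: s1_def)
  qed
  have sum: "a = s1 + s2" by (simp add: s1_def s2_def field_simps)
  have prod: "b = - (s1 * s2)"
    using d2 by (simp add: s1_def s2_def field_simps power2_eq_square)
  define q where "q = (1 + s1) / 2"
  have q: "1 < q" "q < s1" using s1 by (auto simp: q_def)
  show ?thesis
  proof (cases "b \<ge> 0")
    case True
    define c where "c = a * q + b - q\<^sup>2"
    have "s2 \<le> 0" using True prod s1 by (smt (verit) mult_pos_pos)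
    then have "(s1 - q) * (q - s2) > 0" using q by (intro mult_pos_pos) auto
    then have c: "c > 0" by (simp add: c_def sum prod power2_eq_square algebra_simps)
    obtain m0 where m0: "\<And>n x z. x \<le> - (q ^ Suc m0) \<and> z \<le> - (q ^ m0) \<Longrightarrow> ennreal (1/2) \<le> surv a b n x z"
    proof (rule surv_lower_of_invariant[of q c "\<lambda>m x z. x \<le> - (q ^ Suc m) \<and> z \<le> - (q ^ m)" a b])
      fix m x z u assume *: "x \<le> - (q ^ Suc m) \<and> z \<le> - (q ^ m)" "u \<le> c * q ^ m"
      have "a * x \<le> a * (- (q ^ Suc m))" "b * z \<le> b * (- (q ^ m))"
        using * a0 True by (intro mult_left_mono; simp)+
      then have "a * x + b * z + u \<le> - (q ^ Suc (Suc m))"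
        using *(2) by (simp add: c_def power2_eq_square algebra_simps)
      moreover have "q ^ Suc (Suc m) > 0" using q by simp
      ultimately show "a * x + b * z + u \<le> 0 \<and> a * x + b * z + u \<le> - (q ^ Suc (Suc m)) \<and> x \<le> - (q ^ Suc m)"
        using * by auto
    qed (use q c that in auto)
    have pos: "q ^ m0 > 0" "q ^ m0 \<le> q ^ Suc m0" using q by auto
    show ?thesis
    proof (rule surv_lower_of_two_steps[of "- (q ^ Suc m0)"])
      fix n u1 u2 assume u: "u1 \<le> - (q ^ Suc m0)" "u2 \<le> - (q ^ Suc m0)"
      have "u1 \<le> - (q ^ m0)" "u1 \<le> 0" "u2 \<le> 0" using u pos by linarith+
      moreover have "a * u1 \<le> 0" using a0 \<open>u1 \<le> 0\<close> by (simp add: mult_le_0_iff)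
      ultimately show "u1 \<le> 0 \<and> a * u1 + u2 \<le> 0 \<and> ennreal (1/2) \<le> surv a b n (a * u1 + u2) u1"
        using m0[of "a * u1 + u2" u1 n] u by auto
    qed
  next
    case False
    define c where "c = s1 - q"
    have "s2 > 0" using False prod s1 by (smt (verit) mult_nonneg_nonpos)
    obtain m0 where m0: "\<And>n x z. x \<le> 0 \<and> x - s2 * z \<le> - (q ^ m0) \<Longrightarrow> ennreal (1/2) \<le> surv a b n x z"
    proof (rule surv_lower_of_invariant[of q c "\<lambda>m x z. x \<le> 0 \<and> x - s2 * z \<le> - (q ^ m)" a b])
      fix m x z u assume *: "x \<le> 0 \<and> x - s2 * z \<le> - (q ^ m)" "u \<le> c * q ^ m"
      have "s1 * (x - s2 * z) \<le> s1 * (- (q ^ m))" using * s1 by (intro mult_left_mono) auto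
      then have "a * x + b * z + u - s2 * x \<le> - (q ^ Suc m)"
        using *(2) by (simp add: c_def sum prod algebra_simps)
      moreover have "q ^ Suc m > 0" using q by simp
      moreover have "s2 * x \<le> 0" using * \<open>s2 > 0\<close> by (simp add: mult_le_0_iff)
      ultimately show "a * x + b * z + u \<le> 0 \<and> a * x + b * z + u \<le> 0 \<and> a * x + b * z + u - s2 * x \<le> - (q ^ Suc m)"
        by linarith
    qed (use q c_def that in auto)
    have pos: "q ^ m0 > 0" using q by auto
    show ?thesis
    proof (rule surv_lower_of_two_steps[of "- (q ^ m0)"])
      fix n u1 u2 assume u: "u1 \<le> - (q ^ m0)" "u2 \<le> - (q ^ m0)"
      have "u1 \<le> 0" "u2 \<le> 0" using u pos by linarith+
      moreover have "a * u1 \<le> 0" "s1 * u1 \<le> 0" using a0 s1 \<open>u1 \<le> 0\<close> by (simp_all add: mult_le_0_iff)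
      moreover have "a * u1 + u2 - s2 * u1 = s1 * u1 + u2" by (simp add: sum algebra_simps)
      ultimately show "u1 \<le> 0 \<and> a * u1 + u2 \<le> 0 \<and> ennreal (1/2) \<le> surv a b n (a * u1 + u2) u1"
        using m0[of "a * u1 + u2" u1 n] u by auto
    qed
  qed
qed

section \<open>Exponential decay\<close>

definition exp_decay :: "real \<Rightarrow> real \<Rightarrow> bool" where
  "exp_decay a b \<longleftrightarrow> (\<exists>C h. 0 < h \<and> h < 1 \<and> (\<forall>n. surv a b n 0 0 \<le> ennreal (C * h ^ n)))"

text \<open>Linear Lyapunov function: far from the origin \<open>1 + t g\<close> contracts because \<open>g\<close> does,
  and near the origin there is a fixed chance of becoming positive in the next step.\<close>

lemma exp_decay_of_contraction:
  fixes g :: "real \<Rightarrow> real \<Rightarrow> real"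
  assumes \<rho>: "0 \<le> \<rho>" "\<rho> < 1" and c: "c > 0" and C: "C > 0"
    and g0: "\<And>x z. x \<le> 0 \<Longrightarrow> z \<le> 0 \<Longrightarrow> 0 \<le> g x z"
    and g00: "g 0 0 = 0"
    and contr: "\<And>x z u. x \<le> 0 \<Longrightarrow> z \<le> 0 \<Longrightarrow> a * x + b * z + u \<le> 0 \<Longrightarrow>
      g (a * x + b * z + u) x \<le> \<rho> * g x z + c * \<bar>u\<bar>"
    and bd: "\<And>x z. x \<le> 0 \<Longrightarrow> z \<le> 0 \<Longrightarrow> \<bar>a * x + b * z\<bar> \<le> C * g x z"
  shows "exp_decay a b"
proof -
  define l0 where "l0 = (1 + \<rho>) / 2"
  define M where "M = (c + 1) / (l0 - \<rho>)"
  have l0: "l0 - \<rho> > 0" "l0 < 1" "l0 > 0" using \<rho> by (auto simp: l0_def)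
  have M: "M > 0" "(l0 - \<rho>) * M = c + 1" using l0 c by (auto simp: M_def)
  define P where "P = gauss.prob {..C * M}"
  have P1: "P < 1"
    unfolding P_def by (rule gauss_prob_less_1[of _ "C * M + 1" "C * M + 2"]) auto
  define t where "t = min (1/2) ((1 - P) / (2 * (M + c)))"
  have Mc: "M + c > 0" using M c by simp
  have t: "t > 0" "t < 1" using P1 Mc by (auto simp: t_def)
  have tP: "t * (M + c) \<le> (1 - P) / 2"
  proof -
    have "t * (M + c) \<le> (1 - P) / (2 * (M + c)) * (M + c)"
      by (intro mult_right_mono) (use Mc in \<open>auto simp: t_def\<close>)
    moreover have "(1 - P) / (2 * K) * K = (1 - P) / 2" if "K > 0" for K using that by simp
    ultimately show ?thesis using Mc by metis
  qed
  define h where "h = max l0 (max ((1 + P) / 2) (1 - t))"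
  have h: "0 < h" "h < 1" "l0 \<le> h" "1 - t \<le> h"
    using l0 P1 t by (auto simp: h_def)
  have hP: "(1 + P) / 2 \<le> h"
    unfolding h_def by (intro max.coboundedI2 max.cobounded1)
  have main: "surv a b n x z \<le> ennreal (h ^ n * (1 + t * g x z))" if "x \<le> 0" "z \<le> 0" for n x z
    using that
  proof (induction n arbitrary: x z)
    case 0
    then show ?case using g0[of x z] t by (simp add: ennreal_1[symmetric] ennreal_leI del: ennreal_1)
  next
    case (Suc n)
    let ?w = "\<lambda>u. a * x + b * z + u"
    define G where "G = g x z"
    have G0: "G \<ge> 0" using g0 Suc.prems by (simp add: G_def)
    have "surv a b (Suc n) x z \<le> (\<integral>\<^sup>+u. ennreal (h ^ n) * (ennreal (1 + t * \<rho> * G) * indicator {..C * G} u + ennreal (t * c) * ennreal \<bar>u\<bar>) \<partial>gauss)"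
      unfolding surv.simps
    proof (intro nn_integral_mono)
      fix u
      show "indicator {..0} (?w u) * surv a b n (?w u) x \<le>
        ennreal (h ^ n) * (ennreal (1 + t * \<rho> * G) * indicator {..C * G} u + ennreal (t * c) * ennreal \<bar>u\<bar>)"
      proof (cases "?w u \<le> 0")
        case True
        have "u \<le> C * G" using bd[of x z] Suc.prems True unfolding G_def by linarith
        have "surv a b n (?w u) x \<le> ennreal (h ^ n * (1 + t * g (?w u) x))"
          using Suc.IH[OF True Suc.prems(1)] .
        also have "\<dots> \<le> ennreal (h ^ n * (1 + t * (\<rho> * G + c * \<bar>u\<bar>)))"
          unfolding G_def using contr[OF Suc.prems True] t h by (intro ennreal_leI mult_left_mono add_mono order_refl) auto
        also have "\<dots> = ennreal (h ^ n) * (ennreal (1 + t * \<rho> * G) + ennreal (t * c) * ennreal \<bar>u\<bar>)"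
          using G0 t c \<rho> h by (simp add: ennreal_mult'[symmetric] ennreal_plus[symmetric] algebra_simps del: ennreal_plus)
        finally show ?thesis using True \<open>u \<le> C * G\<close> by simp
      qed simp
    qed
    also have "\<dots> = ennreal (h ^ n) * (ennreal (1 + t * \<rho> * G) * emeasure gauss {..C * G} + ennreal (t * c) * (\<integral>\<^sup>+u. ennreal \<bar>u\<bar> \<partial>gauss))"
      by (simp add: nn_integral_cmult nn_integral_add)
    also have "\<dots> \<le> ennreal (h ^ n) * (ennreal (1 + t * \<rho> * G) * ennreal (gauss.prob {..C * G}) + ennreal (t * c) * 1)"
      using gauss_first_abs_moment unfolding emeasure_gauss_eq
      by (intro mult_left_mono add_mono) auto
    also have "\<dots> = ennreal (h ^ n * ((1 + t * \<rho> * G) * gauss.prob {..C * G} + t * c))"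
      using G0 t c \<rho> h by (simp add: ennreal_mult'[symmetric] ennreal_plus[symmetric] del: ennreal_plus)
    also have "\<dots> \<le> ennreal (h ^ Suc n * (1 + t * G))"
    proof (rule ennreal_leI)
      have "(1 + t * \<rho> * G) * gauss.prob {..C * G} + t * c \<le> h * (1 + t * G)"
      proof (cases "G \<le> M")
        case True
        have "gauss.prob {..C * G} \<le> P"
          unfolding P_def using True C by (intro gauss.finite_measure_mono) auto
        moreover have "P \<ge> 0" by (simp add: P_def)
        ultimately have "(1 + t * \<rho> * G) * gauss.prob {..C * G} \<le> P + t * \<rho> * G * 1"
          unfolding distrib_right using G0 t \<rho> gauss.prob_le_1 by (intro add_mono mult_left_mono) auto
        also have "t * \<rho> * G * 1 \<le> t * M"
          using True G0 t \<rho> mult_mono[of \<rho> 1 G M] by (simp add: mult.assoc)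
        finally have "(1 + t * \<rho> * G) * gauss.prob {..C * G} + t * c \<le> P + t * (M + c)"
          by (simp add: algebra_simps)
        also have "\<dots> \<le> (1 + P) / 2" using tP by (simp add: field_simps)
        also have "\<dots> \<le> h" by (rule hP)
        also have "\<dots> \<le> h * (1 + t * G)" using h t G0 by simp
        finally show ?thesis .
      next
        case False
        have "(1 + t * \<rho> * G) * gauss.prob {..C * G} \<le> (1 + t * \<rho> * G) * 1"
          using G0 t \<rho> by (intro mult_left_mono gauss.prob_le_1) auto
        moreover have "(l0 - \<rho>) * M \<le> (h - \<rho>) * G"
          using False h l0 M by (intro mult_mono) auto
        then have "t * (c + 1) \<le> t * ((h - \<rho>) * G)"
          using M t by (intro mult_left_mono) auto
        ultimately show ?thesis using h by (simp add: algebra_simps)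
      qed
      then show "h ^ n * ((1 + t * \<rho> * G) * gauss.prob {..C * G} + t * c) \<le> h ^ Suc n * (1 + t * G)"
        using h by (simp add: mult.assoc mult.left_commute[of h])
    qed
    finally show ?case by (simp add: G_def)
  qed
  show ?thesis
    unfolding exp_decay_def using main[of 0 0] h by (intro exI[of _ 1] exI[of _ h]) (auto simp: g00)
qed

lemma exp_decay_small_a1:
  assumes "a < 1" "a + b < 1"
  shows "exp_decay a b"
proof -
  have "((\<lambda>r. r * (r - a)) \<longlongrightarrow> 1 * (1 - a)) (at_left 1)"
    by (intro tendsto_intros)
  then have "\<forall>\<^sub>F r in at_left 1. b < r * (r - a)"
    by (rule order_tendstoD) (use assms in auto)
  moreover have "\<forall>\<^sub>F r in at_left (1::real). max 0 a < r"
    by (rule eventually_at_leftI[of "max 0 a"]) (use assms in auto)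
  moreover have "\<forall>\<^sub>F r in at_left (1::real). r < 1"
    by (rule eventually_at_leftI[of 0]) auto
  ultimately have "\<forall>\<^sub>F r in at_left 1. b < r * (r - a) \<and> max 0 a < r \<and> r < 1"
    by eventually_elim auto
  then obtain r where r: "b < r * (r - a)" "0 < r" "a < r" "r < 1"
    using eventually_happens[of _ "at_left (1::real)"] by auto
  define \<beta> where "\<beta> = r - a"
  have \<beta>: "\<beta> > 0" using r by (simp add: \<beta>_def)
  show ?thesis
  proof (rule exp_decay_of_contraction[of r 1 "\<bar>a\<bar> + \<bar>b\<bar> / \<beta> + 1" "\<lambda>x z. - x - \<beta> * z"])
    fix x z :: real assume xz: "x \<le> 0" "z \<le> 0"
    then show "0 \<le> - x - \<beta> * z" using \<beta> by (smt (verit) mult_nonneg_nonpos)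
    have bz: "\<beta> * z \<le> 0" using \<beta> xz by (simp add: mult_le_0_iff)
    have "\<bar>a * x + b * z\<bar> \<le> \<bar>a\<bar> * (- x) + \<bar>b\<bar> * (- z)"
      using xz abs_triangle_ineq[of "a * x" "b * z"] by (simp add: abs_mult)
    also have "\<dots> = \<bar>a\<bar> * (- x) + \<bar>b\<bar> / \<beta> * (- (\<beta> * z))" using \<beta> by simp
    also have "\<dots> \<le> (\<bar>a\<bar> + \<bar>b\<bar> / \<beta> + 1) * (- x) + (\<bar>a\<bar> + \<bar>b\<bar> / \<beta> + 1) * (- (\<beta> * z))"
      using xz bz \<beta> by (intro add_mono mult_right_mono) auto
    finally show "\<bar>a * x + b * z\<bar> \<le> (\<bar>a\<bar> + \<bar>b\<bar> / \<beta> + 1) * (- x - \<beta> * z)"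
      by (simp add: algebra_simps)
    fix u
    have "r * \<beta> * z \<le> b * z" using r xz by (intro mult_right_mono_neg) (auto simp: \<beta>_def)
    then show "- (a * x + b * z + u) - \<beta> * x \<le> r * (- x - \<beta> * z) + 1 * \<bar>u\<bar>"
      by (simp add: \<beta>_def algebra_simps)
  qed (use r \<beta> in \<open>auto intro!: add_nonneg_pos\<close>)
qed

lemma exp_decay_real_roots:
  assumes s: "0 < s1" "s1 < 1" "0 < s2" "s2 < 1"
  shows "exp_decay (s1 + s2) (- (s1 * s2))"
proof -
  define k where "k = 2 * s1 / (1 - s1)"
  have k: "k > 0" using s by (simp add: k_def)
  define r where "r = max s2 ((1 + s1) / 2)"
  have r: "s2 \<le> r" "(1 + s1) / 2 \<le> r" "r < 1" using s by (auto simp: r_def)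
  have sk: "s1 * (1 + k) \<le> r * k"
  proof -
    have "s1 + s1 * k = (1 + s1) / 2 * k" using s by (simp add: k_def field_simps)
    also have "\<dots> \<le> r * k" using r k by (intro mult_right_mono) auto
    finally show ?thesis by (simp add: algebra_simps)
  qed
  show ?thesis
  proof (rule exp_decay_of_contraction[of r "1 + k" "1 + 1 / k" "\<lambda>x z. \<bar>x\<bar> + k * \<bar>x - s2 * z\<bar>"])
    fix x z u :: real
    define Z where "Z = x - s2 * z"
    show "0 \<le> \<bar>x\<bar> + k * \<bar>x - s2 * z\<bar>" using k by simp
    have e: "(s1 + s2) * x + - (s1 * s2) * z + u = s2 * x + s1 * Z + u"
      by (simp add: Z_def algebra_simps)
    have 1: "\<bar>s2 * x + s1 * Z + u\<bar> \<le> s2 * \<bar>x\<bar> + s1 * \<bar>Z\<bar> + \<bar>u\<bar>"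
      using s abs_triangle_ineq[of "s2 * x + s1 * Z" u] abs_triangle_ineq[of "s2 * x" "s1 * Z"]
      by (simp add: abs_mult)
    have 2: "k * \<bar>s1 * Z + u\<bar> \<le> k * (s1 * \<bar>Z\<bar> + \<bar>u\<bar>)"
      using s k abs_triangle_ineq[of "s1 * Z" u] by (intro mult_left_mono) (auto simp: abs_mult)
    have 3: "s2 * \<bar>x\<bar> \<le> r * \<bar>x\<bar>" using r by (intro mult_right_mono) auto
    have 4: "s1 * (1 + k) * \<bar>Z\<bar> \<le> r * k * \<bar>Z\<bar>" using sk by (intro mult_right_mono) auto
    have "\<bar>s2 * x + s1 * Z + u\<bar> + k * \<bar>s1 * Z + u\<bar> \<le> r * (\<bar>x\<bar> + k * \<bar>Z\<bar>) + (1 + k) * \<bar>u\<bar>"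
      using 1 2 3 4 by (simp add: algebra_simps)
    then show "\<bar>(s1 + s2) * x + - (s1 * s2) * z + u\<bar> + k * \<bar>(s1 + s2) * x + - (s1 * s2) * z + u - s2 * x\<bar>
      \<le> r * (\<bar>x\<bar> + k * \<bar>x - s2 * z\<bar>) + (1 + k) * \<bar>u\<bar>"
      unfolding e by (simp add: Z_def)
    have "\<bar>s2 * x + s1 * Z\<bar> \<le> s2 * \<bar>x\<bar> + s1 * \<bar>Z\<bar>"
      using s abs_triangle_ineq[of "s2 * x" "s1 * Z"] by (simp add: abs_mult)
    also have "\<dots> \<le> 1 * \<bar>x\<bar> + 1 * \<bar>Z\<bar>" using s by (intro add_mono mult_right_mono) auto
    also have "\<dots> \<le> (1 + 1 / k) * (\<bar>x\<bar> + k * \<bar>Z\<bar>)"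
      using k by (simp add: field_simps)
    finally show "\<bar>(s1 + s2) * x + - (s1 * s2) * z\<bar> \<le> (1 + 1 / k) * (\<bar>x\<bar> + k * \<bar>x - s2 * z\<bar>)"
      using e[unfolded Z_def] by (simp add: Z_def algebra_simps)
  qed (use r s k in \<open>auto intro!: add_pos_pos\<close>)
qed

lemma impulse_response_sign_change:
  fixes a b :: real
  defines "h \<equiv> arp a b 1 0 (\<lambda>_. 0)"
  assumes "a > 0" "a\<^sup>2 + 4 * b < 0"
  obtains m where "\<And>j. j \<le> m \<Longrightarrow> h j > 0" "h (Suc m) \<le> 0"
proof -
  have "\<exists>j. h j \<le> 0"
  proof (rule ccontr)
    assume "\<not> (\<exists>j. h j \<le> 0)"
    then have pos: "h j > 0" for j by (simp add: not_le)
    define r where "r n = h (Suc n) / h n" for n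
    define d where "d = - (a\<^sup>2 / 4 + b)"
    have d: "d > 0" using assms by (simp add: d_def)
    have rpos: "r n > 0" for n using pos by (simp add: r_def)
    have rec: "r (Suc n) = a + b / r n" for n
      using pos[of n] pos[of "Suc n"] by (simp add: r_def h_def field_simps)
    have "r n \<le> a - real n * (d / a)" for n
    proof (induction n)
      case 0
      then show ?case by (simp add: r_def h_def)
    next
      case (Suc n)
      have "real n * (d / a) \<ge> 0" using d assms by simp
      then have ra: "r n \<le> a" using Suc by linarith
      have "a * r n + b \<le> (r n)\<^sup>2 - d"
        using zero_le_power2[of "r n - a / 2"] by (simp add: d_def power2_eq_square field_simps)
      then have "a + b / r n \<le> r n - d / r n"
        using rpos[of n] divide_right_mono[of "a * r n + b" "(r n)\<^sup>2 - d" "r n"]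
        by (simp add: add_divide_distrib diff_divide_distrib power2_eq_square)
      moreover have "d / a \<le> d / r n" using ra rpos[of n] d assms by (intro divide_left_mono) auto
      ultimately have "r (Suc n) \<le> r n - d / a" by (simp add: rec)
      then show ?case using Suc by (simp add: algebra_simps add_divide_distrib)
    qed
    moreover obtain n where "a < real n * (d / a)"
      using ex_less_of_nat_mult[of "d / a" a] d assms by auto
    ultimately show False using rpos[of n] by (smt (verit))
  qed
  define j where "j = (LEAST j. h j \<le> 0)"
  have hj: "h j \<le> 0" unfolding j_def using \<open>\<exists>j. h j \<le> 0\<close> by (rule LeastI_ex)
  then obtain m where m: "j = Suc m" by (cases j) (auto simp: h_def)
  have "h i > 0" if "i \<le> m" for i
    using not_less_Least[of i "\<lambda>j. h j \<le> 0"] that m by (simp add: j_def not_le)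
  with hj m that show thesis by blast
qed

lemma surv_positive_run:
  fixes a b :: real
  defines "h \<equiv> arp a b 1 0 (\<lambda>_. 0)"
  assumes s: "s \<ge> 0" "\<And>x z. x \<le> 0 \<Longrightarrow> z \<le> 0 \<Longrightarrow> surv a b n x z \<le> ennreal s"
    and "\<And>i. i \<le> k \<Longrightarrow> h i > 0" "h (Suc k) * x + b * h k * z \<ge> 0" "x \<le> 0" "z \<le> 0"
  shows "surv a b (n + Suc k) x z \<le> ennreal (s * (1 - gauss.prob {0<..} ^ Suc k))"
  using assms(4-)
proof (induction k arbitrary: x z)
  have split: "surv a b (Suc m) x z \<le> ennreal (s * (1 - gauss.prob {0<..} ^ Suc k))"
    if 1: "\<And>u. u \<le> 0 \<Longrightarrow> a * x + b * z + u \<le> 0 \<Longrightarrow> surv a b m (a * x + b * z + u) x \<le> ennreal s"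
      and 2: "\<And>u. u > 0 \<Longrightarrow> a * x + b * z + u \<le> 0 \<Longrightarrow>
        surv a b m (a * x + b * z + u) x \<le> ennreal (s * (1 - gauss.prob {0<..} ^ k))" for m x z k
  proof -
    let ?q = "gauss.prob {0<..}"
    have q: "gauss.prob {..0} = 1 - ?q"
      using gauss.prob_compl[of "{0<..}"] by (simp add: Compl_eq_Diff_UNIV[symmetric])
    have q1: "?q ^ k \<le> 1" by (intro power_le_one) auto
    have "surv a b (Suc m) x z \<le> (\<integral>\<^sup>+u. ennreal s * indicator {..0} u + ennreal (s * (1 - ?q ^ k)) * indicator {0<..} u \<partial>gauss)"
      unfolding surv.simps using 1 2 by (auto intro!: nn_integral_mono simp: indicator_def)
    also have "\<dots> = ennreal s * ennreal (gauss.prob {..0}) + ennreal (s * (1 - ?q ^ k)) * ennreal ?q"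
      by (simp add: nn_integral_add nn_integral_cmult_indicator emeasure_gauss_eq)
    also have "\<dots> = ennreal (s * (1 - ?q) + s * (1 - ?q ^ k) * ?q)"
      unfolding q using s q1 by (simp add: ennreal_mult'[symmetric] ennreal_plus[symmetric] del: ennreal_plus)
    also have "s * (1 - ?q) + s * (1 - ?q ^ k) * ?q = s * (1 - ?q ^ Suc k)"
      by (simp add: algebra_simps)
    finally show ?thesis .
  qed
  {
    case 0
    show ?case
      unfolding add_Suc_right
    proof (rule split)
      fix u assume "u > 0" "a * x + b * z + u \<le> 0"
      then show "surv a b (n + 0) (a * x + b * z + u) x \<le> ennreal (s * (1 - gauss.prob {0<..} ^ 0))"
        using 0 by (simp add: h_def)
    qed (use s 0 in auto)
  next
    case (Suc k)
    show ?case
      unfolding add_Suc_right[of n "Suc k"]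
    proof (rule split)
      fix u assume u: "u \<le> 0" "a * x + b * z + u \<le> 0"
      have "surv a b (n + Suc k) (a * x + b * z + u) x \<le> surv a b n (a * x + b * z + u) x"
        by (rule surv_antimono') simp
      also have "\<dots> \<le> ennreal s" using s u Suc.prems by blast
      finally show "surv a b (n + Suc k) (a * x + b * z + u) x \<le> ennreal s" .
    next
      fix u assume u: "u > 0" "a * x + b * z + u \<le> 0"
      show "surv a b (n + Suc k) (a * x + b * z + u) x \<le> ennreal (s * (1 - gauss.prob {0<..} ^ Suc k))"
      proof (rule Suc.IH)
        have "h (Suc k) * (a * x + b * z + u) + b * h k * x =
          (h (Suc (Suc k)) * x + b * h (Suc k) * z) + h (Suc k) * u"
          by (simp add: h_def algebra_simps)
        then show "0 \<le> h (Suc k) * (a * x + b * z + u) + b * h k * x"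
          using Suc.prems(1)[of "Suc k"] Suc.prems(2) u by simp
      qed (use Suc.prems u in auto)
    qed
  }
qed

lemma exp_decay_complex_roots:
  assumes "a > 0" "a\<^sup>2 + 4 * b < 0"
  shows "exp_decay a b"
proof -
  define h where "h = arp a b 1 0 (\<lambda>_. 0)"
  obtain m where m: "\<And>j. j \<le> m \<Longrightarrow> h j > 0" "h (Suc m) \<le> 0"
    unfolding h_def by (rule impulse_response_sign_change[OF assms]) blast
  have b: "b < 0" using assms(2) zero_le_power2[of a] by linarith
  define q where "q = 1 - gauss.prob {0<..} ^ Suc m"
  have g0: "gauss.prob {0<..} > 0"
  proof -
    have "0 < gauss.prob {1..2}"
      using gauss_Icc_pos[of 1 2] by (simp add: emeasure_gauss_eq)
    also have "\<dots> \<le> gauss.prob {0<..}" by (rule gauss.finite_measure_mono) auto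
    finally show ?thesis .
  qed
  have g1: "gauss.prob {0<..} < 1"
    by (rule gauss_prob_less_1[of _ "- 2" "- 1"]) auto
  have q: "0 < q" "q < 1"
    using g0 g1 power_Suc_less_one[of "gauss.prob {0<..}" m] by (auto simp: q_def)
  have blocks: "surv a b (i * Suc m) x z \<le> ennreal (q ^ i)" if "x \<le> 0" "z \<le> 0" for i x z
    using that
  proof (induction i arbitrary: x z)
    case (Suc i)
    have "surv a b (i * Suc m + Suc m) x z \<le> ennreal (q ^ i * (1 - gauss.prob {0<..} ^ Suc m))"
    proof (rule surv_positive_run)
      have "h (Suc m) * x \<ge> 0" "b * h m * z \<ge> 0"
        using m(1)[of m] m(2) b Suc.prems by (auto intro!: mult_nonpos_nonpos simp: mult_le_0_iff)
      then show "0 \<le> arp a b 1 0 (\<lambda>_. 0) (Suc m) * x + b * arp a b 1 0 (\<lambda>_. 0) m * z"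
        by (simp add: h_def)
    qed (use Suc q m in \<open>auto simp: h_def\<close>)
    then show ?case unfolding q_def[symmetric] by (simp only: mult_Suc add.commute power_Suc2)
  qed simp
  define \<eta> where "\<eta> = root (Suc m) q"
  have \<eta>: "0 < \<eta>" "\<eta> < 1" "\<eta> ^ Suc m = q"
    using q real_root_pow_pos[of "Suc m" q] by (simp_all add: \<eta>_def del: power_Suc)
  have "surv a b n 0 0 \<le> ennreal (1 / q * \<eta> ^ n)" for n
  proof -
    have "surv a b n 0 0 \<le> surv a b (n div Suc m * Suc m) 0 0"
      by (rule surv_antimono'[OF div_times_less_eq_dividend])
    also have "\<dots> \<le> ennreal (q ^ (n div Suc m))" by (rule blocks) auto
    also have "\<dots> \<le> ennreal (1 / q * \<eta> ^ n)"
    proof (rule ennreal_leI)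
      have "q * q ^ (n div Suc m) = \<eta> ^ (Suc m * Suc (n div Suc m))"
        unfolding power_mult \<eta>(3) by simp
      also have "\<dots> \<le> \<eta> ^ n"
        using \<eta> dividend_less_times_div[of "Suc m" n] by (intro power_decreasing) auto
      finally show "q ^ (n div Suc m) \<le> 1 / q * \<eta> ^ n"
        using q by (simp add: field_simps)
    qed
    finally show ?thesis .
  qed
  then show ?thesis unfolding exp_decay_def using \<eta> by blast
qed

lemma nn_integral_noise_iter':
  assumes [measurable]: "f \<in> borel_measurable noise"
  shows "(\<integral>\<^sup>+y. f y \<partial>noise) = (\<integral>\<^sup>+y. \<integral>\<^sup>+u. f (case_nat u y) \<partial>gauss \<partial>noise)"
proof -
  interpret pair_sigma_finite gauss noise ..
  show ?thesis
    by (subst noise.PiM_iter[symmetric])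
       (simp add: nn_integral_distr nn_integral_snd[symmetric] case_prod_beta)
qed

lemma distr_noise_component: "distr noise gauss (\<lambda>y. y n) = gauss"
  by (rule distr_PiM_component) (auto simp: prob_space_gauss)

lemma noise_sup_tail:
  assumes "L \<ge> 0"
  shows "emeasure noise {y. \<exists>j<n. L < \<bar>y j\<bar>} \<le> ennreal (real n * tail_bound L)"
proof -
  have "emeasure noise {y. L < \<bar>y j\<bar>} \<le> ennreal (tail_bound L)" for j
  proof -
    have "emeasure noise {y. L < \<bar>y j\<bar>} = emeasure (distr noise gauss (\<lambda>y. y j)) {u. L < \<bar>u\<bar>}"
      by (subst emeasure_distr) (auto simp: vimage_def)
    then show ?thesis using gauss_tail[OF assms] by (simp add: distr_noise_component)
  qed
  moreover have "{y. \<exists>j<n. L < \<bar>y j\<bar>} = (\<Union>j<n. {y::nat \<Rightarrow> real. L < \<bar>y j\<bar>})" by auto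
  moreover have "emeasure noise (\<Union>j<n. {y::nat \<Rightarrow> real. L < \<bar>y j\<bar>}) \<le> (\<Sum>j<n. emeasure noise {y. L < \<bar>y j\<bar>})"
    by (rule emeasure_subadditive_finite) (auto intro!: noise_event)
  ultimately have "emeasure noise {y. \<exists>j<n. L < \<bar>y j\<bar>} \<le> (\<Sum>j<n. ennreal (tail_bound L))"
    by (metis (no_types, lifting) order_trans sum_mono)
  also have "\<dots> = ennreal (real n * tail_bound L)"
    by (simp add: ennreal_of_nat_eq_real_of_nat ennreal_mult)
  finally show ?thesis .
qed

lemma emeasure_noise_truncate:
  assumes "L \<ge> 0" "Measurable.pred noise Q" "\<And>y. P y \<Longrightarrow> (\<And>j. j < n \<Longrightarrow> \<bar>y j\<bar> \<le> L) \<Longrightarrow> Q y"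
  shows "emeasure noise {y. P y} \<le>
    emeasure noise {y. Q y} + ennreal (real n * tail_bound L)"
proof -
  have "emeasure noise {y. P y} \<le> emeasure noise ({y. Q y} \<union> {y. \<exists>j<n. L < \<bar>y j\<bar>})"
  proof (rule emeasure_mono)
    show "{y. P y} \<subseteq> {y. Q y} \<union> {y. \<exists>j<n. L < \<bar>y j\<bar>}" using assms(3) not_le by blast
  qed (use noise_event[OF assms(2)] in \<open>auto intro!: noise_event sets.Un\<close>)
  also have "\<dots> \<le> emeasure noise {y. Q y} + emeasure noise {y. \<exists>j<n. L < \<bar>y j\<bar>}"
    using noise_event[OF assms(2)] by (intro emeasure_subadditive) (auto intro!: noise_event)
  also have "\<dots> \<le> emeasure noise {y. Q y} + ennreal (real n * tail_bound L)"
    by (intro add_mono noise_sup_tail assms order_refl)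
  finally show ?thesis .
qed

primrec ar1 :: "real \<Rightarrow> (nat \<Rightarrow> real) \<Rightarrow> nat \<Rightarrow> real" where
  "ar1 s y 0 = 0"
| "ar1 s y (Suc n) = s * ar1 s y n + y n"

lemma ar1_case_nat: "ar1 s (case_nat u y) (Suc n) = s ^ n * u + ar1 s y n"
  by (induction n) (simp_all add: algebra_simps)

lemma measurable_ar1 [measurable]: "(\<lambda>y. ar1 s y n) \<in> borel_measurable noise"
  by (induction n) simp_all

lemma arp_eq_ar1:
  "(s1 - s2) * arp (s1 + s2) (- (s1 * s2)) 0 0 y n = s1 * ar1 s1 y n - s2 * ar1 s2 y n"
proof (induction n rule: induct_nat_012)
  case (ge2 n)
  have "(s1 - s2) * arp (s1 + s2) (- (s1 * s2)) 0 0 y (Suc (Suc n)) =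
    (s1 + s2) * ((s1 - s2) * arp (s1 + s2) (- (s1 * s2)) 0 0 y (Suc n))
    - (s1 * s2) * ((s1 - s2) * arp (s1 + s2) (- (s1 * s2)) 0 0 y n) + (s1 - s2) * y (Suc n)"
    by (simp add: algebra_simps)
  then show ?case unfolding ge2 by (simp add: algebra_simps)
qed (simp_all add: algebra_simps)

lemma ar1_bound:
  assumes "s \<ge> 1" "\<And>j. j < n \<Longrightarrow> \<bar>y j\<bar> \<le> L"
  shows "\<bar>ar1 s y n\<bar> \<le> real n * s ^ n * L"
  using assms(2)
proof (induction n)
  case (Suc n)
  have L: "L \<ge> 0" using Suc.prems[of n] by simp
  have "\<bar>ar1 s y (Suc n)\<bar> \<le> s * \<bar>ar1 s y n\<bar> + \<bar>y n\<bar>"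
    using assms(1) abs_triangle_ineq[of "s * ar1 s y n" "y n"] by (simp add: abs_mult)
  also have "\<dots> \<le> s * (real n * s ^ n * L) + s ^ Suc n * L"
  proof (intro add_mono mult_left_mono)
    show "\<bar>ar1 s y n\<bar> \<le> real n * s ^ n * L" using Suc by simp
    have "1 * L \<le> s ^ Suc n * L" using assms(1) L by (intro mult_right_mono one_le_power) auto
    then show "\<bar>y n\<bar> \<le> s ^ Suc n * L" using Suc.prems[of n] by simp
  qed (use assms in auto)
  also have "\<dots> = real (Suc n) * s ^ Suc n * L" by (simp add: algebra_simps)
  finally show ?case .
qed simp

lemma ar1_small_ball:
  assumes "t > 0" "r \<ge> 0"
  shows "emeasure noise {y. \<bar>ar1 (- t) y (Suc n)\<bar> \<le> r} \<le> ennreal (r / t ^ n)"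
proof -
  have "emeasure noise {y. \<bar>ar1 (- t) y (Suc n)\<bar> \<le> r} = (\<integral>\<^sup>+y. indicator {y. \<bar>ar1 (- t) y (Suc n)\<bar> \<le> r} y \<partial>noise)"
    by (subst nn_integral_indicator) (auto intro!: noise_event)
  also have "\<dots> = (\<integral>\<^sup>+y. \<integral>\<^sup>+u. indicator {y. \<bar>ar1 (- t) y (Suc n)\<bar> \<le> r} (case_nat u y) \<partial>gauss \<partial>noise)"
    by (rule nn_integral_noise_iter') (auto intro!: noise_event borel_measurable_indicator)
  also have "\<dots> \<le> (\<integral>\<^sup>+y. ennreal (r / t ^ n) \<partial>noise)"
  proof (intro nn_integral_mono)
    fix y
    define c where "c = - ar1 (- t) y n / (- t) ^ n"
    have "(\<integral>\<^sup>+u. indicator {y. \<bar>ar1 (- t) y (Suc n)\<bar> \<le> r} (case_nat u y) \<partial>gauss) \<le>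
      (\<integral>\<^sup>+u. indicator {c - r / t ^ n..c + r / t ^ n} u \<partial>gauss)"
    proof (intro nn_integral_mono)
      fix u
      show "(indicator {y. \<bar>ar1 (- t) y (Suc n)\<bar> \<le> r} (case_nat u y) :: ennreal) \<le> indicator {c - r / t ^ n..c + r / t ^ n} u"
      proof (cases "\<bar>ar1 (- t) (case_nat u y) (Suc n)\<bar> \<le> r")
        case True
        have "ar1 (- t) (case_nat u y) (Suc n) = (- t) ^ n * (u - c)"
          using assms by (simp add: ar1_case_nat c_def field_simps del: ar1.simps)
        then have "t ^ n * \<bar>u - c\<bar> \<le> r" using True assms by (simp add: abs_mult power_abs del: ar1.simps)
        then have "\<bar>u - c\<bar> \<le> r / t ^ n" using assms by (simp add: field_simps)
        then show ?thesis by (simp add: indicator_def abs_le_iff)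
      qed (simp add: indicator_def)
    qed
    also have "\<dots> = emeasure gauss {c - r / t ^ n..c + r / t ^ n}" by simp
    also have "\<dots> \<le> ennreal ((c + r / t ^ n - (c - r / t ^ n)) / 2)"
      using assms by (intro gauss_Icc_le) auto
    also have "\<dots> = ennreal (r / t ^ n)" by simp
    finally show "(\<integral>\<^sup>+u. indicator {y. \<bar>ar1 (- t) y (Suc n)\<bar> \<le> r} (case_nat u y) \<partial>gauss) \<le> ennreal (r / t ^ n)" .
  qed
  also have "\<dots> = ennreal (r / t ^ n)" using noise.emeasure_space_1 by simp
  finally show ?thesis .
qed

text \<open>The negative root dominates, so the coordinate \<open>ar1 (- t)\<close> alternates in sign unless it is
  as small as the subdominant one, which the small ball estimate makes exponentially unlikely.\<close>

lemma surv_bound_alternating: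
  assumes s: "1 \<le> s" "s < t" and L: "L \<ge> 0" and n: "n \<ge> 1"
  shows "surv (s - t) (s * t) (Suc n) 0 0 \<le>
    ennreal (real (n + 2) * s ^ n * L / t ^ (n - 1) + real (Suc n) * tail_bound L)"
proof -
  let ?X = "arp (s - t) (s * t) 0 0"
  have X: "(s + t) * ?X y k = s * ar1 s y k + t * ar1 (- t) y k" for y k
    using arp_eq_ar1[of s "- t" y k] by simp
  have small: "\<bar>ar1 (- t) y n\<bar> \<le> real (n + 2) * s ^ n * L"
    if y: "\<forall>i\<in>{1..Suc n}. ?X y i \<le> 0" and yL: "\<And>j. j < Suc n \<Longrightarrow> \<bar>y j\<bar> \<le> L" for y
  proof -
    have up: "t * ar1 (- t) y k \<le> s * (real k * s ^ k * L)" if "k \<in> {1..Suc n}" for k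
    proof -
      have "(s + t) * ?X y k \<le> 0" using y s that by (auto simp: mult_le_0_iff)
      then have "t * ar1 (- t) y k \<le> s * (- ar1 s y k)" unfolding X by simp
      also have "\<dots> \<le> s * (real k * s ^ k * L)"
        using s ar1_bound[of s k y L] yL that by (intro mult_left_mono) auto
      finally show ?thesis .
    qed
    have sn: "s ^ n * L \<ge> 0" "1 \<le> s ^ n" using s L by auto
    have "t * ar1 (- t) y n \<le> s * (real n * s ^ n * L)" using up[of n] n by auto
    also have "\<dots> \<le> t * (real n * s ^ n * L)" using s L by (intro mult_right_mono) auto
    finally have "ar1 (- t) y n \<le> real n * (s ^ n * L)" using s by (simp add: mult_ac)
    also have "\<dots> \<le> real (n + 2) * (s ^ n * L)" using sn by (intro mult_right_mono) auto
    finally have 1: "ar1 (- t) y n \<le> real (n + 2) * s ^ n * L" by (simp add: mult_ac)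
    have "t * ar1 (- t) y (Suc n) \<le> s * (real (Suc n) * s ^ Suc n * L)" using up[of "Suc n"] by auto
    also have "\<dots> \<le> t * (real (Suc n) * s ^ Suc n * L)" using s L by (intro mult_right_mono) auto
    finally have "ar1 (- t) y (Suc n) \<le> real (Suc n) * s ^ Suc n * L" using s by (simp add: mult_ac)
    then have "t * (- ar1 (- t) y n) \<le> real (Suc n) * (s * (s ^ n * L)) + L"
      using yL[of n] by (simp add: mult_ac)
    also have "\<dots> \<le> real (Suc n) * (t * (s ^ n * L)) + t * (s ^ n * L)"
    proof (intro add_mono mult_left_mono mult_right_mono)
      have "1 * (1 * L) \<le> t * (s ^ n * L)"
        using s sn L by (intro mult_mono) auto
      then show "L \<le> t * (s ^ n * L)" by simp
    qed (use s sn in auto)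
    also have "\<dots> = t * (real (n + 2) * s ^ n * L)" by (simp add: algebra_simps)
    finally have "- ar1 (- t) y n \<le> real (n + 2) * s ^ n * L"
      by (rule mult_left_le_imp_le) (use s in auto)
    with 1 show ?thesis by (simp add: abs_le_iff)
  qed
  have "surv (s - t) (s * t) (Suc n) 0 0 \<le> emeasure noise {y. \<bar>ar1 (- t) y n\<bar> \<le> real (n + 2) * s ^ n * L} +
    ennreal (real (Suc n) * tail_bound L)"
    unfolding surv_eq_emeasure by (rule emeasure_noise_truncate[OF L _ small]) auto
  also have "\<dots> \<le> ennreal (real (n + 2) * s ^ n * L / t ^ (n - 1)) + ennreal (real (Suc n) * tail_bound L)"
    using ar1_small_ball[of t "real (n + 2) * s ^ n * L" "n - 1"] s L n by (intro add_mono) auto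
  finally show ?thesis using s L by (simp add: ennreal_plus[symmetric] del: ennreal_plus)
qed

lemma exp_decay_alternating:
  assumes s: "1 \<le> s" "s < t"
  shows "exp_decay (s - t) (s * t)"
proof -
  define m where "m = max (s / t) (exp (- 1 / 4))"
  have m: "0 < m" "m < 1" "s / t \<le> m" "exp (- 1 / 4) \<le> m" using s by (auto simp: m_def less_max_iff_disj)
  define h where "h = sqrt m"
  have h: "0 < h" "h < 1" "h * h = m" using m by (auto simp: h_def)
  have "(\<lambda>n. real (n + 2) ^ 2 * h ^ n) \<longlonglongrightarrow> 0" using h by real_asymp
  then have "Bseq (\<lambda>n. real (n + 2) ^ 2 * h ^ n)" by (intro convergent_imp_Bseq convergentI)
  then obtain K where K: "K > 0" "\<And>n. \<bar>real (n + 2) ^ 2 * h ^ n\<bar> \<le> K" by (auto simp: Bseq_def)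
  define C where "C = max ((t + 2) * K / h) (1 / h)"
  have "surv (s - t) (s * t) N 0 0 \<le> ennreal (C * h ^ N)" for N
  proof (cases "N \<le> 1")
    case True
    then have "h ^ 1 \<le> h ^ N" using h by (intro power_decreasing) auto
    then have "1 / h * h \<le> C * h ^ N"
      using h by (intro mult_mono) (auto simp: C_def max.coboundedI2)
    then have "1 \<le> C * h ^ N" using h by simp
    then show ?thesis using surv_le_1[of "s - t" "s * t" N 0 0]
      by (metis ennreal_1 ennreal_leI order_trans)
  next
    case False
    then obtain n where N: "N = Suc n" and n: "n \<ge> 1" by (cases N) auto
    have 1: "real (n + 2) * s ^ n * real n / t ^ (n - 1) \<le> t * (real (n + 2) ^ 2 * m ^ n)"
    proof -
      have "t ^ n = t * t ^ (n - 1)" using n by (cases n) auto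
      then have "real (n + 2) * s ^ n * real n / t ^ (n - 1) = t * (real (n + 2) * real n * (s / t) ^ n)"
        using s by (simp add: field_simps)
      also have "\<dots> \<le> t * (real (n + 2) * real (n + 2) * m ^ n)"
        using s m by (intro mult_left_mono mult_mono power_mono) auto
      finally show ?thesis by (simp add: power2_eq_square mult_ac)
    qed
    have 2: "real (Suc n) * tail_bound (real n) \<le> 2 * (real (n + 2) ^ 2 * m ^ n)"
    proof -
      have "exp (- (real n)\<^sup>2 / 4) \<le> exp (real n * (- 1 / 4))"
        using n by (simp add: power2_eq_square)
      also have "\<dots> = exp (- 1 / 4) ^ n" by (rule exp_of_nat_mult)
      also have "\<dots> \<le> m ^ n" using m by (intro power_mono) auto
      finally have "tail_bound (real n) \<le> 2 * m ^ n"
        using sqrt2_less_2 by (intro mult_mono) auto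
      then have "real (Suc n) * tail_bound (real n) \<le> real (n + 2) ^ 2 * (2 * m ^ n)"
      proof (rule mult_mono[rotated])
        have "real (Suc n) * 1 \<le> real (n + 2) * real (n + 2)" by (intro mult_mono) auto
        then show "real (Suc n) \<le> (real (n + 2))\<^sup>2" by (simp add: power2_eq_square)
      qed auto
      then show ?thesis by simp
    qed
    have "m ^ n = h ^ n * h ^ n" by (simp add: h(3)[symmetric] power_mult_distrib)
    then have "real (n + 2) ^ 2 * m ^ n = (real (n + 2) ^ 2 * h ^ n) * h ^ n" by simp
    also have "\<dots> \<le> K * h ^ n"
      using K(2)[of n] h by (intro mult_right_mono) auto
    finally have "(t + 2) * (real (n + 2) ^ 2 * m ^ n) \<le> (t + 2) * (K * h ^ n)"
      using s by (intro mult_left_mono) auto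
    also have "\<dots> = (t + 2) * K / h * h ^ N" using h by (simp add: N)
    also have "\<dots> \<le> C * h ^ N" using h by (intro mult_right_mono) (auto simp: C_def)
    finally have "real (n + 2) * s ^ n * real n / t ^ (n - 1) + real (Suc n) * tail_bound (real n) \<le> C * h ^ N"
      using 1 2 by (simp add: algebra_simps)
    then show ?thesis
      using surv_bound_alternating[OF s, of "real n" n] n unfolding N
      by (meson ennreal_leI of_nat_0_le_iff order_trans)
  qed
  then show ?thesis unfolding exp_decay_def using h by blast
qed

lemma exp_decay_regionE:
  assumes "(a, b) \<in> regionE"
  shows "exp_decay a b"
proof -
  have E: "(a, b) \<notin> regionC" "(a, b) \<notin> regionP" using assms by (auto simp: regionE_def)
  define d where "d = sqrt (a\<^sup>2 + 4 * b)"
  consider (small) "a < 1" "a + b < 1" | (alt) "a < 0" "a + b \<ge> 1"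
    | (complex) "a > 0" "a\<^sup>2 + 4 * b < 0"
    | (real) "1 \<le> a" "a < 2" "a + b < 1" "a\<^sup>2 + 4 * b \<ge> 0"
  proof -
    have "a + b < 1" if "a \<ge> 0" "a < 2"
      using E that by (auto simp: regionC_def regionP_def not_less)
    moreover have "a\<^sup>2 + 4 * b < 0" if "a \<ge> 2"
      using E that by (auto simp: regionC_def regionP_def not_less power2_eq_square)
    ultimately show thesis using small alt complex real by (smt (verit))
  qed
  then show ?thesis
  proof cases
    case small
    then show ?thesis by (rule exp_decay_small_a1)
  next
    case alt
    have "a\<^sup>2 + 4 * b \<ge> (2 - a)\<^sup>2" using alt by (simp add: power2_eq_square algebra_simps)
    then have d: "d \<ge> 2 - a" unfolding d_def by (rule real_le_rsqrt)
    have d2: "d\<^sup>2 = a\<^sup>2 + 4 * b" unfolding d_def using \<open>a\<^sup>2 + 4 * b \<ge> (2 - a)\<^sup>2\<close>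
      by (intro real_sqrt_pow2) (meson order_trans zero_le_power2)
    have ab: "a = (a + d) / 2 - (d - a) / 2" "b = (a + d) / 2 * ((d - a) / 2)"
      using d2 by (auto simp: power2_eq_square field_simps)
    show ?thesis
      using exp_decay_alternating[of "(a + d) / 2" "(d - a) / 2"] d alt
      unfolding ab[symmetric] by simp
  next
    case complex
    then show ?thesis by (rule exp_decay_complex_roots)
  next
    case real
    have d2: "d\<^sup>2 = a\<^sup>2 + 4 * b" unfolding d_def using real by simp
    have "d < 2 - a" unfolding d_def
      using real by (intro real_less_lsqrt) (auto simp: power2_eq_square algebra_simps)
    moreover have "d < a" unfolding d_def
      using real by (intro real_less_lsqrt) auto
    moreover have "d \<ge> 0" using real by (simp add: d_def)
    moreover have ab: "a = (a + d) / 2 + (a - d) / 2" "b = - ((a + d) / 2 * ((a - d) / 2))"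
      using d2 by (auto simp: power2_eq_square field_simps)
    ultimately show ?thesis
      using exp_decay_real_roots[of "(a + d) / 2" "(a - d) / 2"] unfolding ab[symmetric] by auto
  qed
qed

section \<open>Persistence of the random walk\<close>

definition rwalk :: "(nat \<Rightarrow> real) \<Rightarrow> nat \<Rightarrow> real" where
  "rwalk y n = (\<Sum>j<n. y j)"

lemma rwalk_0 [simp]: "rwalk y 0 = 0" and rwalk_Suc: "rwalk y (Suc n) = rwalk y n + y n"
  by (simp_all add: rwalk_def)

lemma measurable_rwalk [measurable (raw)]:
  assumes "f \<in> measurable N noise"
  shows "(\<lambda>x. rwalk (f x) n) \<in> borel_measurable N"
proof -
  have "(\<lambda>y. rwalk y n) \<in> borel_measurable noise" by (simp add: rwalk_def)
  then show ?thesis by (rule measurable_compose[OF assms])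
qed

lemma arp_rwalk: "arp 1 0 x z y n = x + rwalk y n"
  by (induction n rule: induct_nat_012) (simp_all add: rwalk_Suc)

lemma surv_rwalk: "surv 1 0 n x z = emeasure noise {y. \<forall>i\<in>{1..n}. x + rwalk y i \<le> 0}"
  by (simp add: surv_eq_emeasure arp_rwalk)

lemma surv_rwalk_indep: "surv 1 0 n x z = surv 1 0 n x z'"
  by (simp add: surv_rwalk)

lemma surv_0_1:
  "surv 0 1 n x z = surv 1 0 ((n + 1) div 2) z 0 * surv 1 0 (n div 2) x 0"
proof (induction n arbitrary: x z)
  case (Suc n)
  have "surv 0 1 (Suc n) x z = (\<integral>\<^sup>+u. surv 1 0 ((n + 1) div 2) x 0 *
    (indicator {..0} (z + u) * surv 1 0 (n div 2) (z + u) z) \<partial>gauss)"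
    by (simp add: Suc mult_ac surv_rwalk_indep[of "n div 2" "_ + _" z 0])
  also have "\<dots> = surv 1 0 ((n + 1) div 2) x 0 * surv 1 0 (Suc (n div 2)) z 0"
    by (subst nn_integral_cmult) simp_all
  finally show ?case by (simp add: mult.commute)
qed simp

definition neg_seq :: "(nat \<Rightarrow> real) \<Rightarrow> nat \<Rightarrow> real" where
  "neg_seq y n = - y n"

lemma indep_vars_noise: "noise.indep_vars (\<lambda>_. borel) (\<lambda>n y. y n) UNIV"
proof -
  have "distr noise borel (\<lambda>y. y n) = gauss" for n
    using distr_noise_component[of n] by (simp cong: distr_cong)
  moreover have "distr noise (PiM UNIV (\<lambda>_. borel)) (\<lambda>y. \<lambda>n\<in>UNIV. y n) = noise"
    by (simp add: restrict_def distr_id2 cong: sets_PiM_cong)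
  ultimately show ?thesis
    by (subst noise.indep_vars_iff_distr_eq_PiM') auto
qed

lemma distr_gauss_uminus: "distr gauss borel (\<lambda>u. - u) = gauss"
proof -
  have "distributed gauss lborel (\<lambda>x. x) (\<lambda>x. ennreal (std_normal_density x))"
    unfolding distributed_def by (simp add: gauss_def distr_id2)
  then have "distributed gauss lborel (\<lambda>x. 0 + (- 1) * x) (\<lambda>x. ennreal (normal_density (0 + (- 1) * 0) (\<bar>- 1\<bar> * 1) x))"
    by (intro gauss.normal_density_affine) auto
  then show ?thesis
    unfolding distributed_def by (simp add: gauss_def[symmetric] cong: distr_cong)
qed

lemma distr_noise_neg: "distr noise noise neg_seq = noise"
proof -
  have "distr noise noise (\<lambda>y n. - y n) = noise"
  proof (rule distr_noise_iid)
    show "noise.indep_vars (\<lambda>_. borel) (\<lambda>n y. - y n) UNIV"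
      using noise.indep_vars_compose2[OF indep_vars_noise, of "\<lambda>_ u. - u" "\<lambda>_. borel"] by simp
    have "distr noise borel (\<lambda>y. - y n) = distr (distr noise gauss (\<lambda>y. y n)) borel (\<lambda>u. - u)" for n
      by (subst distr_distr) (auto simp: comp_def)
    then show "distr noise borel (\<lambda>y. - y n) = gauss" for n
      by (simp add: distr_noise_component distr_gauss_uminus)
  qed unfold_locales
  then show ?thesis by (simp add: neg_seq_def[abs_def])
qed

lemma measurable_neg_seq [measurable]: "neg_seq \<in> measurable noise noise"
  unfolding neg_seq_def[abs_def] by (rule measurable_PiM_single') auto

definition rev_seq :: "nat \<Rightarrow> (nat \<Rightarrow> real) \<Rightarrow> nat \<Rightarrow> real" where
  "rev_seq k y n = y (if n < k then k - 1 - n else n)"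

lemma measurable_rev_seq [measurable]: "rev_seq k \<in> measurable noise noise"
  unfolding rev_seq_def[abs_def] by (rule measurable_PiM_single') auto

lemma distr_noise_rev: "distr noise noise (rev_seq k) = noise"
proof -
  have "inj (\<lambda>n. if n < k then k - 1 - n else n)"
    by (rule injI) (auto split: if_splits)
  from distr_PiM_reindex[OF _ this, of UNIV "\<lambda>_. gauss"] show ?thesis
    by (simp add: rev_seq_def[abs_def] restrict_def prob_space_gauss)
qed

lemma emeasure_noise_neg: "{y. P y} \<in> sets noise \<Longrightarrow> emeasure noise {y. P (neg_seq y)} = emeasure noise {y. P y}"
  by (subst (2) distr_noise_neg[symmetric]) (simp add: emeasure_distr vimage_def)

lemma emeasure_noise_rev: "{y. P y} \<in> sets noise \<Longrightarrow> emeasure noise {y. P (rev_seq k y)} = emeasure noise {y. P y}"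
  by (subst (2) distr_noise_rev[symmetric, of k]) (simp add: emeasure_distr vimage_def)

lemma rwalk_tie_null: "emeasure noise {y. rwalk y (Suc n) = 0} = 0"
proof -
  have r: "rwalk y n = ar1 1 y n" for y n by (induction n) (simp_all add: rwalk_Suc)
  have "emeasure noise {y. rwalk y (Suc n) = 0} = (\<integral>\<^sup>+y. indicator {y. rwalk y (Suc n) = 0} y \<partial>noise)"
    by (subst nn_integral_indicator) (auto intro!: noise_event)
  also have "\<dots> = (\<integral>\<^sup>+y. \<integral>\<^sup>+u. indicator {y. rwalk y (Suc n) = 0} (case_nat u y) \<partial>gauss \<partial>noise)"
    by (rule nn_integral_noise_iter') (auto intro!: noise_event borel_measurable_indicator)
  also have "\<dots> = (\<integral>\<^sup>+y. \<integral>\<^sup>+u. indicator {- rwalk y n} u \<partial>gauss \<partial>noise)"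
    unfolding r by (intro nn_integral_cong) (auto simp: indicator_def ar1_case_nat simp del: ar1.simps)
  also have "\<dots> = (\<integral>\<^sup>+y. 0 \<partial>noise)"
  proof (intro nn_integral_cong)
    fix y
    show "(\<integral>\<^sup>+u. indicator {- rwalk y n} u \<partial>gauss) = 0"
      using gauss_Icc_le[of "- rwalk y n" "- rwalk y n"] by simp
  qed
  finally show ?thesis by simp
qed

definition rwp :: "nat \<Rightarrow> real" where
  "rwp n = measure noise {y. \<forall>i\<in>{1..n}. rwalk y i \<le> 0}"

lemma surv_eq_rwp: "surv 1 0 n 0 0 = ennreal (rwp n)"
  by (simp add: surv_rwalk rwp_def noise.emeasure_eq_measure)

lemma rwalk_pos_prob: "emeasure noise {y. \<forall>i\<in>{1..n}. 0 < rwalk y i} = ennreal (rwp n)"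
proof -
  have "emeasure noise {y. \<forall>i\<in>{1..n}. 0 < rwalk y i} = emeasure noise {y. \<forall>i\<in>{1..n}. 0 \<le> rwalk y i}"
  proof (rule emeasure_eq_AE)
    have "AE y in noise. \<forall>i\<in>{1..n}. rwalk y i \<noteq> 0"
    proof (intro AE_finite_allI)
      fix i assume "i \<in> {1..n}"
      then obtain j where "i = Suc j" by (cases i) auto
      then show "AE y in noise. rwalk y i \<noteq> 0"
        using rwalk_tie_null[of j] by (intro AE_I[of _ _ "{y. rwalk y (Suc j) = 0}"]) (auto intro!: noise_event)
    qed simp
    then show "AE y in noise. (y \<in> {y. \<forall>i\<in>{1..n}. 0 < rwalk y i}) = (y \<in> {y. \<forall>i\<in>{1..n}. 0 \<le> rwalk y i})"
      by eventually_elim (force simp: less_le)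
  qed (auto intro!: noise_event)
  also have "{y. \<forall>i\<in>{1..n}. 0 \<le> rwalk y i} = {y. \<forall>i\<in>{1..n}. rwalk (neg_seq y) i \<le> 0}"
    by (simp add: rwalk_def neg_seq_def sum_negf)
  also have "emeasure noise \<dots> = emeasure noise {y. \<forall>i\<in>{1..n}. rwalk y i \<le> 0}"
    by (rule emeasure_noise_neg) (auto intro!: noise_event)
  finally show ?thesis by (simp add: rwp_def noise.emeasure_eq_measure)
qed


lemma emeasure_noise_comb:
  assumes "{y. P y} \<in> sets noise"
    and "\<And>a b. P (comb_seq k a b) \<longleftrightarrow> Q a \<and> R b"
    and "{y. Q y} \<in> sets noise" "{y. R y} \<in> sets noise"
  shows "emeasure noise {y. P y} = emeasure noise {y. Q y} * emeasure noise {y. R y}"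
proof -
  have "emeasure noise {y. P y} = (\<integral>\<^sup>+y. indicator {y. P y} y \<partial>noise)"
    using assms(1) by simp
  also have "\<dots> = (\<integral>\<^sup>+a. \<integral>\<^sup>+b. indicator {y. P y} (comb_seq k a b) \<partial>noise \<partial>noise)"
    by (rule nn_integral_noise_comb) (use assms in auto)
  also have "\<dots> = (\<integral>\<^sup>+a. \<integral>\<^sup>+b. indicator {y. Q y} a * indicator {y. R y} b \<partial>noise \<partial>noise)"
    using assms(2) by (intro nn_integral_cong) (auto simp: indicator_def)
  also have "\<dots> = emeasure noise {y. Q y} * emeasure noise {y. R y}"
    using assms(3,4) by (simp add: nn_integral_cmult nn_integral_multc)
  finally show ?thesis .
qed

lemma rwalk_comb_seq_le: "i \<le> k \<Longrightarrow> rwalk (comb_seq k a b) i = rwalk a i"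
  by (auto simp: rwalk_def comb_seq_def intro!: sum.cong)

lemma rwalk_comb_seq_add: "rwalk (comb_seq k a b) (k + i) = rwalk a k + rwalk b i"
proof (induction i)
  case (Suc i)
  have "comb_seq k a b (k + i) = b i" by (simp add: comb_seq_def)
  then show ?case using Suc by (simp add: rwalk_Suc)
qed (simp add: rwalk_comb_seq_le)

lemma rwalk_rev_seq: "i \<le> k \<Longrightarrow> rwalk (rev_seq k y) i = rwalk y k - rwalk y (k - i)"
proof (induction i)
  case (Suc i)
  have "k - i = Suc (k - Suc i)" using Suc.prems by simp
  then show ?case using Suc by (simp add: rwalk_Suc rev_seq_def)
qed simp

text \<open>Splitting at the first maximum of the walk: the reversed increments
  before it have positive partial sums, the increments after it nonpositive ones.\<close>

lemma rwp_convolution: "(\<Sum>k\<le>n. rwp k * rwp (n - k)) = 1"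
proof -
  define A where "A k = {y. (\<forall>i\<in>{1..k}. 0 < rwalk y k - rwalk y (k - i)) \<and>
    (\<forall>i\<in>{1..n-k}. rwalk y (k + i) \<le> rwalk y k)}" for k
  have le [measurable]: "Measurable.pred noise (\<lambda>y. rwalk y i \<le> rwalk y j)" for i j
    unfolding pred_def by (rule borel_measurable_le) measurable
  have A_sets: "A k \<in> sets noise" for k
  proof -
    have "Measurable.pred noise (\<lambda>y. \<forall>i\<in>{1..n-k}. rwalk y (k + i) \<le> rwalk y k)"
      by (intro pred_intros_finite le) simp
    then show ?thesis unfolding A_def by (intro noise_event pred_intros_logic) measurable
  qed
  have prob: "emeasure noise (A k) = ennreal (rwp k * rwp (n - k))" for k
  proof -
    have "emeasure noise (A k) = emeasure noise {y. \<forall>i\<in>{1..k}. 0 < rwalk (rev_seq k y) i} *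
      emeasure noise {y. \<forall>i\<in>{1..n-k}. rwalk y i \<le> 0}"
      unfolding A_def
    proof (rule emeasure_noise_comb[where k = k])
      fix a b
      have "(\<forall>i\<in>{1..k}. 0 < rwalk (comb_seq k a b) k - rwalk (comb_seq k a b) (k - i)) \<longleftrightarrow>
        (\<forall>i\<in>{1..k}. 0 < rwalk (rev_seq k a) i)"
        by (intro ball_cong) (auto simp: rwalk_comb_seq_le rwalk_rev_seq)
      then show "(\<forall>i\<in>{1..k}. 0 < rwalk (comb_seq k a b) k - rwalk (comb_seq k a b) (k - i)) \<and>
        (\<forall>i\<in>{1..n-k}. rwalk (comb_seq k a b) (k + i) \<le> rwalk (comb_seq k a b) k) \<longleftrightarrow>
        (\<forall>i\<in>{1..k}. 0 < rwalk (rev_seq k a) i) \<and> (\<forall>i\<in>{1..n-k}. rwalk b i \<le> 0)"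
        by (simp add: rwalk_comb_seq_le rwalk_comb_seq_add)
    next
      show "{y. (\<forall>i\<in>{1..k}. 0 < rwalk y k - rwalk y (k - i)) \<and> (\<forall>i\<in>{1..n - k}. rwalk y (k + i) \<le> rwalk y k)} \<in> sets noise"
        using A_sets unfolding A_def .
      show "{y. \<forall>i\<in>{1..k}. 0 < rwalk (rev_seq k y) i} \<in> sets noise"
        by (rule noise_event) measurable
      show "{y. \<forall>i\<in>{1..n-k}. rwalk y i \<le> 0} \<in> sets noise"
        by (rule noise_event) measurable
    qed
    also have "emeasure noise {y. \<forall>i\<in>{1..k}. 0 < rwalk (rev_seq k y) i} = ennreal (rwp k)"
      unfolding rwalk_pos_prob[symmetric] by (rule emeasure_noise_rev, rule noise_event) measurable
    finally show ?thesis
      by (simp add: rwp_def noise.emeasure_eq_measure ennreal_mult)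
  qed
  have disj: "disjoint_family_on A {..n}"
  proof (unfold disjoint_family_on_def, intro ballI impI)
    have "A k \<inter> A l = {}" if "k < l" "l \<le> n" for k l
    proof (rule ccontr)
      assume "A k \<inter> A l \<noteq> {}"
      then obtain y where y: "y \<in> A k" "y \<in> A l" by auto
      have l: "l - k \<in> {1..n - k}" "l - k \<in> {1..l}" using that by auto
      have "\<forall>i\<in>{1..n-k}. rwalk y (k + i) \<le> rwalk y k" using y(1) unfolding A_def by blast
      then have "rwalk y (k + (l - k)) \<le> rwalk y k" using l by blast
      moreover have "\<forall>i\<in>{1..l}. 0 < rwalk y l - rwalk y (l - i)" using y(2) unfolding A_def by blast
      then have "0 < rwalk y l - rwalk y (l - (l - k))" using l by blast
      ultimately show False using that by simp
    qed
    then show "A k \<inter> A l = {}" if "k \<in> {..n}" "l \<in> {..n}" "k \<noteq> l" for k l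
      using that by (metis Int_commute atMost_iff linorder_neqE_nat)
  qed
  have cover: "(\<Union>k\<le>n. A k) = UNIV"
  proof (intro set_eqI iffI UNIV_I)
    fix y :: "nat \<Rightarrow> real"
    define m where "m = Max (rwalk y ` {..n})"
    have m: "rwalk y i \<le> m" if "i \<le> n" for i unfolding m_def using that by auto
    have "m \<in> rwalk y ` {..n}" unfolding m_def by (rule Max_in) auto
    then have ex: "\<exists>k. k \<le> n \<and> rwalk y k = m" by auto
    define k where "k = (LEAST k. k \<le> n \<and> rwalk y k = m)"
    have k: "k \<le> n" "rwalk y k = m" using LeastI_ex[OF ex] by (auto simp: k_def)
    have "rwalk y (k - i) < m" if "i \<in> {1..k}" for i
    proof -
      have "k - i < k" using that by auto
      then have "\<not> (k - i \<le> n \<and> rwalk y (k - i) = m)"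
        unfolding k_def by (rule not_less_Least)
      then have "rwalk y (k - i) \<noteq> m" using k(1) by simp
      then show ?thesis using m[of "k - i"] k(1) by (simp add: less_le)
    qed
    moreover have "rwalk y (k + i) \<le> m" if "i \<in> {1..n-k}" for i by (rule m) (use that k(1) in auto)
    ultimately have "y \<in> A k" by (simp add: A_def k(2))
    then show "y \<in> (\<Union>k\<le>n. A k)" using k by auto
  qed
  have "ennreal (\<Sum>k\<le>n. rwp k * rwp (n - k)) = (\<Sum>k\<le>n. emeasure noise (A k))"
    by (simp add: prob sum_ennreal rwp_def)
  also have "\<dots> = emeasure noise (\<Union>k\<le>n. A k)"
    by (rule sum_emeasure) (use A_sets disj in auto)
  also have "\<dots> = 1" unfolding cover using noise.emeasure_space_1 by simp
  finally show ?thesis by simp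
qed

lemma rwp_eq_gbinomial: "rwp n = (- 1) ^ n * ((- 1 / 2) gchoose n)"
proof (induction n rule: less_induct)
  case (less n)
  define c where "c k = (- 1) ^ k * ((- 1 / 2 :: real) gchoose k)" for k
  have c: "(\<Sum>k\<le>n. c k * c (n - k)) = 1" for n
  proof -
    have "(\<Sum>k\<le>n. c k * c (n - k)) = (- 1) ^ n * (\<Sum>k\<le>n. ((- 1 / 2) gchoose k) * ((- 1 / 2) gchoose (n - k)))"
      unfolding c_def sum_distrib_left
    proof (intro sum.cong refl)
      fix k assume "k \<in> {..n}"
      then have "(- 1 :: real) ^ n = (- 1) ^ k * (- 1) ^ (n - k)" by (simp add: power_add[symmetric])
      then show "(- 1) ^ k * ((- 1 / 2 :: real) gchoose k) * ((- 1) ^ (n - k) * ((- 1 / 2) gchoose (n - k))) =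
        (- 1) ^ n * (((- 1 / 2) gchoose k) * ((- 1 / 2) gchoose (n - k)))" by simp
    qed
    also have "(\<Sum>k\<le>n. ((- 1 / 2 :: real) gchoose k) * ((- 1 / 2) gchoose (n - k))) = (- 1) gchoose n"
      using gbinomial_Vandermonde[of "- 1 / 2 :: real" "- 1 / 2" n] by (simp add: atLeast0AtMost)
    also have "(- 1 :: real) gchoose n = (- 1) ^ n"
      using gbinomial_minus[of "1 :: real" n] by (simp add: binomial_gbinomial[symmetric])
    finally show ?thesis by (simp add: power_mult_distrib[symmetric])
  qed
  show ?case
  proof (cases n)
    case 0
    then show ?thesis using noise.emeasure_space_1 by (simp add: rwp_def measure_def)
  next
    case (Suc m)
    have split: "(\<Sum>k\<le>n. f k * f (n - k)) = 2 * f n * f 0 + (\<Sum>k=1..m. f k * f (n - k))" for f :: "nat \<Rightarrow> real"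
    proof -
      have "{..n} = insert 0 (insert n {1..m})" using Suc by auto
      then show ?thesis using Suc by simp
    qed
    have r0: "rwp 0 = 1" using noise.emeasure_space_1 by (simp add: rwp_def measure_def)
    have "(\<Sum>k=1..m. rwp k * rwp (n - k)) = (\<Sum>k=1..m. c k * c (n - k))"
      using less Suc by (intro sum.cong) (auto simp: c_def)
    then have "2 * rwp n * rwp 0 = 2 * c n * c 0"
      using rwp_convolution[of n] c[of n] split[of rwp] split[of c] by simp
    then show ?thesis by (simp add: c_def r0)
  qed
qed

lemma rwp_asymptotic: "(\<lambda>n. rwp n * sqrt (real n)) \<longlonglongrightarrow> 1 / sqrt pi"
proof -
  have lim: "(\<lambda>n. ((- 1 / 2 :: real) gchoose n) / ((-1)^n / exp ((- 1 / 2 + 1) * of_real (ln (real n))))) \<longlonglongrightarrow>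
    inverse (Gamma (- (- 1 / 2)))"
    by (rule gbinomial_asymptotic)
  have G: "inverse (Gamma (- (- 1 / 2 :: real))) = 1 / sqrt pi"
    using Gamma_one_half_real by (simp add: field_simps)
  have ev: "\<forall>\<^sub>F n in sequentially. ((- 1 / 2 :: real) gchoose n) / ((-1)^n / exp ((- 1 / 2 + 1) * of_real (ln (real n)))) = rwp n * sqrt (real n)"
    using eventually_gt_at_top[of 0]
  proof eventually_elim
    case (elim n)
    have "exp ((- 1 / 2 + 1) * of_real (ln (real n))) = sqrt (real n)"
      using elim by (simp add: powr_half_sqrt[symmetric] powr_def)
    then show ?case
      by (cases "even n") (simp_all add: rwp_eq_gbinomial)
  qed
  show ?thesis by (rule Lim_transform_eventually[OF lim[unfolded G] ev])
qed

section \<open>Simple unit root\<close>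

definition persist :: "real \<Rightarrow> real \<Rightarrow> nat \<Rightarrow> real" where
  "persist a b n = enn2real (surv a b n 0 0)"

lemma surv_eq_persist: "surv a b n 0 0 = ennreal (persist a b n)"
  unfolding persist_def using surv_le_1[of a b n 0 0]
  by (metis ennreal_enn2real ennreal_one_less_top le_less_trans)

lemma persist_nonneg: "0 \<le> persist a b n"
  by (simp add: persist_def)

lemma persist_antimono: "m \<le> n \<Longrightarrow> persist a b n \<le> persist a b m"
  using surv_antimono'[of m n a b 0 0] by (simp add: surv_eq_persist persist_nonneg)

lemma persist_rwalk: "persist 1 0 n = rwp n"
  unfolding persist_def surv_eq_rwp by (simp add: rwp_def)

lemma arp_unit_root_walk:
  "arp (1 + b) (- b) x z y (Suc n) - b * arp (1 + b) (- b) x z y n = x - b * z + rwalk y (Suc n)"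
  by (induction n) (simp_all add: rwalk_Suc algebra_simps)

lemma arp_unit_root_increment:
  "arp (1 + b) (- b) x z y (Suc n) - arp (1 + b) (- b) x z y n = b ^ Suc n * (x - z) + ar1 b y (Suc n)"
proof (induction n)
  case (Suc n)
  have "arp (1 + b) (- b) x z y (Suc (Suc n)) - arp (1 + b) (- b) x z y (Suc n) =
    b * (arp (1 + b) (- b) x z y (Suc n) - arp (1 + b) (- b) x z y n) + y (Suc n)"
    by (simp add: algebra_simps)
  then show ?case unfolding Suc by (simp add: algebra_simps)
qed (simp add: algebra_simps)

lemma arp_unit_root:
  "(1 - b) * arp (1 + b) (- b) x z y (Suc n) =
    x - b * z + rwalk y (Suc n) - b * (b ^ Suc n * (x - z) + ar1 b y (Suc n))"
  unfolding arp_unit_root_walk[symmetric] arp_unit_root_increment[symmetric] by (simp add: algebra_simps)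

lemma ar1_bound_stable:
  assumes "\<bar>b\<bar> < 1" "L \<ge> 0" "\<And>j. j < n \<Longrightarrow> \<bar>y j\<bar> \<le> L"
  shows "\<bar>ar1 b y n\<bar> \<le> L / (1 - \<bar>b\<bar>)"
  using assms(3)
proof (induction n)
  case (Suc n)
  have "\<bar>ar1 b y (Suc n)\<bar> \<le> \<bar>b\<bar> * \<bar>ar1 b y n\<bar> + \<bar>y n\<bar>"
    using abs_triangle_ineq[of "b * ar1 b y n" "y n"] by (simp add: abs_mult)
  also have "\<dots> \<le> \<bar>b\<bar> * (L / (1 - \<bar>b\<bar>)) + L"
    using Suc by (intro add_mono mult_left_mono) auto
  also have "\<dots> = L / (1 - \<bar>b\<bar>)" using assms by (simp add: field_simps)
  finally show ?case .
qed (use assms in auto)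

lemma surv_rwalk_mono: "x \<le> x' \<Longrightarrow> surv 1 0 n x' z' \<le> surv 1 0 n x z"
  unfolding surv_rwalk by (rule emeasure_mono) (force intro!: noise_event)+

lemma surv_rwalk_descend:
  assumes "x \<le> 0"
  shows "surv 1 0 n (x - real k) z * emeasure gauss {..-1} ^ k \<le> surv 1 0 (n + k) x z'"
  using assms
proof (induction k arbitrary: x z')
  case 0
  then show ?case using surv_rwalk_mono[of x x] by simp
next
  case (Suc k)
  have "surv 1 0 n (x - real (Suc k)) z * emeasure gauss {..-1} ^ k * emeasure gauss {..-1} \<le> surv 1 0 (Suc (n + k)) x z'"
  proof (rule surv_ge_step)
    fix u :: real assume "u \<in> {..-1}"
    then have u: "u \<le> -1" by simp
    have "surv 1 0 n (x - real (Suc k)) z * emeasure gauss {..-1} ^ k \<le> surv 1 0 (n + k) (x - 1) x"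
      using Suc.IH[of "x - 1" x] Suc.prems by (simp add: algebra_simps)
    also have "\<dots> \<le> surv 1 0 (n + k) (1 * x + 0 * z' + u) x"
      using u by (intro surv_rwalk_mono) auto
    finally show "1 * x + 0 * z' + u \<le> 0 \<and>
      surv 1 0 n (x - real (Suc k)) z * emeasure gauss {..-1} ^ k \<le> surv 1 0 (n + k) (1 * x + 0 * z' + u) x"
      using u Suc.prems by simp
  qed simp
  then show ?case by (simp add: mult_ac)
qed

lemma unit_root_upper_pos:
  assumes b: "0 \<le> b" "b < 1" and L: "L \<ge> 0" and k: "b * L / (1 - b) \<le> real k"
  shows "persist (1 + b) (- b) n * gauss.prob {..-1} ^ k \<le> rwp n + real n * tail_bound L"
proof -
  let ?X = "arp (1 + b) (- b) 0 0" and ?g = "emeasure gauss {..-1}"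
  let ?e = "real n * tail_bound L"
  have walk: "- real k + rwalk y i \<le> 0"
    if y: "\<forall>i\<in>{1..n}. ?X y i \<le> 0" and yL: "\<And>j. j < n \<Longrightarrow> \<bar>y j\<bar> \<le> L" and i: "i \<in> {1..n}" for y i
  proof -
    obtain m where m: "i = Suc m" using i by (cases i) auto
    have "\<bar>ar1 b y i\<bar> \<le> L / (1 - \<bar>b\<bar>)" using yL i b L by (intro ar1_bound_stable) auto
    then have "b * ar1 b y i \<le> b * (L / (1 - b))" using b by (intro mult_left_mono) auto
    moreover have "(1 - b) * ?X y i \<le> 0" using y i b by (auto simp: mult_le_0_iff)
    ultimately show ?thesis using arp_unit_root[of b 0 0 y m] k by (simp add: m)
  qed
  have "surv (1 + b) (- b) n 0 0 \<le> surv 1 0 n (0 - real k) 0 + ennreal ?e"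
    unfolding surv_rwalk surv_eq_emeasure[of "1 + b"] diff_0
    by (rule emeasure_noise_truncate[OF L _ ballI[OF walk]]) auto
  then have "surv (1 + b) (- b) n 0 0 * ?g ^ k \<le> (surv 1 0 n (0 - real k) 0 + ennreal ?e) * ?g ^ k"
    by (rule mult_right_mono) simp
  also have "\<dots> = surv 1 0 n (0 - real k) 0 * ?g ^ k + ennreal ?e * ?g ^ k"
    by (rule distrib_right)
  also have "\<dots> \<le> surv 1 0 (n + k) 0 0 + ennreal ?e * 1"
    by (intro add_mono surv_rwalk_descend mult_left_mono power_le_one_iff[THEN iffD2])
       (auto simp: gauss.emeasure_le_1 power_le_one)
  also have "\<dots> \<le> surv 1 0 n 0 0 + ennreal ?e"
    by (intro add_mono surv_antimono') auto
  also have "\<dots> = ennreal (rwp n + ?e)"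
    by (simp add: surv_eq_rwp ennreal_plus rwp_def)
  finally have "ennreal (persist (1 + b) (- b) n * gauss.prob {..-1} ^ k) \<le> ennreal (rwp n + ?e)"
    by (simp add: surv_eq_persist emeasure_gauss_eq ennreal_mult persist_nonneg ennreal_power)
  then show ?thesis by (subst (asm) ennreal_le_iff) (auto simp: rwp_def)
qed

lemma unit_root_lower_pos:
  assumes b: "0 \<le> b"
  shows "rwp n \<le> persist (1 + b) (- b) n"
proof -
  have "surv 1 0 n 0 0 \<le> surv (1 + b) (- b) n 0 0"
    unfolding surv_rwalk[of n 0 0] surv_eq_emeasure[of "1 + b"]
  proof (rule emeasure_mono)
    show "{y. \<forall>i\<in>{1..n}. 0 + rwalk y i \<le> 0} \<subseteq> {y. \<forall>i\<in>{1..n}. arp (1 + b) (- b) 0 0 y i \<le> 0}"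
    proof (intro subsetI CollectI ballI)
      fix y i assume y: "y \<in> {y. \<forall>i\<in>{1..n}. 0 + rwalk y i \<le> 0}"
      assume "i \<in> {1..n}"
      then have "i \<le> n" by simp
      then show "arp (1 + b) (- b) 0 0 y i \<le> 0"
      proof (induction i)
        case (Suc i)
        have "b * arp (1 + b) (- b) 0 0 y i \<le> 0" using Suc b by (simp add: mult_le_0_iff)
        moreover have "rwalk y (Suc i) \<le> 0" using y Suc.prems by auto
        ultimately show ?case using arp_unit_root_walk[of b 0 0 y i] by simp
      qed simp
    qed
  qed (auto intro!: noise_event)
  then show ?thesis by (simp add: surv_eq_persist persist_rwalk[symmetric] persist_nonneg)
qed

lemma unit_root_upper_neg:
  assumes b: "b \<le> 0"
  shows "persist (1 + b) (- b) n \<le> rwp n"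
proof -
  have "surv (1 + b) (- b) n 0 0 \<le> surv 1 0 n 0 0"
    unfolding surv_rwalk[of n 0 0] surv_eq_emeasure[of "1 + b"]
  proof (rule emeasure_mono)
    show "{y. \<forall>i\<in>{1..n}. arp (1 + b) (- b) 0 0 y i \<le> 0} \<subseteq> {y. \<forall>i\<in>{1..n}. 0 + rwalk y i \<le> 0}"
    proof (intro subsetI CollectI ballI)
      fix y i assume y: "y \<in> {y. \<forall>i\<in>{1..n}. arp (1 + b) (- b) 0 0 y i \<le> 0}" and i: "i \<in> {1..n}"
      obtain m where m: "i = Suc m" using i by (cases i) auto
      have "arp (1 + b) (- b) 0 0 y m \<le> 0" using y i m by (cases m) auto
      then have "b * arp (1 + b) (- b) 0 0 y m \<ge> 0" using b by (simp add: mult_nonpos_nonpos)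
      moreover have "arp (1 + b) (- b) 0 0 y i \<le> 0" using y i by auto
      ultimately show "0 + rwalk y i \<le> 0" using arp_unit_root_walk[of b 0 0 y m] by (simp add: m)
    qed
  qed (auto intro!: noise_event)
  then show ?thesis by (simp add: surv_eq_persist persist_rwalk[symmetric] persist_nonneg)
qed

lemma unit_root_lower_neg:
  assumes t: "0 < t" "t < 1" and L: "L \<ge> 0" and k: "1 + L / (1 - t) \<le> real k"
  shows "(rwp n - real n * tail_bound L) * gauss.prob {-1..-t} ^ k \<le> persist (1 - t) t n"
proof -
  let ?e = "real n * tail_bound L"
  define c where "c = ennreal (rwp n - ?e)"
  have base: "c \<le> surv (1 - t) t n x z" if xz: "-1 \<le> x - z" "x - z \<le> 0" "x + t * z \<le> - real k * t" for x z
  proof -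
    have neg: "arp (1 - t) t x z y i \<le> 0"
      if y: "\<forall>i\<in>{1..n}. 0 + rwalk y i \<le> 0" and yL: "\<And>j. j < n \<Longrightarrow> \<bar>y j\<bar> \<le> L" and i: "i \<in> {1..n}" for y i
    proof (rule ccontr)
      assume pos: "\<not> ?thesis"
      obtain m where m: "i = Suc m" using i by (cases i) auto
      have 1: "\<bar>ar1 (- t) y i\<bar> \<le> L / (1 - \<bar>- t\<bar>)" using yL i t L by (intro ar1_bound_stable) auto
      have "\<bar>(- t) ^ i * (x - z)\<bar> \<le> 1 * 1"
        unfolding abs_mult power_abs using xz t by (intro mult_mono power_le_one) auto
      then have "(- t) ^ i * (x - z) + ar1 (- t) y i \<le> 1 + L / (1 - t)"
        using 1 t by simp
      also note k
      finally have "t * ((- t) ^ i * (x - z) + ar1 (- t) y i) \<le> t * real k"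
        using t by (intro mult_left_mono) auto
      moreover have "(1 + t) * arp (1 - t) t x z y i > 0" using pos t by simp
      moreover have "rwalk y i \<le> 0" using y i by auto
      ultimately show False using arp_unit_root[of "- t" x z y m] xz by (simp add: m mult.commute)
    qed
    have "ennreal (rwp n) \<le> surv (1 - t) t n x z + ennreal ?e"
      unfolding surv_eq_rwp[symmetric] surv_rwalk surv_eq_emeasure[of "1 - t"]
      by (rule emeasure_noise_truncate[OF L _ ballI[OF neg]]) auto
    then have "ennreal (rwp n) - ennreal ?e \<le> surv (1 - t) t n x z"
      by (simp add: ennreal_minus_le_iff add.commute)
    then show ?thesis unfolding c_def by (simp add: ennreal_minus)
  qed
  have desc: "c * emeasure gauss {-1..-t} ^ j \<le> surv (1 - t) t (n + j) x z"
    if "x \<le> 0" "-1 \<le> x - z" "x - z \<le> 0" "x + t * z \<le> - real i * t" "i + j = k" for i j x z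
    using that
  proof (induction j arbitrary: i x z)
    case 0
    then show ?case using base[of x z] by simp
  next
    case (Suc j)
    have "c * emeasure gauss {-1..-t} ^ j * emeasure gauss {-1..-t} \<le> surv (1 - t) t (Suc (n + j)) x z"
    proof (rule surv_ge_step)
      fix u assume "u \<in> {-1..-t}"
      then have u: "-1 \<le> u" "u \<le> -t" by auto
      have "t * (z - x) \<le> t * 1" "0 \<le> t * (z - x)"
        using Suc.prems t by (auto intro!: mult_left_mono)
      then have d: "0 \<le> - (t * (x - z))" "- (t * (x - z)) \<le> t"
        by (simp_all add: algebra_simps)
      define w where "w = (1 - t) * x + t * z + u"
      have w: "w - x = - (t * (x - z)) + u" "w + t * x = x + t * z + u"
        by (simp_all add: w_def algebra_simps)
      have "c * emeasure gauss {-1..-t} ^ j \<le> surv (1 - t) t (n + j) w x"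
      proof (rule Suc.IH[of _ _ "Suc i"])
        show "w + t * x \<le> - real (Suc i) * t" unfolding w using Suc.prems u by (simp add: algebra_simps)
        show "w \<le> 0" "-1 \<le> w - x" "w - x \<le> 0" using w(1) d u Suc.prems by linarith+
      qed (use Suc.prems in auto)
      moreover have "w \<le> 0" using w(1) d u Suc.prems by linarith
      ultimately show "(1 - t) * x + t * z + u \<le> 0 \<and>
        c * emeasure gauss {-1..-t} ^ j \<le> surv (1 - t) t (n + j) ((1 - t) * x + t * z + u) x"
        by (simp add: w_def)
    qed simp
    then show ?case by (simp add: mult_ac)
  qed
  have "c * emeasure gauss {-1..-t} ^ k \<le> surv (1 - t) t (n + k) 0 0"
    by (rule desc[of _ _ 0]) auto
  also have "\<dots> \<le> surv (1 - t) t n 0 0" by (rule surv_antimono') simp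
  finally have *: "c * ennreal (gauss.prob {-1..-t} ^ k) \<le> ennreal (persist (1 - t) t n)"
    by (simp add: surv_eq_persist emeasure_gauss_eq ennreal_power)
  show ?thesis
  proof (cases "rwp n - ?e \<ge> 0")
    case True
    then show ?thesis using * unfolding c_def by (simp add: ennreal_mult[symmetric] persist_nonneg)
  next
    case False
    then have "(rwp n - ?e) * gauss.prob {-1..-t} ^ k \<le> 0" by (simp add: mult_le_0_iff)
    then show ?thesis using persist_nonneg order_trans by blast
  qed
qed

lemma rwp_sqrt_bounds:
  "\<forall>\<^sub>F n in sequentially. 0 < rwp n \<and>
    real n * tail_bound (sqrt 8 * sqrt (ln (real n))) \<le> rwp n / 2"
proof -
  have "1 / 2 < 1 / sqrt pi"
  proof -
    have "sqrt pi < sqrt (2 ^ 2)" using pi_less_4 by (intro real_sqrt_less_mono) simp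
    then show ?thesis by (simp add: field_simps)
  qed
  then have "\<forall>\<^sub>F n in sequentially. 1 / 2 < rwp n * sqrt (real n)"
    using rwp_asymptotic by (intro order_tendstoD)
  moreover have "\<forall>\<^sub>F n in sequentially. sqrt 2 / real n \<le> 1 / (4 * sqrt (real n))"
    by real_asymp
  ultimately show ?thesis using eventually_gt_at_top[of 0]
  proof eventually_elim
    case (elim n)
    have r: "1 / (2 * sqrt (real n)) < rwp n" using elim by (simp add: field_simps)
    have "exp (- (sqrt 8 * sqrt (ln (real n)))\<^sup>2 / 4) = exp (- ln (real n) - ln (real n))"
      using elim by (simp add: power_mult_distrib)
    also have "\<dots> = 1 / real n * (1 / real n)"
      using elim unfolding exp_diff by (simp add: exp_minus inverse_eq_divide)
    finally have "real n * tail_bound (sqrt 8 * sqrt (ln (real n))) = sqrt 2 / real n"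
      using elim by simp
    moreover have "0 < 1 / (2 * sqrt (real n))" using elim by simp
    moreover have "1 / (4 * sqrt (real n)) = 1 / (2 * sqrt (real n)) / 2" by simp
    ultimately show ?case using r elim(2) by linarith
  qed
qed

lemma ceiling_power_ge_exp:
  assumes "0 < (g::real)" "g < 1" "c \<ge> 0"
  obtains C where "C \<ge> 0" "\<And>l. l \<ge> 0 \<Longrightarrow> 2 * exp (- (C * (1 + l))) \<le> g ^ nat \<lceil>1 + c * l\<rceil>"
proof
  let ?q = "ln (1 / g)"
  have q: "?q \<ge> 0" using assms by simp
  then show "0 \<le> ?q * (c + 2) + ln 2" using assms by simp
  fix l :: real assume l: "l \<ge> 0"
  have "real (nat \<lceil>1 + c * l\<rceil>) \<le> (c + 2) * (1 + l)"
    using mult_nonneg_nonneg[OF assms(3) l] l assms(3) of_int_ceiling_le_add_one[of "1 + c * l"]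
    by (simp add: algebra_simps)
  then have "?q * real (nat \<lceil>1 + c * l\<rceil>) \<le> ?q * ((c + 2) * (1 + l))"
    using q by (rule mult_left_mono)
  moreover have "ln 2 \<le> ln 2 * (1 + l)" using l by simp
  ultimately have "ln 2 + - ((?q * (c + 2) + ln 2) * (1 + l)) \<le> real (nat \<lceil>1 + c * l\<rceil>) * ln g"
    using assms by (simp add: ln_div algebra_simps)
  then have "exp (ln 2 + - ((?q * (c + 2) + ln 2) * (1 + l))) \<le> exp (real (nat \<lceil>1 + c * l\<rceil>) * ln g)"
    by (simp only: exp_le_cancel_iff)
  then show "2 * exp (- ((?q * (c + 2) + ln 2) * (1 + l))) \<le> g ^ nat \<lceil>1 + c * l\<rceil>"
    using assms unfolding exp_add exp_of_nat_mult by simp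
qed

lemma unit_root_bounds:
  assumes "\<bar>b\<bar> < 1"
  shows "\<exists>C\<ge>0. \<forall>\<^sub>F n in sequentially.
    rwp n * exp (- (C * (1 + sqrt (ln (real n))))) \<le> persist (1 + b) (- b) n \<and>
    persist (1 + b) (- b) n \<le> rwp n * exp (C * (1 + sqrt (ln (real n))))"
    (is "\<exists>C\<ge>0. \<forall>\<^sub>F n in _. ?B C n")
proof (cases "b \<ge> 0")
  case True
  define g where "g = gauss.prob {..-1}"
  have g: "0 < g" using gauss_atMost_pos[of "-1"] by (simp add: g_def emeasure_gauss_eq)
  have g1: "g < 1" unfolding g_def by (rule gauss_prob_less_1[of _ 0 1]) auto
  define c where "c = b * sqrt 8 / (1 - b)"
  have c: "c \<ge> 0" using True assms by (simp add: c_def)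
  obtain C where C: "C \<ge> 0" "\<And>l. l \<ge> 0 \<Longrightarrow> 2 * exp (- (C * (1 + l))) \<le> g ^ nat \<lceil>1 + c * l\<rceil>"
    using ceiling_power_ge_exp[OF g g1 c] by blast
  have "\<forall>\<^sub>F n in sequentially. ?B C n"
    using rwp_sqrt_bounds eventually_ge_at_top[of 1]
  proof eventually_elim
    case (elim n)
    define l where "l = sqrt (ln (real n))"
    have l: "l \<ge> 0" using elim by (simp add: l_def)
    have "persist (1 + b) (- b) n * (2 * exp (- (C * (1 + l)))) \<le> persist (1 + b) (- b) n * g ^ nat \<lceil>1 + c * l\<rceil>"
      by (intro mult_left_mono C l persist_nonneg)
    also have "\<dots> \<le> rwp n + real n * tail_bound (sqrt 8 * l)"
      unfolding g_def
    proof (rule unit_root_upper_pos)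
      have "b * (sqrt 8 * l) / (1 - b) \<le> 1 + c * l" by (simp add: c_def)
      also have "\<dots> \<le> real (nat \<lceil>1 + c * l\<rceil>)" by (rule real_nat_ceiling_ge)
      finally show "b * (sqrt 8 * l) / (1 - b) \<le> real (nat \<lceil>1 + c * l\<rceil>)" .
    qed (use True assms l in auto)
    also have "\<dots> \<le> 2 * rwp n" using elim by (simp add: l_def)
    finally have up: "persist (1 + b) (- b) n \<le> rwp n * exp (C * (1 + l))"
      unfolding exp_minus by (simp add: divide_inverse[symmetric] pos_divide_le_eq)
    have "rwp n * exp (- (C * (1 + l))) \<le> rwp n * 1"
      using elim C l by (intro mult_left_mono) auto
    also have "\<dots> \<le> persist (1 + b) (- b) n" using unit_root_lower_pos[OF True] by simp
    finally show ?case using up by (simp add: l_def)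
  qed
  then show ?thesis using C by blast
next
  case False
  define t where "t = - b"
  have t: "0 < t" "t < 1" using False assms by (auto simp: t_def)
  define g where "g = gauss.prob {-1..-t}"
  have g: "0 < g" using gauss_Icc_pos[of "-1" "-t"] t by (simp add: g_def emeasure_gauss_eq)
  have g1: "g < 1" unfolding g_def using t by (intro gauss_prob_less_1[of _ 0 1]) auto
  define c where "c = sqrt 8 / (1 - t)"
  have c: "c \<ge> 0" using t by (simp add: c_def)
  obtain C where C: "C \<ge> 0" "\<And>l. l \<ge> 0 \<Longrightarrow> 2 * exp (- (C * (1 + l))) \<le> g ^ nat \<lceil>1 + c * l\<rceil>"
    using ceiling_power_ge_exp[OF g g1 c] by blast
  have "\<forall>\<^sub>F n in sequentially. ?B C n"
    using rwp_sqrt_bounds eventually_ge_at_top[of 1]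
  proof eventually_elim
    case (elim n)
    define l where "l = sqrt (ln (real n))"
    have l: "l \<ge> 0" using elim by (simp add: l_def)
    have e: "rwp n / 2 \<le> rwp n - real n * tail_bound (sqrt 8 * l)"
      using elim(1) unfolding l_def by linarith
    have "rwp n * exp (- (C * (1 + l))) = rwp n / 2 * (2 * exp (- (C * (1 + l))))" by simp
    also have "\<dots> \<le> (rwp n - real n * tail_bound (sqrt 8 * l)) * g ^ nat \<lceil>1 + c * l\<rceil>"
      using elim(1) e by (intro mult_mono C l) auto
    also have "\<dots> \<le> persist (1 - t) t n"
      unfolding g_def
    proof (rule unit_root_lower_neg)
      have "1 + sqrt 8 * l / (1 - t) = 1 + c * l" by (simp add: c_def)
      then show "1 + sqrt 8 * l / (1 - t) \<le> real (nat \<lceil>1 + c * l\<rceil>)" by (metis real_nat_ceiling_ge)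
    qed (use t l in auto)
    finally have low: "rwp n * exp (- (C * (1 + l))) \<le> persist (1 + b) (- b) n" by (simp add: t_def)
    have "persist (1 + b) (- b) n \<le> rwp n * 1" using unit_root_upper_neg[of b] False by simp
    also have "\<dots> \<le> rwp n * exp (C * (1 + l))"
      using elim C l by (intro mult_left_mono) auto
    finally show ?case using low by (simp add: l_def)
  qed
  then show ?thesis using C by blast
qed

lemma persist_unit_root_exponent:
  assumes "\<bar>b\<bar> < 1"
  shows "\<exists>e. e \<longlonglongrightarrow> 0 \<and> (\<forall>\<^sub>F n in at_top. persist (1 + b) (- b) n = real n powr (- 1 / 2 + e n))"
proof -
  let ?p = "persist (1 + b) (- b)"
  define e where "e n = ln (?p n) / ln (real n) + 1 / 2" for n
  obtain C where C: "C \<ge> 0" "\<forall>\<^sub>F n in sequentially. rwp n * exp (- (C * (1 + sqrt (ln (real n))))) \<le> ?p n \<and>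
    ?p n \<le> rwp n * exp (C * (1 + sqrt (ln (real n))))"
    using unit_root_bounds[OF assms] by blast
  have pos: "\<forall>\<^sub>F n in sequentially. rwp n > 0" using rwp_sqrt_bounds by eventually_elim simp
  have "\<forall>\<^sub>F n in at_top. ?p n = real n powr (- 1 / 2 + e n)"
    using C(2) pos eventually_gt_at_top[of 1]
  proof eventually_elim
    case (elim n)
    have p: "?p n > 0" using elim by (smt (verit) exp_gt_zero mult_pos_pos)
    then have "real n powr (- 1 / 2 + e n) = exp (ln (?p n))"
      using elim by (simp add: e_def powr_def)
    then show ?case using p by simp
  qed
  moreover have "e \<longlonglongrightarrow> 0"
  proof -
    define w where "w n = ln (rwp n * sqrt (real n))" for n
    define d where "d n = C * (1 + sqrt (ln (real n)))" for n
    have "w \<longlonglongrightarrow> ln (1 / sqrt pi)"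
      unfolding w_def by (intro tendsto_ln rwp_asymptotic) simp
    moreover have ln_top: "filterlim (\<lambda>n. ln (real n)) at_top sequentially" by real_asymp
    ultimately have w0: "(\<lambda>n. w n / ln (real n)) \<longlonglongrightarrow> 0"
      by (rule tendsto_divide_0[OF _ filterlim_at_top_imp_at_infinity])
    have d0: "(\<lambda>n. d n / ln (real n)) \<longlonglongrightarrow> 0" unfolding d_def by real_asymp
    have "\<forall>\<^sub>F n in sequentially. w n / ln (real n) - d n / ln (real n) \<le> e n \<and> e n \<le> w n / ln (real n) + d n / ln (real n)"
      using C(2) pos eventually_gt_at_top[of 1]
    proof eventually_elim
      case (elim n)
      have ln: "ln (real n) > 0" using elim by simp
      have p: "?p n > 0" using elim by (smt (verit) exp_gt_zero mult_pos_pos)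
      have "ln (rwp n * exp (- d n)) \<le> ln (?p n)" "ln (?p n) \<le> ln (rwp n * exp (d n))"
        using elim p by (auto simp: d_def)
      then have "ln (rwp n) - d n \<le> ln (?p n)" "ln (?p n) \<le> ln (rwp n) + d n"
        using elim by (auto simp: ln_mult)
      moreover have "w n = ln (rwp n) + ln (real n) / 2"
        using elim by (simp add: w_def ln_mult ln_sqrt)
      moreover have "e n * ln (real n) = ln (?p n) + ln (real n) / 2"
        using ln by (simp add: e_def distrib_right)
      ultimately have "(w n - d n) \<le> e n * ln (real n)" "e n * ln (real n) \<le> w n + d n"
        by linarith+
      then show ?case using ln by (simp add: field_simps)
    qed
    then show ?thesis
      using tendsto_sandwich[of "\<lambda>n. w n / ln (real n) - d n / ln (real n)" e sequentially
          "\<lambda>n. w n / ln (real n) + d n / ln (real n)" 0]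
        tendsto_diff[OF w0 d0] tendsto_add[OF w0 d0] by (simp add: eventually_conj_iff)
  qed
  ultimately show ?thesis by blast
qed

section \<open>Interlaced random walks\<close>

lemma persist_0_1: "persist 0 1 n = rwp ((n + 1) div 2) * rwp (n div 2)"
proof -
  have "ennreal (persist 0 1 n) = ennreal (rwp ((n + 1) div 2) * rwp (n div 2))"
    unfolding surv_eq_persist[symmetric] surv_0_1 surv_eq_rwp by (simp add: ennreal_mult rwp_def)
  then show ?thesis by (simp add: persist_nonneg rwp_def)
qed

lemma persist_0_1_asymptotic: "persist 0 1 \<sim>[at_top] (\<lambda>N. (2 / pi) / real N)"
proof (rule asymp_equivI')
  define w where "w n = rwp n * sqrt (real n)" for n
  have w: "w \<longlonglongrightarrow> 1 / sqrt pi" unfolding w_def by (rule rwp_asymptotic)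
  have h1: "filterlim (\<lambda>n. (n + 1) div 2) at_top (at_top :: nat filter)"
    unfolding filterlim_at_top
  proof
    fix Z :: nat
    show "\<forall>\<^sub>F n in at_top. Z \<le> (n + 1) div 2"
      using eventually_ge_at_top[of "2 * Z"] by eventually_elim linarith
  qed
  have h2: "filterlim (\<lambda>n. n div 2) at_top (at_top :: nat filter)"
    unfolding filterlim_at_top
  proof
    fix Z :: nat
    show "\<forall>\<^sub>F n in at_top. Z \<le> n div 2"
      using eventually_ge_at_top[of "2 * Z"] by eventually_elim linarith
  qed
  define r where "r n = real n / 2 / sqrt (real ((n + 1) div 2) * real (n div 2))" for n
  have ev: "\<forall>\<^sub>F n in sequentially. 1 \<le> r n \<and> r n \<le> real n / 2 / ((real n - 1) / 2)"
    using eventually_ge_at_top[of 2]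
  proof eventually_elim
    case (elim n)
    define a b where "a = real ((n + 1) div 2)" and "b = real (n div 2)"
    have n: "real n = a + b"
      unfolding a_def b_def of_nat_add[symmetric] by (rule arg_cong[where f = real]) linarith
    have ab: "a \<le> b + 1" "b \<le> a" unfolding a_def b_def by linarith+
    have pos: "a > 0" "b > 0" using elim by (auto simp: a_def b_def)
    have "sqrt (a * b) \<le> (a + b) / 2" using arith_geo_mean_sqrt[of a b] pos by simp
    moreover have "(real n - 1) / 2 \<le> sqrt (b * b)" using n ab pos by simp
    moreover have "sqrt (b * b) \<le> sqrt (a * b)" using ab pos by (intro real_sqrt_le_mono mult_right_mono) auto
    ultimately show ?case
      unfolding r_def a_def[symmetric] b_def[symmetric] using n pos elim
      by (intro conjI divide_left_mono mult_pos_pos) (auto simp: pos_le_divide_eq)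
  qed
  have r: "r \<longlonglongrightarrow> 1"
  proof (rule tendsto_sandwich)
    show "\<forall>\<^sub>F n in sequentially. 1 \<le> r n" using ev by eventually_elim simp
    show "\<forall>\<^sub>F n in sequentially. r n \<le> real n / 2 / ((real n - 1) / 2)" using ev by eventually_elim simp
    show "(\<lambda>n. real n / 2 / ((real n - 1) / 2)) \<longlonglongrightarrow> 1" by real_asymp
  qed simp
  have "(\<lambda>n. (pi * (w ((n + 1) div 2) * w (n div 2))) * r n) \<longlonglongrightarrow> (pi * (1 / sqrt pi * (1 / sqrt pi))) * 1"
    by (intro tendsto_intros filterlim_compose[OF w h1] filterlim_compose[OF w h2] r)
  moreover have "(pi * (1 / sqrt pi * (1 / sqrt pi))) * 1 = 1"
    by (simp add: real_sqrt_mult[symmetric])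
  moreover have "\<forall>\<^sub>F n in sequentially. (pi * (w ((n + 1) div 2) * w (n div 2))) * r n = persist 0 1 n / (2 / pi / real n)"
    using eventually_ge_at_top[of 2]
  proof eventually_elim
    case (elim n)
    have "real ((n + 1) div 2) > 0" "real (n div 2) > 0" using elim by auto
    then show ?case using elim by (simp add: w_def r_def persist_0_1 real_sqrt_mult)
  qed
  ultimately show "(\<lambda>n. persist 0 1 n / (2 / pi / real n)) \<longlonglongrightarrow> 1"
    using Lim_transform_eventually by fastforce
qed

section \<open>The integrated random walk\<close>

definition iwalk :: "(nat \<Rightarrow> real) \<Rightarrow> nat \<Rightarrow> real" where
  "iwalk y n = (\<Sum>j<n. rwalk y (Suc j))"

lemma iwalk_0 [simp]: "iwalk y 0 = 0" and iwalk_Suc: "iwalk y (Suc n) = iwalk y n + rwalk y (Suc n)"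
  by (simp_all add: iwalk_def)

lemma measurable_iwalk [measurable (raw)]:
  assumes "f \<in> measurable N noise"
  shows "(\<lambda>x. iwalk (f x) n) \<in> borel_measurable N"
  unfolding iwalk_def using measurable_rwalk[OF assms] by (rule borel_measurable_sum)

lemma arp_iwalk: "arp 2 (- 1) x z y n = x + real n * (x - z) + iwalk y n"
proof (induction n)
  case (Suc n)
  have "arp 2 (- 1) x z y (Suc n) - arp 2 (- 1) x z y n = x - z + rwalk y (Suc n)"
    using arp_unit_root_walk[of 1 x z y n] by simp
  then show ?case using Suc by (simp add: iwalk_Suc algebra_simps)
qed simp

definition shift_seq :: "nat \<Rightarrow> (nat \<Rightarrow> real) \<Rightarrow> nat \<Rightarrow> real" where
  "shift_seq k y j = y (k + j)"

lemma measurable_shift_seq [measurable]: "shift_seq k \<in> measurable noise noise"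
  unfolding shift_seq_def[abs_def] by (rule measurable_PiM_single') auto

abbreviation le_or_less :: "(real \<Rightarrow> real \<Rightarrow> bool) \<Rightarrow> bool" where
  "le_or_less R \<equiv> R = (\<le>) \<or> R = (<)"

text \<open>\<open>peak R K m v y\<close>: if the walk with increments \<open>y\<close> has velocity \<open>v\<close> at time \<open>K\<close>, the integrated walk has a
  (weak or strict) maximum right after time \<open>K\<close>, compared with \<open>K + 1\<close> positions before and \<open>m + 1\<close> after it.\<close>

definition peak :: "(real \<Rightarrow> real \<Rightarrow> bool) \<Rightarrow> nat \<Rightarrow> nat \<Rightarrow> real \<Rightarrow> (nat \<Rightarrow> real) \<Rightarrow> bool" where
  "peak R K m v y \<longleftrightarrow>
     (\<forall>i\<le>K. R (iwalk (rev_seq K y) i) (real (Suc i) * v)) \<and>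
     (\<forall>i\<le>m. R (iwalk (shift_seq (Suc K) y) i) (real (Suc i) * - (v + y K)))"

definition below :: "(real \<Rightarrow> real \<Rightarrow> bool) \<Rightarrow> nat \<Rightarrow> real \<Rightarrow> ennreal" where
  "below R m v = emeasure noise {y. \<forall>i\<le>m. R (iwalk y i) (real (Suc i) * v)}"

lemma pred_le_or_less:
  assumes "le_or_less R" "f \<in> borel_measurable N" "g \<in> borel_measurable N"
  shows "Measurable.pred N (\<lambda>x. R (f x) (g x :: real))"
  using assms(1)
proof
  assume "R = (\<le>)"
  then show ?thesis using borel_measurable_le[OF assms(2,3)] by (simp add: pred_def)
next
  assume "R = (<)"
  then show ?thesis using borel_measurable_less[OF assms(2,3)] by (simp add: pred_def)
qed

lemma pred_below:
  assumes "le_or_less R" "f \<in> measurable N noise" "g \<in> borel_measurable N"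
  shows "Measurable.pred N (\<lambda>x. \<forall>i\<le>m. R (iwalk (f x) i) (real (Suc i) * g x))"
proof -
  have "Measurable.pred N (\<lambda>x. \<forall>i\<in>{..m}. R (iwalk (f x) i) (real (Suc i) * g x))"
    by (intro pred_intros_finite pred_le_or_less[OF assms(1)] measurable_iwalk[OF assms(2)]
        borel_measurable_times borel_measurable_const assms(3)) simp
  then show ?thesis by (simp only: Ball_def atMost_iff)
qed

lemma pred_peak:
  assumes R: "le_or_less R" and f: "f \<in> measurable N noise" and g: "g \<in> borel_measurable N"
  shows "Measurable.pred N (\<lambda>x. peak R K m (g x) (f x))"
proof -
  have fK: "(\<lambda>x. f x K) \<in> borel_measurable N"
    using measurable_compose[OF f, of "\<lambda>y. y K" borel] by simp
  show ?thesis
    unfolding peak_def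
    by (intro pred_intros_logic pred_below[OF R] measurable_compose[OF f measurable_rev_seq]
        measurable_compose[OF f measurable_shift_seq] g borel_measurable_uminus borel_measurable_add fK)
qed

lemma iwalk_cong: "(\<And>j. j < n \<Longrightarrow> y j = y' j) \<Longrightarrow> iwalk y n = iwalk y' n"
  unfolding iwalk_def rwalk_def by (intro sum.cong refl) auto

lemma peak_comb_seq:
  "peak R K m v (comb_seq K a (case_nat u b)) \<longleftrightarrow>
     (\<forall>i\<le>K. R (iwalk (rev_seq K a) i) (real (Suc i) * v)) \<and>
     (\<forall>i\<le>m. R (iwalk b i) (real (Suc i) * - (v + u)))"
proof -
  have "shift_seq (Suc K) (comb_seq K a (case_nat u b)) = b"
    by (auto simp: shift_seq_def comb_seq_def fun_eq_iff Suc_diff_le)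
  moreover have "iwalk (rev_seq K (comb_seq K a (case_nat u b))) i = iwalk (rev_seq K a) i" if "i \<le> K" for i
    using that by (intro iwalk_cong) (auto simp: rev_seq_def comb_seq_def)
  moreover have "comb_seq K a (case_nat u b) K = u" by (simp add: comb_seq_def)
  ultimately show ?thesis by (simp add: peak_def)
qed

lemma measurable_below:
  assumes "le_or_less R"
  shows "below R m \<in> borel_measurable borel"
proof -
  have "Measurable.pred (borel \<Otimes>\<^sub>M noise) (\<lambda>p. \<forall>i\<le>m. R (iwalk (snd p) i) (real (Suc i) * fst p))"
    by (rule pred_below[OF assms]) auto
  then have "{p. \<forall>i\<le>m. R (iwalk (snd p) i) (real (Suc i) * fst p)} \<in> sets (borel \<Otimes>\<^sub>M noise)"
    by (simp add: pred_def space_pair_measure)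
  then have "(\<lambda>v. emeasure noise (Pair v -` {p. \<forall>i\<le>m. R (iwalk (snd p) i) (real (Suc i) * fst p)})) \<in> borel_measurable borel"
    by (rule noise.P.measurable_emeasure_Pair)
  moreover have "Pair v -` {p. \<forall>i\<le>m. R (iwalk (snd p) i) (real (Suc i) * fst p)} =
    {y. \<forall>i\<le>m. R (iwalk y i) (real (Suc i) * v)}" for v :: real
    by auto
  ultimately show ?thesis unfolding below_def[abs_def] by (simp only:)
qed

definition peak_ind :: "(real \<Rightarrow> real \<Rightarrow> bool) \<Rightarrow> nat \<Rightarrow> nat \<Rightarrow> real \<Rightarrow> (nat \<Rightarrow> real) \<Rightarrow> ennreal" where
  "peak_ind R K m v y = (if peak R K m v y then 1 else 0)"

lemma measurable_peak_ind:
  assumes "le_or_less R" "g \<in> borel_measurable N" "f \<in> measurable N noise"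
  shows "(\<lambda>p. peak_ind R K m (g p) (f p)) \<in> borel_measurable N"
  unfolding peak_ind_def
  by (intro measurable_If measurable_const pred_peak[OF assms(1,3,2), unfolded pred_def]) simp_all

lemma peak_mass_fixed_velocity:
  assumes R: "le_or_less R"
  shows "(\<integral>\<^sup>+y. peak_ind R K m v y \<partial>noise) = (\<integral>\<^sup>+u. below R K v * below R m (- (v + u)) \<partial>gauss)"
proof -
  define B where "B = {y. \<forall>i\<le>K. R (iwalk (rev_seq K y) i) (real (Suc i) * v)}"
  define F where "F u = {y. \<forall>i\<le>m. R (iwalk y i) (real (Suc i) * - (v + u))}" for u
  have m1: "B \<in> sets noise"
    unfolding B_def by (intro noise_event pred_below[OF R] measurable_rev_seq measurable_const) simp
  have m2: "F u \<in> sets noise" for u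
    unfolding F_def by (intro noise_event pred_below[OF R] measurable_ident_sets[OF refl] measurable_const) simp
  have mb: "(\<lambda>u. below R m (- (v + u))) \<in> borel_measurable gauss"
    using measurable_compose[OF _ measurable_below[OF R, of m], of "\<lambda>u. - (v + u)" gauss] by simp
  have mp: "(\<lambda>y. peak_ind R K m v (f y)) \<in> borel_measurable noise" if "f \<in> measurable noise noise" for f
    by (intro measurable_peak_ind R that measurable_const) simp
  have "(\<integral>\<^sup>+y. peak_ind R K m v y \<partial>noise) = (\<integral>\<^sup>+a. \<integral>\<^sup>+b. peak_ind R K m v (comb_seq K a b) \<partial>noise \<partial>noise)"
    by (intro nn_integral_noise_comb mp measurable_ident_sets refl)
  also have "\<dots> = (\<integral>\<^sup>+a. \<integral>\<^sup>+u. \<integral>\<^sup>+b. peak_ind R K m v (comb_seq K a (case_nat u b)) \<partial>noise \<partial>gauss \<partial>noise)"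
    by (intro nn_integral_cong nn_integral_noise_iter mp measurable_comb_seq' measurable_const measurable_ident_sets refl) simp
  also have "\<dots> = (\<integral>\<^sup>+a. \<integral>\<^sup>+u. \<integral>\<^sup>+b. indicator B a * indicator (F u) b \<partial>noise \<partial>gauss \<partial>noise)"
    unfolding peak_ind_def peak_comb_seq B_def F_def by (intro nn_integral_cong) (auto simp: indicator_def)
  also have "\<dots> = (\<integral>\<^sup>+a. \<integral>\<^sup>+u. indicator B a * below R m (- (v + u)) \<partial>gauss \<partial>noise)"
  proof (intro nn_integral_cong)
    fix a u
    have "emeasure noise (F u) = below R m (- (v + u))" by (simp only: F_def below_def)
    then show "(\<integral>\<^sup>+b. indicator B a * indicator (F u) b \<partial>noise) = indicator B a * below R m (- (v + u))"
      using m2[of u] by (simp add: nn_integral_cmult)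
  qed
  also have "\<dots> = (\<integral>\<^sup>+a. indicator B a * (\<integral>\<^sup>+u. below R m (- (v + u)) \<partial>gauss) \<partial>noise)"
    by (intro nn_integral_cong nn_integral_cmult mb)
  also have "\<dots> = emeasure noise B * (\<integral>\<^sup>+u. below R m (- (v + u)) \<partial>gauss)"
    using m1 by (simp add: nn_integral_multc)
  also have "emeasure noise B = below R K v"
    unfolding below_def B_def
    by (intro emeasure_noise_rev noise_event pred_below[OF R] measurable_ident_sets[OF refl] measurable_const) simp
  also have "below R K v * (\<integral>\<^sup>+u. below R m (- (v + u)) \<partial>gauss) = (\<integral>\<^sup>+u. below R K v * below R m (- (v + u)) \<partial>gauss)"
    by (intro nn_integral_cmult[symmetric] mb)
  finally show ?thesis .
qed

definition peak_mass :: "(real \<Rightarrow> real \<Rightarrow> bool) \<Rightarrow> nat \<Rightarrow> nat \<Rightarrow> ennreal" where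
  "peak_mass R K m = (\<integral>\<^sup>+v. \<integral>\<^sup>+u. below R K v * below R m (- (v + u)) \<partial>gauss \<partial>lborel)"

lemma peak_mass_eq:
  assumes R: "le_or_less R"
  shows "(\<integral>\<^sup>+y. \<integral>\<^sup>+s. peak_ind R K m (s + rwalk y K) y \<partial>lborel \<partial>noise) = peak_mass R K m"
proof -
  interpret LN: pair_sigma_finite lborel noise ..
  have "(\<integral>\<^sup>+y. \<integral>\<^sup>+s. peak_ind R K m (s + rwalk y K) y \<partial>lborel \<partial>noise) = (\<integral>\<^sup>+y. \<integral>\<^sup>+v. peak_ind R K m v y \<partial>lborel \<partial>noise)"
  proof (rule nn_integral_cong)
    fix y :: "nat \<Rightarrow> real"
    have "(\<lambda>v. peak_ind R K m v y) \<in> borel_measurable borel"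
      by (intro measurable_peak_ind[OF R] measurable_const measurable_ident) simp_all
    then show "(\<integral>\<^sup>+s. peak_ind R K m (s + rwalk y K) y \<partial>lborel) = (\<integral>\<^sup>+v. peak_ind R K m v y \<partial>lborel)"
      using nn_integral_real_affine[of "\<lambda>v. peak_ind R K m v y" 1 "rwalk y K"]
      by (simp add: add.commute)
  qed
  also have "\<dots> = (\<integral>\<^sup>+v. \<integral>\<^sup>+y. peak_ind R K m v y \<partial>noise \<partial>lborel)"
  proof (rule LN.Fubini')
    have "(\<lambda>p. peak_ind R K m (fst p) (snd p)) \<in> borel_measurable (lborel \<Otimes>\<^sub>M noise)"
      by (intro measurable_peak_ind[OF R]) auto
    then show "case_prod (peak_ind R K m) \<in> borel_measurable (lborel \<Otimes>\<^sub>M noise)"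
      by (simp add: case_prod_beta')
  qed
  finally show ?thesis by (simp add: peak_mass_fixed_velocity[OF R] peak_mass_def)
qed

definition pos :: "real \<Rightarrow> (nat \<Rightarrow> real) \<Rightarrow> nat \<Rightarrow> real" where
  "pos s y k = (\<Sum>i<k. s + rwalk y i)"

lemma pos_Suc: "pos s y (Suc k) = pos s y k + (s + rwalk y k)"
  by (simp add: pos_def)

lemma pos_eq_iwalk: "pos s y (Suc n) = real (Suc n) * s + iwalk y n"
  by (induction n) (simp_all add: pos_def iwalk_Suc algebra_simps)

lemma pos_backward:
  "i \<le> K \<Longrightarrow> pos s y (Suc K) - pos s y (K - i) = real (Suc i) * (s + rwalk y K) - iwalk (rev_seq K y) i"
proof (induction i)
  case 0
  show ?case by (simp add: pos_Suc)
next
  case (Suc i)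
  have "K - i = Suc (K - Suc i)" using Suc.prems by simp
  then have "pos s y (K - i) = pos s y (K - Suc i) + (s + rwalk y (K - Suc i))"
    by (simp add: pos_Suc)
  then show ?case using Suc rwalk_rev_seq[OF Suc.prems, of y] by (simp add: iwalk_Suc algebra_simps)
qed

lemma rwalk_shift_seq: "rwalk y (K + i) = rwalk y K + rwalk (shift_seq K y) i"
  by (induction i) (simp_all add: rwalk_Suc shift_seq_def)

lemma pos_forward:
  "pos s y (Suc (Suc (K + i))) - pos s y (Suc K) =
    real (Suc i) * (s + rwalk y K + y K) + iwalk (shift_seq (Suc K) y) i"
proof (induction i)
  case (Suc i)
  have "rwalk y (Suc (Suc (K + i))) = rwalk y (Suc K + Suc i)" by simp
  then have "rwalk y (Suc (Suc (K + i))) = rwalk y K + y K + rwalk (shift_seq (Suc K) y) (Suc i)"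
    unfolding rwalk_shift_seq by (simp add: rwalk_Suc)
  then show ?case using Suc by (simp add: pos_Suc iwalk_Suc algebra_simps)
qed (simp add: pos_Suc rwalk_Suc)

lemma peak_eq_pos:
  assumes "le_or_less R"
  shows "peak R K m (s + rwalk y K) y \<longleftrightarrow>
    (\<forall>i\<le>K. R (pos s y (K - i)) (pos s y (Suc K))) \<and>
    (\<forall>i\<le>m. R (pos s y (Suc (Suc (K + i)))) (pos s y (Suc K)))"
proof -
  have 1: "R a b \<longleftrightarrow> R c d" if "b - a = d - c" for a b c d :: real
    using assms that by auto
  have "R (iwalk (rev_seq K y) i) (real (Suc i) * (s + rwalk y K)) \<longleftrightarrow> R (pos s y (K - i)) (pos s y (Suc K))" if "i \<le> K" for i
    by (rule 1) (simp add: pos_backward[OF that])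
  moreover have "R (iwalk (shift_seq (Suc K) y) i) (real (Suc i) * - (s + rwalk y K + y K)) \<longleftrightarrow>
    R (pos s y (Suc (Suc (K + i)))) (pos s y (Suc K))" for i
    by (rule 1) (use pos_forward[of s y K i] in \<open>simp add: algebra_simps\<close>)
  ultimately show ?thesis by (simp add: peak_def)
qed

lemma strict_peak_unique:
  assumes "peak (<) K (n - Suc K) (s + rwalk y K) y" "peak (<) K' (n - Suc K') (s + rwalk y K') y"
    and "K < n" "K' < n"
  shows "K = K'"
proof -
  have False if p: "peak (<) k (n - Suc k) (s + rwalk y k) y" "peak (<) l (n - Suc l) (s + rwalk y l) y"
    and kl: "k < l" "l < n" for k l
  proof -
    have "l - Suc k \<le> n - Suc k" "Suc (Suc (k + (l - Suc k))) = Suc l" using kl by auto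
    then have "pos s y (Suc l) < pos s y (Suc k)" using p(1) peak_eq_pos[of "(<)"] by metis
    moreover have "l - Suc k \<le> l" "l - (l - Suc k) = Suc k" using kl by auto
    then have "pos s y (Suc k) < pos s y (Suc l)" using p(2) peak_eq_pos[of "(<)"] by metis
    ultimately show False by simp
  qed
  with assms show ?thesis by (metis linorder_neqE_nat)
qed

definition maxwalk :: "nat \<Rightarrow> (nat \<Rightarrow> real) \<Rightarrow> real" where
  "maxwalk n y = Max (rwalk y ` {..n})"

lemma maxwalk_ge: "i \<le> n \<Longrightarrow> rwalk y i \<le> maxwalk n y"
  by (simp add: maxwalk_def)

lemma maxwalk_nonneg: "0 \<le> maxwalk n y"
  using maxwalk_ge[of 0 n y] by simp

lemma strict_peak_velocity:
  assumes "peak (<) K m (s + rwalk y K) y" "K < n"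
  shows "- maxwalk n y < s" "s < maxwalk n (neg_seq y)"
proof -
  have "0 < s + rwalk y K" "0 < - (s + rwalk y K + y K)"
    using assms(1) unfolding peak_def by (auto dest!: spec[of _ 0])
  moreover have "rwalk y K \<le> maxwalk n y" "rwalk (neg_seq y) (Suc K) \<le> maxwalk n (neg_seq y)"
    using assms(2) by (auto intro!: maxwalk_ge)
  moreover have "rwalk (neg_seq y) (Suc K) = - (rwalk y K + y K)"
    by (simp add: rwalk_def neg_seq_def sum_negf)
  ultimately show "- maxwalk n y < s" "s < maxwalk n (neg_seq y)" by linarith+
qed

lemma weak_peak_exists:
  assumes "0 < s" "pos s y (Suc n) \<le> 0" "n \<ge> 1"
  shows "\<exists>K<n. peak (\<le>) K (n - Suc K) (s + rwalk y K) y"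
proof -
  define M where "M = Max (pos s y ` {..Suc n})"
  have M: "pos s y i \<le> M" if "i \<le> Suc n" for i using that by (auto simp: M_def)
  have "M \<in> pos s y ` {..Suc n}" unfolding M_def by (rule Max_in) auto
  then obtain k where k: "k \<le> Suc n" "pos s y k = M" by auto
  have "0 < pos s y 1" using assms by (simp add: pos_def)
  also have "\<dots> \<le> M" by (rule M) simp
  finally have "M > 0" .
  have "pos s y 0 = 0" by (simp add: pos_def)
  then have "k \<noteq> 0" using k(2) \<open>M > 0\<close> by (metis less_irrefl)
  moreover have "k \<noteq> Suc n" using k(2) assms(2) \<open>M > 0\<close> by auto
  ultimately obtain K where K: "k = Suc K" "K < n" using k by (cases k) auto
  have "peak (\<le>) K (n - Suc K) (s + rwalk y K) y"
    unfolding peak_eq_pos[of "(\<le>)", simplified] using K M[unfolded k(2)[symmetric] K(1)] by auto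
  then show ?thesis using K by blast
qed

lemma rwalk_case_nat: "rwalk (case_nat u y) (Suc n) = u + rwalk y n"
  by (induction n) (simp_all add: rwalk_Suc)

lemma maxwalk_case_nat: "maxwalk (Suc n) (case_nat u y) = max 0 (u + maxwalk n y)"
proof -
  have "{..Suc n} = insert 0 (Suc ` {..n})" by (simp add: atMost_Suc_eq_insert_0)
  then have "rwalk (case_nat u y) ` {..Suc n} = insert 0 ((\<lambda>x. u + x) ` (rwalk y ` {..n}))"
    by (simp add: image_image rwalk_case_nat)
  moreover have "Max ((\<lambda>x. u + x) ` (rwalk y ` {..n})) = u + Max (rwalk y ` {..n})"
    by (rule mono_Max_commute[symmetric]) (auto simp: mono_def)
  ultimately show ?thesis by (simp add: maxwalk_def)
qed

lemma measurable_maxwalk [measurable]: "maxwalk n \<in> borel_measurable noise"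
  unfolding maxwalk_def[abs_def] by (rule borel_measurable_Max) auto

lemma maxwalk_second_moment: "(\<integral>\<^sup>+y. ennreal ((maxwalk n y)\<^sup>2) \<partial>noise) \<le> ennreal (real n)"
proof (induction n)
  case 0
  then show ?case by (simp add: maxwalk_def)
next
  case (Suc n)
  have "(\<integral>\<^sup>+y. ennreal ((maxwalk (Suc n) y)\<^sup>2) \<partial>noise) = (\<integral>\<^sup>+y. \<integral>\<^sup>+u. ennreal ((maxwalk (Suc n) (case_nat u y))\<^sup>2) \<partial>gauss \<partial>noise)"
    by (rule nn_integral_noise_iter') simp
  also have "\<dots> \<le> (\<integral>\<^sup>+y. \<integral>\<^sup>+u. ennreal ((u + maxwalk n y)\<^sup>2) \<partial>gauss \<partial>noise)"
    by (intro nn_integral_mono) (auto simp: maxwalk_case_nat max_def intro!: ennreal_leI)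
  also have "\<dots> = (\<integral>\<^sup>+y. 1 + ennreal ((maxwalk n y)\<^sup>2) \<partial>noise)"
    by (simp add: gauss_second_moment ennreal_plus)
  also have "\<dots> = 1 + (\<integral>\<^sup>+y. ennreal ((maxwalk n y)\<^sup>2) \<partial>noise)"
    using noise.emeasure_space_1 by (subst nn_integral_add) simp_all
  also have "\<dots> \<le> 1 + ennreal (real n)" using Suc by (intro add_mono) auto
  also have "\<dots> = ennreal (real (Suc n))" by (simp add: ennreal_plus)
  finally show ?case .
qed

lemma maxwalk_first_moment:
  assumes "n \<ge> 1"
  shows "(\<integral>\<^sup>+y. ennreal (maxwalk n y) \<partial>noise) \<le> ennreal (sqrt (real n))"
proof -
  define r where "r = sqrt (real n)"
  have r: "r > 0" "r * r = real n" using assms by (auto simp: r_def)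
  have "(\<integral>\<^sup>+y. ennreal (maxwalk n y) \<partial>noise) \<le> (\<integral>\<^sup>+y. ennreal (r / 2) + ennreal (1 / (2 * r)) * ennreal ((maxwalk n y)\<^sup>2) \<partial>noise)"
  proof (intro nn_integral_mono)
    fix y
    have "0 \<le> (maxwalk n y - r)\<^sup>2" by simp
    then have "maxwalk n y * (2 * r) \<le> (maxwalk n y)\<^sup>2 + r * r" by (simp add: power2_eq_square algebra_simps)
    then have "maxwalk n y \<le> ((maxwalk n y)\<^sup>2 + r * r) / (2 * r)" using r(1) by (simp add: pos_le_divide_eq)
    also have "\<dots> = r / 2 + 1 / (2 * r) * (maxwalk n y)\<^sup>2" using r(1) by (simp add: field_simps)
    finally show "ennreal (maxwalk n y) \<le> ennreal (r / 2) + ennreal (1 / (2 * r)) * ennreal ((maxwalk n y)\<^sup>2)"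
      using r(1) by (simp add: ennreal_mult'[symmetric] ennreal_plus[symmetric] ennreal_leI del: ennreal_plus)
  qed
  also have "\<dots> = ennreal (r / 2) + ennreal (1 / (2 * r)) * (\<integral>\<^sup>+y. ennreal ((maxwalk n y)\<^sup>2) \<partial>noise)"
    using noise.emeasure_space_1 by (simp add: nn_integral_add nn_integral_cmult)
  also have "\<dots> \<le> ennreal (r / 2) + ennreal (1 / (2 * r)) * ennreal (real n)"
    by (intro add_mono mult_left_mono maxwalk_second_moment) auto
  also have "\<dots> = ennreal (r / 2 + 1 / (2 * r) * real n)"
    using r(1) by (simp add: ennreal_mult'[symmetric] ennreal_plus[symmetric] del: ennreal_plus)
  also have "r / 2 + 1 / (2 * r) * real n = r" using r by (simp add: r(2)[symmetric])
  finally show ?thesis by (simp add: r_def)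
qed

abbreviation iwp :: "nat \<Rightarrow> real" where
  "iwp \<equiv> persist 2 (- 1)"

lemma below_weak_eq_surv: "v \<ge> 0 \<Longrightarrow> below (\<le>) m v = surv 2 (- 1) m (- v) 0"
  unfolding below_def surv_eq_emeasure arp_iwalk
proof (intro arg_cong[where f = "emeasure noise"] Collect_cong iffI allI impI ballI)
  fix y i assume v: "v \<ge> 0" and *: "\<forall>i\<in>{1..m}. - v + real i * (- v - 0) + iwalk y i \<le> 0" and i: "i \<le> m"
  then show "iwalk y i \<le> real (Suc i) * v"
    by (cases "i = 0") (auto simp: algebra_simps dest!: bspec[of _ _ i])
qed (auto simp: algebra_simps)

lemma below_weak_neg: "v < 0 \<Longrightarrow> below (\<le>) m v = 0"
proof -
  assume "v < 0"
  then have "{y. \<forall>i\<le>m. iwalk y i \<le> real (Suc i) * v} = {}" by (auto intro!: exI[of _ 0])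
  then show ?thesis unfolding below_def by (simp only: emeasure_empty)
qed

lemma below_strict_ge: "v > 0 \<Longrightarrow> ennreal (iwp m) \<le> below (<) m v"
proof -
  assume v: "v > 0"
  have "ennreal (iwp m) = below (\<le>) m 0"
    using below_weak_eq_surv[of 0 m] by (simp add: surv_eq_persist)
  also have "\<dots> \<le> below (<) m v"
    unfolding below_def
  proof (rule emeasure_mono)
    show "{y. \<forall>i\<le>m. iwalk y i \<le> real (Suc i) * 0} \<subseteq> {y. \<forall>i\<le>m. iwalk y i < real (Suc i) * v}"
    proof (intro subsetI CollectI allI impI)
      fix y i assume y: "y \<in> {y. \<forall>i\<le>m. iwalk y i \<le> real (Suc i) * 0}" "i \<le> m"
      then have "iwalk y i \<le> 0" by simp
      also have "0 < real (Suc i) * v" using v by simp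
      finally show "iwalk y i < real (Suc i) * v" .
    qed
    show "{y. \<forall>i\<le>m. iwalk y i < real (Suc i) * v} \<in> sets noise"
      by (intro noise_event pred_below measurable_ident_sets[OF refl] measurable_const) auto
  qed
  finally show ?thesis .
qed

lemma surv_iwalk_mono:
  assumes "x \<le> x'" "x - z \<le> x' - z'"
  shows "surv 2 (- 1) n x' z' \<le> surv 2 (- 1) n x z"
  unfolding surv_eq_emeasure arp_iwalk
proof (rule emeasure_mono)
  show "{y. \<forall>i\<in>{1..n}. x' + real i * (x' - z') + iwalk y i \<le> 0} \<subseteq> {y. \<forall>i\<in>{1..n}. x + real i * (x - z) + iwalk y i \<le> 0}"
  proof (intro subsetI CollectI ballI)
    fix y i assume "y \<in> {y. \<forall>i\<in>{1..n}. x' + real i * (x' - z') + iwalk y i \<le> 0}" "i \<in> {1..n}"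
    then have "x' + real i * (x' - z') + iwalk y i \<le> 0" by blast
    moreover have "real i * (x - z) \<le> real i * (x' - z')" using assms by (intro mult_left_mono) auto
    ultimately show "x + real i * (x - z) + iwalk y i \<le> 0" using assms by linarith
  qed
  show "{y. \<forall>i\<in>{1..n}. x + real i * (x - z) + iwalk y i \<le> 0} \<in> sets noise"
    by (rule noise_event) (auto simp: arp_iwalk[symmetric])
qed

text \<open>Two steps of size at least \<open>v / 2\<close> each, rather than one of size \<open>v\<close>, are what makes the
  resulting Gaussian weights integrable in \<open>weak_peak_mass_bound\<close>.\<close>

lemma below_weak_le:
  assumes "v \<ge> 0"
  shows "below (\<le>) m v * emeasure gauss {..- v / 2} * emeasure gauss {..- v / 2} \<le> ennreal (iwp (m + 2))"
proof -
  have "surv 2 (- 1) m (- v) 0 * emeasure gauss {..- v / 2} * emeasure gauss {..- v / 2} \<le> surv 2 (- 1) (Suc (Suc m)) 0 0"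
  proof (rule surv_ge_step)
    fix u1 assume u1: "u1 \<in> {..- v / 2}"
    have "surv 2 (- 1) m (- v) 0 * emeasure gauss {..- v / 2} \<le> surv 2 (- 1) (Suc m) u1 0"
    proof (rule surv_ge_step)
      fix u2 assume u2: "u2 \<in> {..- v / 2}"
      show "2 * u1 + - 1 * 0 + u2 \<le> 0 \<and> surv 2 (- 1) m (- v) 0 \<le> surv 2 (- 1) m (2 * u1 + - 1 * 0 + u2) u1"
        using u1 u2 assms by (auto intro!: surv_iwalk_mono)
    qed simp
    then show "2 * 0 + - 1 * 0 + u1 \<le> 0 \<and>
      surv 2 (- 1) m (- v) 0 * emeasure gauss {..- v / 2} \<le> surv 2 (- 1) (Suc m) (2 * 0 + - 1 * 0 + u1) 0"
      using u1 assms by auto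
  qed simp
  then show ?thesis
    using assms by (simp add: below_weak_eq_surv surv_eq_persist[symmetric] numeral_2_eq_2)
qed

lemma gauss_atMost_ge: "a \<ge> 0 \<Longrightarrow> ennreal (exp (- (a + 1)\<^sup>2 / 2) / sqrt (2 * pi)) \<le> emeasure gauss {..- a}"
proof -
  assume a: "a \<ge> 0"
  let ?d = "exp (- (a + 1)\<^sup>2 / 2) / sqrt (2 * pi)"
  have "ennreal ?d = (\<integral>\<^sup>+u. ennreal ?d * indicator {- a - 1..- a} u \<partial>lborel)"
    by (simp add: nn_integral_cmult_indicator)
  also have "\<dots> \<le> (\<integral>\<^sup>+u. ennreal (std_normal_density u) * indicator {..- a} u \<partial>lborel)"
  proof (intro nn_integral_mono)
    fix u :: real
    show "ennreal ?d * indicator {- a - 1..- a} u \<le> ennreal (std_normal_density u) * indicator {..- a} u"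
    proof (cases "u \<in> {- a - 1..- a}")
      case True
      then have "\<bar>u\<bar> \<le> \<bar>a + 1\<bar>" using a by auto
      then have "u\<^sup>2 \<le> (a + 1)\<^sup>2" by (simp only: abs_le_square_iff)
      then have "?d \<le> std_normal_density u" by (simp add: normal_density_def divide_right_mono)
      then show ?thesis using True by (simp add: ennreal_leI)
    qed simp
  qed
  also have "\<dots> = emeasure gauss {..- a}" by (simp add: emeasure_gauss)
  finally show ?thesis .
qed

definition peak_weight :: "real \<Rightarrow> ennreal" where
  "peak_weight v = (if 0 \<le> v then ennreal (2 * pi * exp ((v / 2 + 1)\<^sup>2)) else 0)"

lemma measurable_peak_weight [measurable]: "peak_weight \<in> borel_measurable borel"
  unfolding peak_weight_def[abs_def] by measurable

lemma below_weak_le_weight: "below (\<le>) m v \<le> ennreal (iwp (m + 2)) * peak_weight v"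
proof (cases "v \<ge> 0")
  case True
  define d where "d = exp (- (v / 2 + 1)\<^sup>2 / 2) / sqrt (2 * pi)"
  have d: "d > 0" by (simp add: d_def)
  have "below (\<le>) m v * ennreal d * ennreal d \<le> below (\<le>) m v * emeasure gauss {..- v / 2} * emeasure gauss {..- v / 2}"
    using gauss_atMost_ge[of "v / 2"] True unfolding d_def by (intro mult_mono) auto
  also note below_weak_le[OF True]
  finally have *: "below (\<le>) m v * ennreal (d * d) \<le> ennreal (iwp (m + 2))"
    using d by (simp add: ennreal_mult mult.assoc)
  have dd: "d * d * (2 * pi * exp ((v / 2 + 1)\<^sup>2)) = 1"
  proof -
    have "d * d = exp (- (v / 2 + 1)\<^sup>2 / 2 + - (v / 2 + 1)\<^sup>2 / 2) / (sqrt (2 * pi) * sqrt (2 * pi))"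
      unfolding d_def exp_add by simp
    also have "- (v / 2 + 1)\<^sup>2 / 2 + - (v / 2 + 1)\<^sup>2 / 2 = - (v / 2 + 1)\<^sup>2" by simp
    also have "sqrt (2 * pi) * sqrt (2 * pi) = 2 * pi" by simp
    finally show ?thesis by (simp add: exp_minus)
  qed
  have "below (\<le>) m v = below (\<le>) m v * ennreal (d * d) * ennreal (2 * pi * exp ((v / 2 + 1)\<^sup>2))"
    using d dd by (simp add: mult.assoc ennreal_mult'[symmetric])
  also have "\<dots> \<le> ennreal (iwp (m + 2)) * ennreal (2 * pi * exp ((v / 2 + 1)\<^sup>2))"
    using * by (rule mult_right_mono) simp
  finally show ?thesis using True by (simp add: peak_weight_def)
qed (simp add: below_weak_neg)

lemma weak_peak_mass_bound:
  "\<exists>J\<ge>0. \<forall>K m. peak_mass (\<le>) K m \<le> ennreal (J * (iwp (K + 2) * iwp (m + 2)))"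
proof -
  define c where "c = exp 2 * sqrt (4 * pi)"
  define J where "J = 4 * pi\<^sup>2 * c\<^sup>2"
  let ?N = "normal_density 2 (sqrt 2)"
  have N1: "(\<integral>\<^sup>+v. ennreal (?N v) \<partial>lborel) = 1"
  proof -
    interpret N: prob_space "density lborel (normal_density 2 (sqrt 2))"
      by (rule prob_space_normal_density) simp
    show ?thesis using N.emeasure_space_1 by (simp add: emeasure_density)
  qed
  have N: "exp ((v / 2 + 1)\<^sup>2) * exp (- v\<^sup>2 / 2) = c * ?N v" for v
  proof -
    have "exp ((v / 2 + 1)\<^sup>2) * exp (- v\<^sup>2 / 2) = exp (2 + - (v - 2)\<^sup>2 / 4)"
      unfolding exp_add[symmetric] by (rule arg_cong[where f = exp]) (simp add: power2_eq_square field_simps)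
    also have "\<dots> = exp 2 * exp (- (v - 2)\<^sup>2 / 4)" by (rule exp_add)
    also have "\<dots> = c * ?N v" by (simp add: c_def normal_density_def real_sqrt_mult field_simps)
    finally show ?thesis .
  qed
  have pw: "ennreal (std_normal_density (- v + - 1 * w)) * (peak_weight v * peak_weight w) \<le> ennreal J * (ennreal (?N v) * ennreal (?N w))" for v w
  proof (cases "v \<ge> 0 \<and> w \<ge> 0")
    case True
    have "std_normal_density (- v + - 1 * w) = exp (- (v + w)\<^sup>2 / 2) / sqrt (2 * pi)"
      by (simp add: normal_density_def power2_eq_square algebra_simps)
    also have "\<dots> \<le> exp (- (v + w)\<^sup>2 / 2) / 1"
      using pi_gt3 by (intro divide_left_mono real_le_rsqrt) auto
    also have "\<dots> \<le> exp (- v\<^sup>2 / 2 + - w\<^sup>2 / 2)"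
      using mult_nonneg_nonneg[of v w] True by (simp add: power2_eq_square field_simps)
    also have "\<dots> = exp (- v\<^sup>2 / 2) * exp (- w\<^sup>2 / 2)" by (rule exp_add)
    finally have "std_normal_density (- v + - 1 * w) * (2 * pi * exp ((v / 2 + 1)\<^sup>2) * (2 * pi * exp ((w / 2 + 1)\<^sup>2))) \<le>
      exp (- v\<^sup>2 / 2) * exp (- w\<^sup>2 / 2) * (2 * pi * exp ((v / 2 + 1)\<^sup>2) * (2 * pi * exp ((w / 2 + 1)\<^sup>2)))"
      by (rule mult_right_mono) simp
    also have "\<dots> = 4 * pi\<^sup>2 * ((exp ((v / 2 + 1)\<^sup>2) * exp (- v\<^sup>2 / 2)) * (exp ((w / 2 + 1)\<^sup>2) * exp (- w\<^sup>2 / 2)))"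
      by (simp add: power2_eq_square mult_ac)
    also have "\<dots> = J * (?N v * ?N w)" unfolding N by (simp add: J_def power2_eq_square mult_ac)
    finally have le: "std_normal_density (- v + - 1 * w) * (2 * pi * exp ((v / 2 + 1)\<^sup>2) * (2 * pi * exp ((w / 2 + 1)\<^sup>2))) \<le> J * (?N v * ?N w)" .
    define A B where "A = 2 * pi * exp ((v / 2 + 1)\<^sup>2)" and "B = 2 * pi * exp ((w / 2 + 1)\<^sup>2)"
    have AB: "A \<ge> 0" "B \<ge> 0" "J \<ge> 0" by (simp_all add: A_def B_def J_def)
    have "peak_weight v = ennreal A" "peak_weight w = ennreal B"
      using True by (simp_all only: peak_weight_def A_def B_def if_True)
    then have "ennreal (std_normal_density (- v + - 1 * w)) * (peak_weight v * peak_weight w) =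
      ennreal (std_normal_density (- v + - 1 * w) * (A * B))"
      using AB by (simp only: ennreal_mult mult_nonneg_nonneg normal_density_nonneg)
    also have "\<dots> \<le> ennreal (J * (?N v * ?N w))"
      using le unfolding A_def B_def by (rule ennreal_leI)
    also have "\<dots> = ennreal J * (ennreal (?N v) * ennreal (?N w))"
      using AB by (simp only: ennreal_mult mult_nonneg_nonneg normal_density_nonneg)
    finally show ?thesis .
  next
    case False
    then show ?thesis by (auto simp: peak_weight_def)
  qed
  have "peak_mass (\<le>) K m \<le> ennreal (J * (iwp (K + 2) * iwp (m + 2)))" for K m
  proof -
    let ?a = "ennreal (iwp (K + 2))" and ?b = "ennreal (iwp (m + 2))"
    have inner: "(\<integral>\<^sup>+u. below (\<le>) K v * below (\<le>) m (- (v + u)) \<partial>gauss) \<le> ?a * ?b * (ennreal J * ennreal (?N v))" for v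
    proof -
      have "(\<integral>\<^sup>+u. below (\<le>) K v * below (\<le>) m (- (v + u)) \<partial>gauss) \<le>
        (\<integral>\<^sup>+u. ?a * ?b * (peak_weight v * peak_weight (- (v + u))) \<partial>gauss)"
      proof (rule nn_integral_mono)
        fix u
        have "below (\<le>) K v * below (\<le>) m (- (v + u)) \<le> (?a * peak_weight v) * (?b * peak_weight (- (v + u)))"
          by (intro mult_mono below_weak_le_weight) auto
        then show "below (\<le>) K v * below (\<le>) m (- (v + u)) \<le> ?a * ?b * (peak_weight v * peak_weight (- (v + u)))"
          by (simp add: mult_ac)
      qed
      also have "\<dots> = ?a * ?b * (\<integral>\<^sup>+u. peak_weight v * peak_weight (- (v + u)) \<partial>gauss)"
        by (rule nn_integral_cmult) simp
      also have "(\<integral>\<^sup>+u. peak_weight v * peak_weight (- (v + u)) \<partial>gauss) =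
        (\<integral>\<^sup>+u. ennreal (std_normal_density u) * (peak_weight v * peak_weight (- (v + u))) \<partial>lborel)"
        by (rule nn_integral_gauss) simp
      also have "\<dots> = (\<integral>\<^sup>+w. ennreal (std_normal_density (- v + - 1 * w)) * (peak_weight v * peak_weight w) \<partial>lborel)"
        by (subst nn_integral_real_affine[of _ "- 1" "- v"]) simp_all
      also have "\<dots> \<le> (\<integral>\<^sup>+w. ennreal J * (ennreal (?N v) * ennreal (?N w)) \<partial>lborel)"
        by (intro nn_integral_mono pw)
      also have "\<dots> = ennreal J * (ennreal (?N v) * (\<integral>\<^sup>+w. ennreal (?N w) \<partial>lborel))"
        by (simp add: nn_integral_cmult)
      also have "\<dots> = ennreal J * ennreal (?N v)" by (simp add: N1)
      finally show ?thesis by (simp add: mult_left_mono)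
    qed
    have "peak_mass (\<le>) K m \<le> (\<integral>\<^sup>+v. ?a * ?b * (ennreal J * ennreal (?N v)) \<partial>lborel)"
      unfolding peak_mass_def by (intro nn_integral_mono inner)
    also have "\<dots> = ?a * ?b * (ennreal J * (\<integral>\<^sup>+v. ennreal (?N v) \<partial>lborel))"
      by (simp add: nn_integral_cmult)
    also have "\<dots> = ennreal (J * (iwp (K + 2) * iwp (m + 2)))"
      by (simp add: N1 ennreal_mult persist_nonneg J_def mult_ac)
    finally show ?thesis .
  qed
  moreover have "J \<ge> 0" by (simp add: J_def)
  ultimately show ?thesis by blast
qed

definition peaks :: "(real \<Rightarrow> real \<Rightarrow> bool) \<Rightarrow> nat \<Rightarrow> real \<Rightarrow> (nat \<Rightarrow> real) \<Rightarrow> ennreal" where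
  "peaks R n s y = (\<Sum>K<n. peak_ind R K (n - Suc K) (s + rwalk y K) y)"

lemma peak_mass_sum:
  assumes R: "le_or_less R"
  shows "(\<Sum>K<n. peak_mass R K (n - Suc K)) =
    (\<integral>\<^sup>+y. \<integral>\<^sup>+s. peaks R n s y \<partial>lborel \<partial>noise)"
proof -
  have m1: "(\<lambda>s. peak_ind R K (n - Suc K) (s + rwalk y K) y) \<in> borel_measurable lborel" for K y
    by (intro measurable_peak_ind[OF R] measurable_const) simp_all
  have m2: "(\<lambda>p. peak_ind R K (n - Suc K) (snd p + rwalk (fst p) K) (fst p)) \<in> borel_measurable (noise \<Otimes>\<^sub>M lborel)" for K
  proof (rule measurable_peak_ind[OF R])
    have "(\<lambda>p. rwalk (fst p) K) \<in> borel_measurable (noise \<Otimes>\<^sub>M lborel)"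
      by (rule measurable_rwalk) simp
    then show "(\<lambda>p. snd p + rwalk (fst p) K) \<in> borel_measurable (noise \<Otimes>\<^sub>M lborel)"
      by (intro borel_measurable_add) simp_all
  qed simp
  have m3: "(\<lambda>y. \<integral>\<^sup>+s. peak_ind R K (n - Suc K) (s + rwalk y K) y \<partial>lborel) \<in> borel_measurable noise" for K
    using lborel.borel_measurable_nn_integral_fst[OF m2[of K]] by simp
  have "(\<integral>\<^sup>+y. \<integral>\<^sup>+s. peaks R n s y \<partial>lborel \<partial>noise) =
    (\<integral>\<^sup>+y. (\<Sum>K<n. \<integral>\<^sup>+s. peak_ind R K (n - Suc K) (s + rwalk y K) y \<partial>lborel) \<partial>noise)"
    unfolding peaks_def by (intro nn_integral_cong nn_integral_sum m1)
  also have "\<dots> = (\<Sum>K<n. \<integral>\<^sup>+y. \<integral>\<^sup>+s. peak_ind R K (n - Suc K) (s + rwalk y K) y \<partial>lborel \<partial>noise)"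
    by (intro nn_integral_sum m3)
  finally show ?thesis by (simp add: peak_mass_eq[OF R])
qed

lemma strict_peak_mass_upper:
  assumes "n \<ge> 1"
  shows "(\<Sum>K<n. peak_mass (<) K (n - Suc K)) \<le> ennreal (2 * sqrt (real n))"
proof -
  have "(\<Sum>K<n. peak_mass (<) K (n - Suc K)) =
    (\<integral>\<^sup>+y. \<integral>\<^sup>+s. peaks (<) n s y \<partial>lborel \<partial>noise)"
    by (rule peak_mass_sum) simp
  also have "\<dots> \<le> (\<integral>\<^sup>+y. ennreal (maxwalk n y) + ennreal (maxwalk n (neg_seq y)) \<partial>noise)"
  proof (rule nn_integral_mono)
    fix y :: "nat \<Rightarrow> real"
    let ?a = "maxwalk n y" and ?b = "maxwalk n (neg_seq y)"
    have "peaks (<) n s y \<le> indicator {- ?a..?b} s" for s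
    proof (cases "\<exists>K<n. peak (<) K (n - Suc K) (s + rwalk y K) y")
      case True
      then obtain K where K: "K < n" "peak (<) K (n - Suc K) (s + rwalk y K) y" by blast
      have "peaks (<) n s y = (\<Sum>K'<n. if K' = K then 1 else 0)"
        unfolding peaks_def
      proof (intro sum.cong refl)
        fix K' assume "K' \<in> {..<n}"
        then have "K' < n" by simp
        show "peak_ind (<) K' (n - Suc K') (s + rwalk y K') y = (if K' = K then 1 else 0)"
        proof (cases "K' = K")
          case True
          then show ?thesis using K by (simp add: peak_ind_def)
        next
          case False
          then have "\<not> peak (<) K' (n - Suc K') (s + rwalk y K') y"
            using strict_peak_unique[OF _ K(2) \<open>K' < n\<close> K(1)] by blast
          then show ?thesis using False by (simp add: peak_ind_def)
        qed
      qed
      also have "\<dots> = 1" using K by simp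
      finally show ?thesis using strict_peak_velocity[OF K(2,1)] by simp
    next
      case False
      then have "peaks (<) n s y = 0"
        unfolding peaks_def by (intro sum.neutral) (auto simp: peak_ind_def)
      then show ?thesis by simp
    qed
    then have "(\<integral>\<^sup>+s. peaks (<) n s y \<partial>lborel) \<le> (\<integral>\<^sup>+s. indicator {- ?a..?b} s \<partial>lborel)"
      by (intro nn_integral_mono)
    also have "\<dots> = ennreal ?a + ennreal ?b"
      using maxwalk_nonneg[of n y] maxwalk_nonneg[of n "neg_seq y"]
      by (simp add: ennreal_plus[symmetric] add.commute del: ennreal_plus)
    finally show "(\<integral>\<^sup>+s. peaks (<) n s y \<partial>lborel) \<le> ennreal ?a + ennreal ?b" .
  qed
  also have "\<dots> = (\<integral>\<^sup>+y. ennreal (maxwalk n y) \<partial>noise) + (\<integral>\<^sup>+y. ennreal (maxwalk n (neg_seq y)) \<partial>noise)"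
    by (rule nn_integral_add) (use measurable_compose[OF measurable_neg_seq measurable_maxwalk[of n]] in simp_all)
  also have "(\<integral>\<^sup>+y. ennreal (maxwalk n (neg_seq y)) \<partial>noise) = (\<integral>\<^sup>+y. ennreal (maxwalk n y) \<partial>distr noise noise neg_seq)"
    by (rule nn_integral_distr[symmetric]) simp_all
  also have "\<dots> = (\<integral>\<^sup>+y. ennreal (maxwalk n y) \<partial>noise)" by (simp only: distr_noise_neg)
  also have "(\<integral>\<^sup>+y. ennreal (maxwalk n y) \<partial>noise) + (\<integral>\<^sup>+y. ennreal (maxwalk n y) \<partial>noise) \<le>
    ennreal (sqrt (real n)) + ennreal (sqrt (real n))"
    by (intro add_mono maxwalk_first_moment assms)
  also have "\<dots> = ennreal (2 * sqrt (real n))" by (simp add: ennreal_plus[symmetric] del: ennreal_plus)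
  finally show ?thesis .
qed

lemma iwalk_upper:
  assumes "n \<ge> 1"
  shows "real n * (iwp n)\<^sup>2 * gauss.prob {..-1} \<le> 2 * sqrt (real n)"
proof -
  let ?p = "iwp n"
  have each: "ennreal (?p\<^sup>2 * gauss.prob {..-1}) \<le>
    (peak_mass (<) K (n - Suc K))" if "K < n" for K
  proof -
    have ge: "ennreal ?p \<le> below (<) k v" if "v > 0" "k \<le> n" for k v
      using below_strict_ge[OF that(1), of k] persist_antimono[OF that(2), of 2 "- 1"]
      by (meson ennreal_leI order_trans)
    have "ennreal (?p\<^sup>2 * gauss.prob {..-1}) = (\<integral>\<^sup>+v. ennreal ?p * ennreal ?p * emeasure gauss {..-1} * indicator {0<..<1::real} v \<partial>lborel)"
      by (simp add: nn_integral_cmult_indicator emeasure_gauss_eq ennreal_mult persist_nonneg power2_eq_square)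
    also have "\<dots> \<le> peak_mass (<) K (n - Suc K)"
      unfolding peak_mass_def
    proof (rule nn_integral_mono)
      fix v :: real
      show "ennreal ?p * ennreal ?p * emeasure gauss {..-1} * indicator {0<..<1} v \<le>
        (\<integral>\<^sup>+u. below (<) K v * below (<) (n - Suc K) (- (v + u)) \<partial>gauss)"
      proof (cases "v \<in> {0<..<1}")
        case True
        have "ennreal ?p * ennreal ?p * emeasure gauss {..-1} = (\<integral>\<^sup>+u. ennreal ?p * ennreal ?p * indicator {..-1} u \<partial>gauss)"
          by (simp add: nn_integral_cmult_indicator)
        also have "\<dots> \<le> (\<integral>\<^sup>+u. below (<) K v * below (<) (n - Suc K) (- (v + u)) \<partial>gauss)"
        proof (rule nn_integral_mono)
          fix u :: real
          show "ennreal ?p * ennreal ?p * indicator {..-1} u \<le> below (<) K v * below (<) (n - Suc K) (- (v + u))"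
            using True \<open>K < n\<close> by (cases "u \<le> -1") (auto intro!: mult_mono ge)
        qed
        finally show ?thesis using True by simp
      qed simp
    qed
    finally show ?thesis .
  qed
  have "ennreal (real n * ?p\<^sup>2 * gauss.prob {..-1}) = (\<Sum>K<n. ennreal (?p\<^sup>2 * gauss.prob {..-1}))"
    by (simp add: ennreal_of_nat_eq_real_of_nat ennreal_mult mult.assoc)
  also have "\<dots> \<le> (\<Sum>K<n. peak_mass (<) K (n - Suc K))"
    by (intro sum_mono each) simp
  also have "\<dots> \<le> ennreal (2 * sqrt (real n))" by (rule strict_peak_mass_upper[OF assms])
  finally show ?thesis by (subst (asm) ennreal_le_iff) auto
qed

lemma weak_peak_mass_lower:
  assumes "n \<ge> 1"
  shows "(\<integral>\<^sup>+y. ennreal (- iwalk y n / real (Suc n)) \<partial>noise) \<le>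
    (\<Sum>K<n. peak_mass (\<le>) K (n - Suc K))"
proof -
  have "(\<integral>\<^sup>+y. ennreal (- iwalk y n / real (Suc n)) \<partial>noise) \<le>
    (\<integral>\<^sup>+y. \<integral>\<^sup>+s. peaks (\<le>) n s y \<partial>lborel \<partial>noise)"
  proof (rule nn_integral_mono)
    fix y :: "nat \<Rightarrow> real"
    define c where "c = - iwalk y n / real (Suc n)"
    have "ennreal c \<le> (\<integral>\<^sup>+s. indicator {0<..c} s \<partial>lborel)"
      by (cases "0 \<le> c") (auto simp: ennreal_neg)
    also have "\<dots> \<le> (\<integral>\<^sup>+s. peaks (\<le>) n s y \<partial>lborel)"
    proof (rule nn_integral_mono)
      fix s :: real
      show "indicator {0<..c} s \<le> peaks (\<le>) n s y"
      proof (cases "s \<in> {0<..c}")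
        case True
        then have "s * real (Suc n) \<le> c * real (Suc n)" by (intro mult_right_mono) auto
        also have "\<dots> = - iwalk y n" by (simp add: c_def del: of_nat_Suc)
        finally have "s * real (Suc n) \<le> - iwalk y n" .
        then have "pos s y (Suc n) \<le> 0" by (simp add: pos_eq_iwalk mult.commute del: of_nat_Suc)
        then obtain K where K: "K < n" "peak (\<le>) K (n - Suc K) (s + rwalk y K) y"
          using weak_peak_exists[of s y n] True assms by auto
        then have "1 = peak_ind (\<le>) K (n - Suc K) (s + rwalk y K) y" by (simp add: peak_ind_def)
        also have "\<dots> \<le> peaks (\<le>) n s y"
          unfolding peaks_def using K by (intro member_le_sum) auto
        finally show ?thesis using True by simp
      qed simp
    qed
    finally show "ennreal (- iwalk y n / real (Suc n)) \<le> (\<integral>\<^sup>+s. peaks (\<le>) n s y \<partial>lborel)"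
      by (simp only: c_def)
  qed
  also have "\<dots> = (\<Sum>K<n. peak_mass (\<le>) K (n - Suc K))"
    by (rule peak_mass_sum[symmetric]) simp
  finally show ?thesis .
qed

lemma iwalk_eq_sum: "iwalk y n = (\<Sum>j<n. real (n - j) * y j)"
proof (induction n)
  case (Suc n)
  have "(\<Sum>j<Suc n. real (Suc n - j) * y j) = (\<Sum>j<n. real (n - j) * y j + y j) + y n"
    by (simp add: Suc_diff_le algebra_simps)
  then show ?case using Suc by (simp add: iwalk_Suc rwalk_def sum.distrib)
qed simp

lemma distributed_noise: "distributed noise lborel (\<lambda>y. y j) (\<lambda>x. ennreal (std_normal_density x))"
  using distr_noise_component[of j] unfolding distributed_def by (simp add: gauss_def cong: distr_cong)

lemma iwalk_prob_below:
  assumes "n \<ge> 1"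
  shows "emeasure noise {y. iwalk y n \<le> - sqrt (\<Sum>j<n. (real (n - j))\<^sup>2)} = emeasure gauss {..-1}"
proof -
  define sd where "sd = sqrt (\<Sum>j<n. (real (n - j))\<^sup>2)"
  have "(\<Sum>j<n. (real (n - j))\<^sup>2) \<ge> (real (n - 0))\<^sup>2"
    using assms by (intro member_le_sum[of 0 _ "\<lambda>j. (real (n - j))\<^sup>2"]) auto
  moreover have "(real (n - 0))\<^sup>2 > 0" using assms by simp
  ultimately have sd: "sd > 0" unfolding sd_def by (intro real_sqrt_gt_zero) linarith
  have "distributed noise lborel (\<lambda>y. \<Sum>j<n. real (n - j) * y j) (normal_density (\<Sum>j<n. 0) (sqrt (\<Sum>j<n. (real (n - j))\<^sup>2)))"
  proof (rule noise.P.sum_indep_normal)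
    show "noise.indep_vars (\<lambda>_. borel) (\<lambda>j y. real (n - j) * y j) {..<n}"
      using noise.indep_vars_compose2[OF noise.indep_vars_subset[OF indep_vars_noise], of "{..<n}" "\<lambda>j x. real (n - j) * x" "\<lambda>_. borel"] by simp
    fix j assume "j \<in> {..<n}"
    then have j: "0 < real (n - j)" by simp
    then show "0 < real (n - j)" .
    have "distributed noise lborel (\<lambda>y. 0 + real (n - j) * y j) (\<lambda>x. ennreal (normal_density (0 + real (n - j) * 0) (\<bar>real (n - j)\<bar> * 1) x))"
      using j by (intro noise.normal_density_affine distributed_noise) auto
    then show "distributed noise lborel (\<lambda>y. real (n - j) * y j) (\<lambda>x. ennreal (normal_density 0 (real (n - j)) x))"
      by simp
  qed (use assms in \<open>auto simp: lessThan_empty_iff\<close>)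
  then have "distributed noise lborel (\<lambda>y. iwalk y n) (\<lambda>x. ennreal (normal_density 0 sd x))"
    by (simp add: iwalk_eq_sum sd_def)
  then have "distributed noise lborel (\<lambda>y. (iwalk y n - 0) / sd) (\<lambda>x. ennreal (std_normal_density x))"
    using noise.normal_standard_normal_convert[OF sd, of "\<lambda>y. iwalk y n" 0] by simp
  then have "distr noise lborel (\<lambda>y. iwalk y n / sd) = gauss" and m: "(\<lambda>y. iwalk y n / sd) \<in> measurable noise lborel"
    unfolding distributed_def gauss_def by simp_all
  then have "emeasure gauss {..-1} = emeasure noise ((\<lambda>y. iwalk y n / sd) -` {..-1} \<inter> space noise)"
    using emeasure_distr[OF m, of "{..-1}"] by simp
  also have "(\<lambda>y. iwalk y n / sd) -` {..-1} \<inter> space noise = {y. iwalk y n \<le> - sd}"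
    using sd by (auto simp: pos_divide_le_eq)
  finally show ?thesis by (simp add: sd_def)
qed

lemma sum_squares_ge: "real n ^ 3 \<le> 3 * (\<Sum>j<n. (real (n - j))\<^sup>2)"
proof (induction n)
  case (Suc n)
  have "(\<Sum>j<Suc n. (real (Suc n - j))\<^sup>2) = (real (Suc n))\<^sup>2 + (\<Sum>j<n. (real (n - j))\<^sup>2)"
    by (subst sum.lessThan_Suc_shift) simp
  moreover have "real (Suc n) ^ 3 \<le> real n ^ 3 + 3 * (real (Suc n))\<^sup>2"
    by (simp add: power3_eq_cube power2_eq_square algebra_simps)
  ultimately show ?case using Suc by simp
qed simp

lemma sqrt_sum_squares_ge: "real n * sqrt (real n) / 2 \<le> sqrt (\<Sum>j<n. (real (n - j))\<^sup>2)"
proof (rule real_le_rsqrt)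
  have "(real n * sqrt (real n) / 2)\<^sup>2 = real n ^ 3 / 4"
    by (simp add: power_divide power_mult_distrib power3_eq_cube power2_eq_square)
  also have "\<dots> \<le> real n ^ 3 / 3" by (intro divide_left_mono) auto
  also have "\<dots> \<le> (\<Sum>j<n. (real (n - j))\<^sup>2)" using sum_squares_ge[of n] by simp
  finally show "(real n * sqrt (real n) / 2)\<^sup>2 \<le> (\<Sum>j<n. (real (n - j))\<^sup>2)" .
qed

lemma iwalk_convolution_lower:
  "\<exists>c>0. \<forall>n\<ge>1. c * sqrt (real n) \<le> (\<Sum>K<n. iwp (K + 2) * iwp (n - Suc K + 2))"
proof -
  obtain J where J: "J \<ge> 0" "\<And>K m. peak_mass (\<le>) K m \<le> ennreal (J * (iwp (K + 2) * iwp (m + 2)))"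
    using weak_peak_mass_bound by blast
  define g where "g = gauss.prob {..-1}"
  have g: "g > 0" using gauss_atMost_pos[of "-1"] by (simp add: g_def emeasure_gauss_eq)
  define c where "c = g / (4 * (J + 1))"
  have "c * sqrt (real n) \<le> (\<Sum>K<n. iwp (K + 2) * iwp (n - Suc K + 2))" if n: "n \<ge> 1" for n
  proof -
    define sd where "sd = sqrt (\<Sum>j<n. (real (n - j))\<^sup>2)"
    define S where "S = (\<Sum>K<n. iwp (K + 2) * iwp (n - Suc K + 2))"
    have S0: "S \<ge> 0" unfolding S_def by (intro sum_nonneg mult_nonneg_nonneg persist_nonneg)
    have sd0: "sd \<ge> 0" unfolding sd_def by (intro real_sqrt_ge_zero sum_nonneg) simp
    have set: "{y. iwalk y n \<le> - sd} \<in> sets noise"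
    proof (rule noise_event)
      show "Measurable.pred noise (\<lambda>y. iwalk y n \<le> - sd)"
        by (intro pred_le_or_less[of "(\<le>)", simplified] measurable_iwalk measurable_ident_sets[OF refl] measurable_const) simp
    qed
    have "ennreal (sd / real (Suc n) * g) = ennreal (sd / real (Suc n)) * emeasure noise {y. iwalk y n \<le> - sd}"
    proof -
      have "emeasure noise {y. iwalk y n \<le> - sd} = ennreal g"
        using iwalk_prob_below[OF n] by (simp only: sd_def g_def emeasure_gauss_eq)
      then show ?thesis using sd0 g by (simp only:) (intro ennreal_mult, auto)
    qed
    also have "\<dots> = (\<integral>\<^sup>+y. ennreal (sd / real (Suc n)) * indicator {y. iwalk y n \<le> - sd} y \<partial>noise)"
      using set by (rule nn_integral_cmult_indicator[symmetric])
    also have "\<dots> \<le> (\<integral>\<^sup>+y. ennreal (- iwalk y n / real (Suc n)) \<partial>noise)"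
    proof (rule nn_integral_mono)
      fix y
      show "ennreal (sd / real (Suc n)) * indicator {y. iwalk y n \<le> - sd} y \<le> ennreal (- iwalk y n / real (Suc n))"
      proof (cases "iwalk y n \<le> - sd")
        case True
        then have "sd / real (Suc n) \<le> - iwalk y n / real (Suc n)" by (intro divide_right_mono) auto
        then have "ennreal (sd / real (Suc n)) \<le> ennreal (- iwalk y n / real (Suc n))" by (rule ennreal_leI)
        then show ?thesis using True by simp
      qed simp
    qed
    also note weak_peak_mass_lower[OF n]
    also have "(\<Sum>K<n. peak_mass (\<le>) K (n - Suc K)) \<le>
      (\<Sum>K<n. ennreal (J * (iwp (K + 2) * iwp (n - Suc K + 2))))"
      by (intro sum_mono J(2))
    also have "\<dots> = ennreal (J * S)"
      unfolding S_def sum_distrib_left using J(1) by (intro sum_ennreal mult_nonneg_nonneg persist_nonneg)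
    finally have "sd / real (Suc n) * g \<le> J * S"
      using J(1) S0 by (subst (asm) ennreal_le_iff) auto
    also have "\<dots> \<le> (J + 1) * S" using S0 by (intro mult_right_mono) auto
    finally have 1: "sd / real (Suc n) * g \<le> (J + 1) * S" .
    have "real n * (sqrt (real n) / 4) * 2 \<le> sd"
      using sqrt_sum_squares_ge[of n] by (simp add: sd_def)
    moreover have "real (Suc n) \<le> real n * 2" using n by simp
    then have "real (Suc n) * (sqrt (real n) / 4) \<le> real n * 2 * (sqrt (real n) / 4)"
      by (rule mult_right_mono) simp
    ultimately have "sqrt (real n) / 4 \<le> sd / real (Suc n)"
      by (simp add: pos_le_divide_eq mult_ac del: of_nat_Suc)
    then have "sqrt (real n) / 4 * g \<le> sd / real (Suc n) * g" using g by (intro mult_right_mono) auto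
    also note 1
    finally have "sqrt (real n) / 4 * g / (J + 1) \<le> S" using J(1) by (subst pos_divide_le_eq) (simp_all add: mult_ac)
    moreover have "c * sqrt (real n) = sqrt (real n) / 4 * g / (J + 1)" by (simp add: c_def)
    ultimately show ?thesis unfolding S_def by simp
  qed
  moreover have "c > 0" using g J by (simp add: c_def)
  ultimately show ?thesis by blast
qed

lemma iwalk_upper_powr:
  "\<exists>C>0. \<forall>n\<ge>1. iwp n \<le> C * real n powr (- 1 / 4)"
proof -
  define g where "g = gauss.prob {..-1}"
  have g: "g > 0" using gauss_atMost_pos[of "-1"] by (simp add: g_def emeasure_gauss_eq)
  define C where "C = sqrt (2 / g)"
  have C: "C > 0" using g by (simp add: C_def)
  have "iwp n \<le> C * real n powr (- 1 / 4)" if n: "n \<ge> 1" for n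
  proof (rule power2_le_imp_le)
    have "sqrt (real n) * (sqrt (real n) * (iwp n)\<^sup>2 * g) \<le> sqrt (real n) * 2"
      using iwalk_upper[OF n] by (simp add: g_def mult.assoc[symmetric] mult.commute)
    then have "sqrt (real n) * (iwp n)\<^sup>2 * g \<le> 2"
      using n by (simp add: mult_le_cancel_left_pos)
    then have "(iwp n)\<^sup>2 \<le> 2 / g * (1 / sqrt (real n))"
      using g n by (simp add: field_simps)
    also have "1 / sqrt (real n) = real n powr (- 1 / 2)"
      using powr_minus[of "real n" "1 / 2"] by (simp add: powr_half_sqrt inverse_eq_divide)
    also have "\<dots> = (real n powr (- 1 / 4))\<^sup>2"
      using n by (simp add: power2_eq_square powr_add[symmetric])
    also have "2 / g * (real n powr (- 1 / 4))\<^sup>2 = (C * real n powr (- 1 / 4))\<^sup>2"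
      using g by (simp add: C_def power_mult_distrib)
    finally show "(iwp n)\<^sup>2 \<le> (C * real n powr (- 1 / 4))\<^sup>2" .
    show "0 \<le> C * real n powr (- 1 / 4)" using C by simp
  qed
  then show ?thesis using C by blast
qed

lemma sum_powr_quarter: "(\<Sum>k=1..n. real k powr (- 1 / 4)) \<le> 2 * real n powr (3 / 4)"
proof (induction n)
  case (Suc n)
  define x y where "x = real (Suc n) powr (1 / 4)" and "y = real n powr (1 / 4)"
  have x: "x > 0" and y: "y \<ge> 0" and xy: "y \<le> x"
    by (auto simp: x_def y_def intro!: powr_mono2)
  have x4: "x ^ 4 = real (Suc n)" and x3: "x ^ 3 = real (Suc n) powr (3 / 4)"
    unfolding x_def by (simp_all add: powr_power)
  have y4: "y ^ 4 = real n" and y3: "y ^ 3 = real n powr (3 / 4)"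
    unfolding y_def by (cases "n = 0"; simp add: powr_power)+
  have xm: "real (Suc n) powr (- 1 / 4) = 1 / x"
    unfolding x_def using powr_minus[of "real (Suc n)" "1 / 4"] by (simp add: inverse_eq_divide)
  have "0 \<le> (x - y) * (x ^ 3 + x\<^sup>2 * y + x * y\<^sup>2 - y ^ 3)"
  proof (intro mult_nonneg_nonneg)
    have "y ^ 3 \<le> x ^ 3" using xy y by (rule power_mono)
    moreover have "0 \<le> x\<^sup>2 * y + x * y\<^sup>2" using x y by simp
    ultimately show "0 \<le> x ^ 3 + x\<^sup>2 * y + x * y\<^sup>2 - y ^ 3" by linarith
  qed (use xy in simp)
  also have "\<dots> = 2 * (x ^ 4 - x * y ^ 3) - (x ^ 4 - y ^ 4)"
    by (simp add: power2_eq_square power3_eq_cube power4_eq_xxxx algebra_simps)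
  finally have "1 \<le> 2 * (x ^ 4 - x * y ^ 3)" by (simp add: x4 y4)
  also have "\<dots> = (2 * x ^ 3 - 2 * y ^ 3) * x"
    by (simp add: power3_eq_cube power4_eq_xxxx algebra_simps)
  finally have "1 / x \<le> 2 * x ^ 3 - 2 * y ^ 3" using x by (simp add: pos_divide_le_eq)
  then show ?case using Suc unfolding x3 y3 xm[symmetric] by simp
qed simp

lemma iwalk_lower_powr:
  "\<exists>c>0. \<forall>h\<ge>1. c * real h powr (- 1 / 4) \<le> iwp h"
proof -
  let ?p = "iwp"
  obtain C where C: "C > 0" "\<And>n. n \<ge> 1 \<Longrightarrow> ?p n \<le> C * real n powr (- 1 / 4)"
    using iwalk_upper_powr by blast
  obtain c where c: "c > 0" "\<And>n. n \<ge> 1 \<Longrightarrow> c * sqrt (real n) \<le> (\<Sum>K<n. ?p (K + 2) * ?p (n - Suc K + 2))"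
    using iwalk_convolution_lower by blast
  define d where "d = c / (4 * C * 3 powr (3 / 4))"
  have "d * real h powr (- 1 / 4) \<le> ?p h" if h: "h \<ge> 1" for h
  proof -
    define n where "n = 2 * h"
    have n: "n \<ge> 1" using h by (simp add: n_def)
    have each: "?p (K + 2) * ?p (n - Suc K + 2) \<le> ?p h * (?p (K + 2) + ?p (n - Suc K + 2))" if "K < n" for K
    proof (cases "h \<le> K + 2")
      case True
      have "?p (K + 2) * ?p (n - Suc K + 2) \<le> ?p h * ?p (n - Suc K + 2)"
        using True by (intro mult_right_mono persist_antimono persist_nonneg)
      also have "\<dots> \<le> ?p h * (?p (K + 2) + ?p (n - Suc K + 2))"
        by (intro mult_left_mono) (auto simp: persist_nonneg)
      finally show ?thesis .
    next
      case False
      then have "h \<le> n - Suc K + 2" by (simp add: n_def)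
      then have "?p (K + 2) * ?p (n - Suc K + 2) \<le> ?p (K + 2) * ?p h"
        by (intro mult_left_mono persist_antimono persist_nonneg)
      also have "\<dots> \<le> ?p h * (?p (K + 2) + ?p (n - Suc K + 2))"
        unfolding mult.commute[of _ "?p h"] by (intro mult_left_mono) (auto simp: persist_nonneg)
      finally show ?thesis .
    qed
    have pK: "?p (K + 2) \<le> C * real (Suc K) powr (- 1 / 4)" for K
      using C(2)[of "Suc K"] persist_antimono[of "Suc K" "K + 2" 2 "- 1"] by simp
    have sumC: "(\<Sum>K<n. C * real (Suc K) powr (- 1 / 4)) \<le> C * (2 * real n powr (3 / 4))"
    proof -
      have "(\<Sum>K<n. real (Suc K) powr (- 1 / 4)) = (\<Sum>k=1..n. real k powr (- 1 / 4))"
        by (rule sum.reindex_bij_witness[of _ "\<lambda>k. k - 1" Suc]) auto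
      then show ?thesis
        unfolding sum_distrib_left[symmetric] using sum_powr_quarter[of n] C(1) by (intro mult_left_mono) auto
    qed
    have s1: "(\<Sum>K<n. ?p (K + 2)) \<le> C * (2 * real n powr (3 / 4))"
      by (rule order_trans[OF sum_mono[OF pK] sumC])
    have s2: "(\<Sum>K<n. ?p (n - Suc K + 2)) \<le> C * (2 * real n powr (3 / 4))"
      using s1 sum.nat_diff_reindex[of "\<lambda>K. ?p (K + 2)" n] by simp
    have "c * sqrt (real n) \<le> (\<Sum>K<n. ?p h * (?p (K + 2) + ?p (n - Suc K + 2)))"
      by (rule order_trans[OF c(2)[OF n] sum_mono]) (use each in auto)
    also have "\<dots> = ?p h * ((\<Sum>K<n. ?p (K + 2)) + (\<Sum>K<n. ?p (n - Suc K + 2)))"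
      by (simp add: sum_distrib_left sum.distrib distrib_left)
    also have "\<dots> \<le> ?p h * (C * (2 * real n powr (3 / 4)) + C * (2 * real n powr (3 / 4)))"
      by (intro mult_left_mono add_mono s1 s2 persist_nonneg)
    finally have main: "c * sqrt (real n) \<le> ?p h * (4 * C * real n powr (3 / 4))"
      by (simp add: algebra_simps)
    have "c * sqrt (real h) \<le> c * sqrt (real n)" using c(1) by (simp add: n_def)
    also note main
    also have "?p h * (4 * C * real n powr (3 / 4)) \<le> ?p h * (4 * C * (3 powr (3 / 4) * real h powr (3 / 4)))"
    proof (intro mult_left_mono persist_nonneg)
      have "real n powr (3 / 4) \<le> (3 * real h) powr (3 / 4)" by (intro powr_mono2) (auto simp: n_def)
      then show "real n powr (3 / 4) \<le> 3 powr (3 / 4) * real h powr (3 / 4)" by (simp add: powr_mult)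
    qed (use C in auto)
    also have "\<dots> = (?p h * (4 * C * 3 powr (3 / 4))) * real h powr (3 / 4)" by (simp add: mult_ac)
    finally have "c * (real h powr (1 / 2) * real h powr (- 3 / 4)) \<le> (?p h * (4 * C * 3 powr (3 / 4))) * (real h powr (3 / 4) * real h powr (- 3 / 4))"
      using mult_right_mono[of _ _ "real h powr (- 3 / 4)"] h by (simp add: powr_half_sqrt mult.assoc)
    moreover have "real h powr (1 / 2) * real h powr (- 3 / 4) = real h powr (- 1 / 4)"
      "real h powr (3 / 4) * real h powr (- 3 / 4) = 1"
      using h by (simp_all add: powr_add[symmetric])
    ultimately have "c * real h powr (- 1 / 4) \<le> ?p h * (4 * C * 3 powr (3 / 4))" by simp
    then show ?thesis using C by (simp add: d_def pos_divide_le_eq)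
  qed
  moreover have "d > 0" using c C by (simp add: d_def)
  ultimately show ?thesis by blast
qed

lemma persist_iwalk_bigtheta: "iwp \<in> \<Theta>(\<lambda>N. real N powr (- 1 / 4))"
proof -
  obtain C where C: "C > 0" "\<And>n. n \<ge> 1 \<Longrightarrow> iwp n \<le> C * real n powr (- 1 / 4)"
    using iwalk_upper_powr by blast
  obtain c where c: "c > 0" "\<And>n. n \<ge> 1 \<Longrightarrow> c * real n powr (- 1 / 4) \<le> iwp n"
    using iwalk_lower_powr by blast
  have "iwp \<in> O(\<lambda>N. real N powr (- 1 / 4))"
    using C(2) by (intro bigoI[of _ C] eventually_at_top_linorderI[of 1]) (simp add: persist_nonneg)
  moreover have "(\<lambda>N. real N powr (- 1 / 4)) \<in> O(iwp)"
    using c by (intro bigoI[of _ "1 / c"] eventually_at_top_linorderI[of 1])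
      (simp add: persist_nonneg pos_le_divide_eq mult.commute)
  ultimately show ?thesis by (simp add: bigtheta_def bigomega_iff_bigo)
qed

section \<open>Separation of the decay rates\<close>

abbreviation powr_le :: "real \<Rightarrow> (nat \<Rightarrow> real) \<Rightarrow> bool" where
  "powr_le \<alpha> p \<equiv> \<forall>\<^sub>F N in at_top. real N powr \<alpha> \<le> p N"

abbreviation le_powr :: "(nat \<Rightarrow> real) \<Rightarrow> real \<Rightarrow> bool" where
  "le_powr p \<beta> \<equiv> \<forall>\<^sub>F N in at_top. p N \<le> real N powr \<beta>"

lemma eventually_powr_exponents_le:
  fixes p :: "nat \<Rightarrow> real"
  assumes "powr_le \<alpha> p" "le_powr p \<beta>"
  shows "\<alpha> \<le> \<beta>"
proof -
  have "\<forall>\<^sub>F N :: nat in at_top. \<alpha> \<le> \<beta>"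
    using assms eventually_gt_at_top[of 1]
  proof eventually_elim
    case (elim N)
    then have "real N powr \<alpha> \<le> real N powr \<beta>" by linarith
    then show ?case using elim by simp
  qed
  then show ?thesis by simp
qed

lemma bigtheta_powr_window:
  assumes "p \<in> \<Theta>(\<lambda>N. real N powr q)" "\<And>N. p N \<ge> 0" "\<epsilon> > 0"
  shows "powr_le (q - \<epsilon>) p" "le_powr p (q + \<epsilon>)"
proof -
  have large: "\<forall>\<^sub>F N in at_top. C \<le> real N powr \<epsilon>" for C
  proof -
    have "filterlim (\<lambda>N. real N powr \<epsilon>) at_top at_top" using assms(3) by real_asymp
    then show ?thesis by (simp add: filterlim_at_top)
  qed
  obtain C where "\<forall>\<^sub>F N in at_top. norm (p N) \<le> C * norm (real N powr q)"
    using bigthetaD1[OF assms(1)] by (rule landau_o.bigE)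
  then show "le_powr p (q + \<epsilon>)" using large[of C]
  proof eventually_elim
    case (elim N)
    have "C * real N powr q \<le> real N powr \<epsilon> * real N powr q" using elim by (intro mult_right_mono) auto
    then show ?case using elim assms(2)[of N] by (simp add: powr_add mult.commute)
  qed
  obtain c where "c > 0" "\<forall>\<^sub>F N in at_top. norm (p N) \<ge> c * norm (real N powr q)"
    using bigthetaD2[OF assms(1)] by (rule landau_omega.bigE)
  from this(2) large[of "1 / c"] eventually_gt_at_top[of 0] show "powr_le (q - \<epsilon>) p"
  proof eventually_elim
    case (elim N)
    have "1 \<le> c * real N powr \<epsilon>" using elim \<open>c > 0\<close> by (simp add: pos_divide_le_eq mult.commute)
    then have "real N powr (q - \<epsilon>) * 1 \<le> real N powr (q - \<epsilon>) * (c * real N powr \<epsilon>)"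
      by (intro mult_left_mono) auto
    also have "\<dots> = c * real N powr q" by (simp add: powr_add[symmetric])
    finally show ?case using elim assms(2)[of N] by simp
  qed
qed

lemma limit_imp_bigtheta:
  assumes "L > 0" "p \<longlonglongrightarrow> L"
  shows "p \<in> \<Theta>(\<lambda>N. real N powr 0)"
proof -
  have "p \<sim>[at_top] (\<lambda>_. L)" using assms by (intro tendsto_imp_asymp_equiv_const) auto
  then have "p \<in> \<Theta>(\<lambda>_. L)" by (rule asymp_equiv_imp_bigtheta)
  also have "(\<lambda>_. L) \<in> \<Theta>(\<lambda>N :: nat. real N powr 0)" using assms(1) by real_asymp
  finally show ?thesis .
qed

lemma asymp_equiv_inverse_imp_bigtheta:
  assumes "c > 0" "p \<sim>[at_top] (\<lambda>N. c / real N)"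
  shows "p \<in> \<Theta>(\<lambda>N. real N powr (- 1))"
proof -
  have "p \<in> \<Theta>(\<lambda>N. c / real N)" using assms(2) by (rule asymp_equiv_imp_bigtheta)
  also have "(\<lambda>N. c / real N) \<in> \<Theta>(\<lambda>N. real N powr (- 1))" using assms(1) by real_asymp
  finally show ?thesis .
qed

lemma half_window:
  assumes "e \<longlonglongrightarrow> 0" "\<forall>\<^sub>F N in at_top. p N = real N powr (- 1 / 2 + e N)"
  shows "powr_le (- 6 / 10) p" "le_powr p (- 4 / 10)"
proof -
  have "\<forall>\<^sub>F N in at_top. - 1 / 10 < e N" "\<forall>\<^sub>F N in at_top. e N < 1 / 10"
    by (rule order_tendstoD[OF assms(1)]; simp)+
  then have "\<forall>\<^sub>F N in at_top. real N powr (- 6 / 10) \<le> p N \<and> p N \<le> real N powr (- 4 / 10)"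
    using assms(2) eventually_gt_at_top[of 1]
    by eventually_elim (auto intro!: powr_mono)
  then show "powr_le (- 6 / 10) p" "le_powr p (- 4 / 10)"
    by (auto elim: eventually_mono)
qed

lemma exp_window:
  fixes p :: "nat \<Rightarrow> real"
  assumes "l > 0" "p \<in> O(\<lambda>N. exp (- l * real N))"
  shows "le_powr p (- 2)"
proof -
  obtain C where C: "C > 0" "\<forall>\<^sub>F N in at_top. norm (p N) \<le> C * norm (exp (- l * real N))"
    using assms(2) by (rule landau_o.bigE)
  have "\<forall>\<^sub>F N in at_top. C * exp (- l * real N) \<le> real N powr (- 2)" using C(1) assms(1) by real_asymp
  with C(2) show ?thesis by eventually_elim auto
qed

lemma persist_limit_regionC:
  assumes "(a, b) \<in> regionC"
  shows "\<exists>L>0. persist a b \<longlonglongrightarrow> L"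
proof -
  obtain \<delta> where \<delta>: "\<delta> > 0" "\<And>n. ennreal \<delta> \<le> surv a b n 0 0"
    using surv_lower_regionC[OF assms] by blast
  have low: "\<delta> \<le> persist a b n" for n
    using \<delta>(2)[of n] by (simp add: surv_eq_persist persist_nonneg)
  have "decseq (persist a b)" by (auto simp: decseq_def persist_antimono)
  then obtain L where "persist a b \<longlonglongrightarrow> L" "\<forall>n. L \<le> persist a b n"
    using decseq_convergent[of "persist a b" \<delta>] low by blast
  moreover have "\<delta> \<le> L"
    using calculation(1) low by (intro LIMSEQ_le_const) auto
  ultimately show ?thesis using \<delta> by (intro exI[of _ L]) auto
qed

lemma persist_exp_regionE:
  assumes "(a, b) \<in> regionE"
  shows "\<exists>l>0. persist a b \<in> O(\<lambda>N. exp (- l * real N))"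
proof -
  obtain C \<eta> where \<eta>: "0 < \<eta>" "\<eta> < 1" "\<And>n. surv a b n 0 0 \<le> ennreal (C * \<eta> ^ n)"
    using exp_decay_regionE[OF assms] unfolding exp_decay_def by blast
  have "persist a b n \<le> \<bar>C\<bar> * exp (- (- ln \<eta>) * real n)" for n
  proof -
    have "C * \<eta> ^ n \<le> \<bar>C\<bar> * \<eta> ^ n" using \<eta> by (intro mult_right_mono) auto
    then have "ennreal (persist a b n) \<le> ennreal (\<bar>C\<bar> * \<eta> ^ n)"
      using \<eta>(3)[of n] unfolding surv_eq_persist by (meson ennreal_leI order_trans)
    then have "persist a b n \<le> \<bar>C\<bar> * \<eta> ^ n" using \<eta> by (subst (asm) ennreal_le_iff) auto
    also have "\<eta> ^ n = exp (- (- ln \<eta>) * real n)"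
      using \<eta> exp_of_nat_mult[of n "ln \<eta>"] by (simp add: mult.commute)
    finally show ?thesis .
  qed
  then have "persist a b \<in> O(\<lambda>N. exp (- (- ln \<eta>) * real N))"
    by (intro bigoI[of _ "\<bar>C\<bar>"]) (simp add: persist_nonneg)
  then show ?thesis using \<eta> by (intro exI[of _ "- ln \<eta>"]) auto
qed

theorem theorem1p4:
  fixes M :: "'w measure" and Y :: "nat \<Rightarrow> 'w \<Rightarrow> real"
    and a1 a2 \<sigma> :: real
  assumes "prob_space M"
    and "prob_space.indep_vars M (\<lambda>_. borel) Y {1..}"
    and "\<sigma> > 0"
    and "\<And>n. n \<ge> 1 \<Longrightarrow> distributed M lborel (Y n) (\<lambda>x. ennreal (normal_density 0 \<sigma> x))"
  defines "p \<equiv> persist_prob M Y a1 a2"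
  shows "((\<exists>L>0. p \<longlonglongrightarrow> L) \<longleftrightarrow> (a1, a2) \<in> regionC)
       \<and> ((\<exists>c>0. p \<sim>[at_top] (\<lambda>N. c / real N)) \<longleftrightarrow> (a1, a2) = (0, 1))
       \<and> (p \<in> \<Theta>(\<lambda>N. real N powr (-1/4)) \<longleftrightarrow> (a1, a2) = (2, -1))
       \<and> ((\<exists>e. e \<longlonglongrightarrow> 0 \<and> (\<forall>\<^sub>F N in at_top. p N = real N powr (-1/2 + e N)))
            \<longleftrightarrow> (a1, a2) \<in> regionP \<and> \<bar>a2\<bar> < 1)
       \<and> ((\<exists>l>0. p \<in> O(\<lambda>N. exp (- l * real N))) \<longleftrightarrow> (a1, a2) \<in> regionE)"
proof -
  have p: "p = persist a1 a2"
    unfolding p_def persist_def[abs_def] using persist_prob_eq_surv[OF assms(1-4)] by (intro ext)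
  define A where "A \<longleftrightarrow> (\<exists>L>0. p \<longlonglongrightarrow> L)"
  define B where "B \<longleftrightarrow> (\<exists>c>0. p \<sim>[at_top] (\<lambda>N. c / real N))"
  define Q where "Q \<longleftrightarrow> p \<in> \<Theta>(\<lambda>N. real N powr (-1/4))"
  define H where "H \<longleftrightarrow> (\<exists>e. e \<longlonglongrightarrow> 0 \<and> (\<forall>\<^sub>F N in at_top. p N = real N powr (-1/2 + e N)))"
  define X where "X \<longleftrightarrow> (\<exists>l>0. p \<in> O(\<lambda>N. exp (- l * real N)))"
  have p0: "p N \<ge> 0" for N by (simp add: p persist_nonneg)
  have A_lo: "powr_le (0 - 1 / 10) p" if A
    using that bigtheta_powr_window(1)[OF limit_imp_bigtheta p0, where \<epsilon> = "1 / 10"] unfolding A_def by fastforce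
  have B_lo: "powr_le (- 1 - 1 / 10) p" and B_up: "le_powr p (- 1 + 1 / 10)" if B
    using that bigtheta_powr_window[OF asymp_equiv_inverse_imp_bigtheta p0, where \<epsilon> = "1 / 10"]
    unfolding B_def by fastforce+
  have Q_lo: "powr_le (- 1 / 4 - 1 / 20) p" and Q_up: "le_powr p (- 1 / 4 + 1 / 20)" if Q
    using that bigtheta_powr_window[of p "- 1 / 4" "1 / 20"] p0 unfolding Q_def by simp_all
  have H_lo: "powr_le (- 6 / 10) p"
    and H_up: "le_powr p (- 4 / 10)" if H
    using that half_window unfolding H_def by blast+
  have X_up: "le_powr p (- 2)" if X
    using that exp_window unfolding X_def by blast
  note cmp = eventually_powr_exponents_le[of _ p]
  have excl: "\<not> (A \<and> Q)" "\<not> (A \<and> H)" "\<not> (A \<and> B)" "\<not> (A \<and> X)" "\<not> (Q \<and> H)"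
    "\<not> (Q \<and> B)" "\<not> (Q \<and> X)" "\<not> (H \<and> B)" "\<not> (H \<and> X)" "\<not> (B \<and> X)"
    using cmp[OF A_lo Q_up] cmp[OF A_lo H_up] cmp[OF A_lo B_up] cmp[OF A_lo X_up] cmp[OF Q_lo H_up]
      cmp[OF Q_lo B_up] cmp[OF Q_lo X_up] cmp[OF H_lo B_up] cmp[OF H_lo X_up] cmp[OF B_lo X_up]
    by auto
  have C: A if "(a1, a2) \<in> regionC"
    using persist_limit_regionC[OF that] by (simp add: A_def p)
  have Z: B if "(a1, a2) = (0, 1)"
    unfolding B_def p using that persist_0_1_asymptotic by (intro exI[of _ "2 / pi"]) auto
  have I: Q if "(a1, a2) = (2, -1)"
    unfolding Q_def p using that persist_iwalk_bigtheta by simp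
  have P: H if "(a1, a2) \<in> regionP \<and> \<bar>a2\<bar> < 1"
  proof -
    have "a1 = 1 + (- a2)" "a2 = - (- a2)" "\<bar>- a2\<bar> < 1" using that by (auto simp: regionP_def)
    then show ?thesis unfolding H_def p using persist_unit_root_exponent[of "- a2"] by metis
  qed
  have E: X if "(a1, a2) \<in> regionE"
    using persist_exp_regionE[OF that] by (simp add: X_def p)
  have cover: "(a1, a2) \<in> regionC \<or> (a1, a2) = (0, 1) \<or> (a1, a2) = (2, -1) \<or>
    ((a1, a2) \<in> regionP \<and> \<bar>a2\<bar> < 1) \<or> (a1, a2) \<in> regionE"
    by (auto simp: regionE_def regionP_def)
  show ?thesis
    unfolding A_def[symmetric] B_def[symmetric] Q_def[symmetric] H_def[symmetric] X_def[symmetric]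
    using C Z I P E cover excl by argo
qed

end
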